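(* Let $g',g,d',d\in\mathbb N$ and let $h:\mathcal B_{g'\times g}\to\mathcal B_{d'\times d}$ be an NC ball map with $h(0)=0$. Then there exist unitaries $U:\mathbb C^d\to\mathbb C^d$ and $V:\mathbb C^{d'}\to\mathbb C^{d'}$ such that $$h(x)=V\begin{bmatrix} x&0\\0&\tilde h(x)\end{bmatrix}U^*,$$ where $\tilde h:\mathcal B_{g'\times g}\to\mathcal B_{(d'-g')\times(d-g)}$ is an NC analytic contraction-valued map with $\tilde h(0)=0$. Conversely, every NC analytic $h$ satisfying the displayed identity for some unitaries $U,V$ and some NC analytic contraction-valued map $\tilde h$ fixing the origin is an NC ball map $\mathcal B_{g'\times g}\to\mathcal B_{d'\times d}$ sending $0$ to $0$.
   Context: For $N\in\mathbb N$, $\mathcal M_{d'\times d}(N)$ is the set of $d'\times d$ block matrices $X=[X_{j\ell}]$ with $X_{j\ell}\in\mathbb C^{N\times N}$, regarded as $d'N\times dN$ matrices with the operator norm; $\mathcal M_{d'\times d}=\bigsqcup_N\mathcal M_{d'\times d}(N)$. Put $\mathcal B_{d'\times d}=\{X\in\mathcal M_{d'\times d}:\|X\|\le1\}$ and $\operatorname{int}\mathcal B_{d'\times d}=\{X\in\mathcal M_{d'\times d}:\|X\|<1\}$. NC analytic functions: let $x=(x_{j\ell})$ be $g'g$ noncommuting variables and $\langle x\rangle$ the set of words in them; for $X\in\mathcal M_{g'\times g}(N)$, $w(X)\in\mathbb C^{N\times N}$ is the evaluation of the word $w$ (with $w(X)=I_N$ for the empty word). An NC analytic function $f:\mathcal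 B_{g'\times g}\to\mathcal M_{d'\times d}$ assigns to each $X\in\operatorname{int}\mathcal B_{g'\times g}$ of size $N$ a matrix $f(X)\in\mathcal M_{d'\times d}(N)$, such that: (1) there are $a_w\in\mathbb C^{d'\times d}$ ($w\in\langle x\rangle$) and $\varepsilon>0$ such that for all $N$ and all $X\in\mathcal M_{g'\times g}(N)$ with $\|X\|<\varepsilon$, $f(X)=\sum_{\alpha=0}^\infty\sum_{|w|=\alpha}a_w\otimes w(X)$, the outer sum converging; (2) for every analytic $a$ from a domain $W\subseteq\mathbb C^K$ into $\operatorname{int}\mathcal B_{g'\times g}$ (at a fixed size $N$), $f\circ a$ is analytic on $W$, and continuous up to $\partial W$ whenever $a$ extends continuously to $\overline W$ with values in $\operatorname{int}\mathcal B_{g'\times g}$. (So an "NC analytic function on $\mathcal B_{g'\times g}$" is defined on the interior.) $f(0)$ denotes the value at $0\in\mathcal M_{g'\times g}(1)$, i.e. $a_\emptyset$. For $\|X\|=1$ and $t\in\mathbb R$, $f(e^{it}X)$ denotes $\lim_{r\nearrow1}f(re^{it}X)$ when this limit exists. An NC ball map $f:\mathcal B_{g'\times g}\to\mathcal B_{d'\times d}$ is an NC analytic function with values in $\mathcal B_{d'\times d}$ such that $\|f(e^{it}X)\|=1$ whenever $\|X\|=1$ and $f(e^{it}X)$ exists. Contraction-valued means $\|\tilde h(X)\|\le1$ for all $X$ in the interior. The identity for $h$ means: for all $N$ and $X\in\operatorname{int}\mathcal B_{g'\times g}$ of size $N$, $h(X)=(V\otimes I_N)\begin{bmatrix}X&0\\0&\tilde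 h(X)\end{bmatrix}(U\otimes I_N)^*$. It is understood to include $g'\le d'$ and $g\le d$; block rows or columns of size zero are absent. *)

theory Defs
  imports
    "HOL-Complex_Analysis.Complex_Analysis"
    "Jordan_Normal_Form.Schur_Decomposition"
begin

unbundle no vec_syntax

section \<open>Operator norm, limits of matrices, Kronecker products\<close>

definition l2_vec_norm :: "complex vec \<Rightarrow> real" where
  "l2_vec_norm v = sqrt (\<Sum>i<dim_vec v. (cmod (v $ i))\<^sup>2)"

text \<open>Matrices without rows or without columns are allowed and have norm 0.\<close>

definition mat_opnorm :: "complex mat \<Rightarrow> real" where
  "mat_opnorm A =
     (SUP v \<in> {v \<in> carrier_vec (dim_col A). l2_vec_norm v \<le> 1}. l2_vec_norm (A *\<^sub>v v))"

definition mat_tendsto :: "('x \<Rightarrow> complex mat) \<Rightarrow> complex mat \<Rightarrow> 'x filter \<Rightarrow> bool" where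
  "mat_tendsto F L \<F> \<longleftrightarrow>
     (\<forall>\<^sub>F x in \<F>. F x \<in> carrier_mat (dim_row L) (dim_col L)) \<and>
     ((\<lambda>x. mat_opnorm (F x - L)) \<longlongrightarrow> 0) \<F>"

definition mat_continuous_on :: "'x::topological_space set \<Rightarrow> ('x \<Rightarrow> complex mat) \<Rightarrow> bool" where
  "mat_continuous_on S F \<longleftrightarrow> (\<forall>x\<in>S. mat_tendsto F (F x) (at x within S))"

text \<open>With respect to the block structure used below, an \<open>m \<times> n\<close> block matrix with blocks of size
  \<open>N\<close> has its \<open>(p, q)\<close> entry of block \<open>(j, l)\<close> at position \<open>(j * N + p, l * N + q)\<close>. The Kronecker
  product follows the same convention: block \<open>(j, l)\<close> of \<open>A \<otimes> B\<close> is \<open>A\<^sub>j\<^sub>l B\<close>.\<close>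

definition kron :: "complex mat \<Rightarrow> complex mat \<Rightarrow> complex mat" where
  "kron A B = Matrix.mat (dim_row A * dim_row B) (dim_col A * dim_col B)
     (\<lambda>(i, j). A $$ (i div dim_row B, j div dim_col B) * B $$ (i mod dim_row B, j mod dim_col B))"

definition unitary_mat :: "nat \<Rightarrow> complex mat \<Rightarrow> bool" where
  "unitary_mat n U \<longleftrightarrow>
     U \<in> carrier_mat n n \<and> U * mat_adjoint U = 1\<^sub>m n \<and> mat_adjoint U * U = 1\<^sub>m n"


section \<open>Analytic matrix-valued functions of several complex variables\<close>

text \<open>\<open>\<complex>\<^sup>K\<close> is the space of sequences supported on \<open>{..<K}\<close>. The subspace topology it inherits from the
  product topology on \<^typ>\<open>nat \<Rightarrow> complex\<close> is the usual one, and it is a closed subset, so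
  \<^const>\<open>closure\<close> and \<^const>\<open>connected\<close> have their usual meaning for subsets of \<open>\<complex>\<^sup>K\<close>.\<close>

definition cspace :: "nat \<Rightarrow> (nat \<Rightarrow> complex) set" where
  "cspace K = {z. \<forall>i\<ge>K. z i = 0}"

definition cdomain :: "nat \<Rightarrow> (nat \<Rightarrow> complex) set \<Rightarrow> bool" where
  "cdomain K W \<longleftrightarrow> openin (top_of_set (cspace K)) W \<and> connected W \<and> W \<noteq> {}"

text \<open>Analytic means locally the sum of a power series, summed over the multi-indices \<open>\<alpha>\<close>;
  \<^const>\<open>has_sum\<close> is unordered, hence absolute, convergence.\<close>

definition analytic_several ::
  "nat \<Rightarrow> (nat \<Rightarrow> complex) set \<Rightarrow> ((nat \<Rightarrow> complex) \<Rightarrow> complex) \<Rightarrow> bool" where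
  "analytic_several K W \<phi> \<longleftrightarrow>
     (\<forall>c\<in>W. \<exists>r>0. \<exists>b :: (nat \<Rightarrow> nat) \<Rightarrow> complex. \<forall>z\<in>W. (\<forall>i<K. cmod (z i - c i) < r) \<longrightarrow>
        ((\<lambda>\<alpha>. b \<alpha> * (\<Prod>i<K. (z i - c i) ^ \<alpha> i)) has_sum \<phi> z) {\<alpha>. \<forall>i\<ge>K. \<alpha> i = 0})"

definition mat_analytic_several ::
  "nat \<Rightarrow> nat \<Rightarrow> nat \<Rightarrow> (nat \<Rightarrow> complex) set \<Rightarrow> ((nat \<Rightarrow> complex) \<Rightarrow> complex mat) \<Rightarrow> bool" where
  "mat_analytic_several m n K W F \<longleftrightarrow>
     (\<forall>z\<in>W. F z \<in> carrier_mat m n) \<and>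
     (\<forall>i<m. \<forall>j<n. analytic_several K W (\<lambda>z. F z $$ (i, j)))"


section \<open>NC analytic functions\<close>

definition nc_int_ball :: "nat \<Rightarrow> nat \<Rightarrow> nat \<Rightarrow> complex mat set" where
  "nc_int_ball g' g N = {X \<in> carrier_mat (g' * N) (g * N). mat_opnorm X < 1}"

definition nc_block :: "nat \<Rightarrow> complex mat \<Rightarrow> nat \<Rightarrow> nat \<Rightarrow> complex mat" where
  "nc_block N X j l = Matrix.mat N N (\<lambda>(p, q). X $$ (j * N + p, l * N + q))"

text \<open>A word in the variables \<open>x\<^sub>j\<^sub>l\<close> is the list of its index pairs.\<close>

definition nc_words :: "nat \<Rightarrow> nat \<Rightarrow> nat \<Rightarrow> (nat \<times> nat) list set" where
  "nc_words g' g k = {w. length w = k \<and> set w \<subseteq> {..<g'} \<times> {..<g}}"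

definition word_eval :: "nat \<Rightarrow> (nat \<times> nat) list \<Rightarrow> complex mat \<Rightarrow> complex mat" where
  "word_eval N w X = foldr (\<lambda>(j, l) M. nc_block N X j l * M) w (1\<^sub>m N)"

definition nc_homogeneous ::
  "nat \<Rightarrow> nat \<Rightarrow> nat \<Rightarrow> nat \<Rightarrow> ((nat \<times> nat) list \<Rightarrow> complex mat) \<Rightarrow> nat \<Rightarrow> nat \<Rightarrow> complex mat \<Rightarrow> complex mat"
where
  "nc_homogeneous g' g d' d a k N X = Matrix.mat (d' * N) (d * N)
     (\<lambda>(i, j). \<Sum>w\<in>nc_words g' g k. kron (a w) (word_eval N w X) $$ (i, j))"

definition nc_partial_sum ::
  "nat \<Rightarrow> nat \<Rightarrow> nat \<Rightarrow> nat \<Rightarrow> ((nat \<times> nat) list \<Rightarrow> complex mat) \<Rightarrow> nat \<Rightarrow> nat \<Rightarrow> complex mat \<Rightarrow> complex mat"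
where
  "nc_partial_sum g' g d' d a n N X = Matrix.mat (d' * N) (d * N)
     (\<lambda>(i, j). \<Sum>k<n. nc_homogeneous g' g d' d a k N X $$ (i, j))"

text \<open>Conditions (1) and (2) in the definition of an NC analytic function on the interior of the ball.
  The functions are applied to matrices of all sizes \<open>N \<ge> 1\<close>; \<open>N\<close> is not an argument because for
  \<open>g', g \<ge> 1\<close> it is determined by the shape of \<open>X\<close>. Only values on the open ball matter. The target
  dimensions \<open>d'\<close> and \<open>d\<close> may be 0.\<close>

definition nc_has_power_series ::
  "nat \<Rightarrow> nat \<Rightarrow> nat \<Rightarrow> nat \<Rightarrow> (complex mat \<Rightarrow> complex mat) \<Rightarrow> bool" where
  "nc_has_power_series g' g d' d f \<longleftrightarrow>
     (\<exists>a. (\<forall>k. \<forall>w\<in>nc_words g' g k. a w \<in> carrier_mat d' d) \<and>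
        (\<exists>\<epsilon>>0. \<forall>N\<ge>1. \<forall>X\<in>nc_int_ball g' g N. mat_opnorm X < \<epsilon> \<longrightarrow>
           mat_tendsto (\<lambda>n. nc_partial_sum g' g d' d a n N X) (f X) sequentially))"

definition nc_analytic_on_slices ::
  "nat \<Rightarrow> nat \<Rightarrow> nat \<Rightarrow> nat \<Rightarrow> (complex mat \<Rightarrow> complex mat) \<Rightarrow> bool" where
  "nc_analytic_on_slices g' g d' d f \<longleftrightarrow>
     (\<forall>N\<ge>1. \<forall>K\<ge>1. \<forall>W a.
        cdomain K W \<and> mat_analytic_several (g' * N) (g * N) K W a \<and> a ` W \<subseteq> nc_int_ball g' g N \<longrightarrow>
        mat_analytic_several (d' * N) (d * N) K W (\<lambda>z. f (a z)) \<and>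
        (\<forall>b. (\<forall>z\<in>W. b z = a z) \<and> b ` closure W \<subseteq> nc_int_ball g' g N \<and> mat_continuous_on (closure W) b
           \<longrightarrow> mat_continuous_on (closure W) (\<lambda>z. f (b z))))"

definition nc_analytic ::
  "nat \<Rightarrow> nat \<Rightarrow> nat \<Rightarrow> nat \<Rightarrow> (complex mat \<Rightarrow> complex mat) \<Rightarrow> bool" where
  "nc_analytic g' g d' d f \<longleftrightarrow>
     (\<forall>N\<ge>1. \<forall>X\<in>nc_int_ball g' g N. f X \<in> carrier_mat (d' * N) (d * N)) \<and>
     nc_has_power_series g' g d' d f \<and> nc_analytic_on_slices g' g d' d f"

definition nc_contractive :: "nat \<Rightarrow> nat \<Rightarrow> (complex mat \<Rightarrow> complex mat) \<Rightarrow> bool" where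
  "nc_contractive g' g f \<longleftrightarrow> (\<forall>N\<ge>1. \<forall>X\<in>nc_int_ball g' g N. mat_opnorm (f X) \<le> 1)"


section \<open>NC ball maps\<close>

text \<open>\<open>f(e\<^sup>i\<^sup>t X)\<close> exists and equals \<open>L\<close>.\<close>

definition nc_radial_limit ::
  "(complex mat \<Rightarrow> complex mat) \<Rightarrow> complex mat \<Rightarrow> real \<Rightarrow> complex mat \<Rightarrow> bool" where
  "nc_radial_limit f X t L \<longleftrightarrow>
     mat_tendsto (\<lambda>r::real. f ((complex_of_real r * cis t) \<cdot>\<^sub>m X)) L (at_left 1)"

definition nc_ball_map ::
  "nat \<Rightarrow> nat \<Rightarrow> nat \<Rightarrow> nat \<Rightarrow> (complex mat \<Rightarrow> complex mat) \<Rightarrow> bool" where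
  "nc_ball_map g' g d' d f \<longleftrightarrow>
     nc_analytic g' g d' d f \<and> nc_contractive g' g f \<and>
     (\<forall>N\<ge>1. \<forall>X\<in>carrier_mat (g' * N) (g * N). mat_opnorm X = 1 \<longrightarrow>
        (\<forall>t L. nc_radial_limit f X t L \<longrightarrow> mat_opnorm L = 1))"

definition nc_block_identity ::
  "nat \<Rightarrow> nat \<Rightarrow> nat \<Rightarrow> nat \<Rightarrow> (complex mat \<Rightarrow> complex mat) \<Rightarrow>
   complex mat \<Rightarrow> complex mat \<Rightarrow> (complex mat \<Rightarrow> complex mat) \<Rightarrow> bool" where
  "nc_block_identity g' g d' d h V U ht \<longleftrightarrow>
     g' \<le> d' \<and> g \<le> d \<and>
     (\<forall>N\<ge>1. \<forall>X\<in>nc_int_ball g' g N.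
        h X = kron V (1\<^sub>m N) *
              four_block_mat X (0\<^sub>m (g' * N) ((d - g) * N))
                             (0\<^sub>m ((d' - g') * N) (g * N)) (ht X) *
              mat_adjoint (kron U (1\<^sub>m N)))"

end

theory Submission
  imports Defs
begin

text \<open>
  Write \<open>h = \<Sum> a\<^sub>w \<otimes> w\<close>, with \<open>a\<^sub>\<emptyset> = 0\<close>. The theorem says that in suitable orthonormal bases the coefficients
  agree with those of \<open>x\<close> in the first \<open>g'\<close> rows and the first \<open>g\<close> columns. All information about the
  coefficients is obtained by evaluating \<open>h\<close> at jointly nilpotent contractions \<open>X\<close>.

  If all long words vanish at \<open>X\<close>, then \<open>h(z X) = \<Sum> z\<^sup>k H\<^sub>k(X)\<close> is a polynomial in \<open>z\<close>, contractive on the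
  unit disc. Averaging over roots of unity gives \<open>\<Sum> \<parallel>H\<^sub>k(X) v\<parallel>\<^sup>2 \<le> \<parallel>v\<parallel>\<^sup>2\<close>, and the same for the adjoints
  (\<open>nc_contractive_block_column\<close>, \<open>nc_contractive_block_row\<close>): once \<open>H\<^sub>1(X)\<close> preserves the norm of \<open>v\<close>, every
  other \<open>H\<^sub>k(X)\<close> kills \<open>v\<close>. Taking for \<open>X\<close> a partial permutation matrix built from the labelled path that
  spells a word \<open>w\<close> (\<open>word_detector\<close>), this becomes \<open>\<parallel>a\<^sub>w x\<parallel>\<^sup>2 + \<parallel>a\<^sub>j\<^sub>m x\<parallel>\<^sup>2 \<le> \<parallel>x\<parallel>\<^sup>2\<close> for every \<open>m\<close> and some \<open>j\<close>,
  unless \<open>w\<close> is the letter \<open>(j, m)\<close> itself, where \<open>a\<^sub>j\<^sub>m\<close> is the coefficient of that letter; similarly for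
  adjoints (\<open>nc_coeff_pairs\<close>).

  It remains to find vectors on which the \<open>a\<^sub>j\<^sub>m\<close> are isometric, and this is the only place where the boundary
  condition on \<open>h\<close> is used. At the nilpotent matrix \<open>X = \<kappa> \<Sum> E\<^sub>j\<^sub>l \<otimes> E\<^sub>j\<^sub>,\<^sub>g\<^sub>'\<^sub>+\<^sub>l\<close> of norm 1 the radial limit of \<open>h\<close>
  exists and is \<open>H\<^sub>1(X)\<close>, so that \<open>\<parallel>H\<^sub>1(X)\<parallel> = 1\<close>. The equality case of the triangle inequality then yields unit
  vectors \<open>x\<^sub>l\<close>, \<open>s\<^sub>j\<close> with \<open>a\<^sub>j\<^sub>l x\<^sub>l = s\<^sub>j\<close> for all \<open>j\<close> and \<open>l\<close> (\<open>nc_ball_map_extremal_vectors\<close>). By the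
  inequalities above \<open>a\<^sub>w x\<^sub>m = 0\<close> for every other word \<open>w\<close>, and dually; this also makes the \<open>x\<^sub>l\<close> and the
  \<open>s\<^sub>j\<close> orthonormal. Extending them to unitaries \<open>U\<close> and \<open>V\<close> gives the claim on the coefficients
  (\<open>nc_ball_map_coefficients\<close>); the identity follows near 0 from the power series and on the whole
  ball by analytic continuation along complex lines through 0 (\<open>nc_entry_eq_on_line\<close>).

  The converse is a norm computation: \<open>\<parallel>X\<parallel> \<le> \<parallel>h(X)\<parallel> \<le> 1\<close> on the ball, so every radial limit at a
  boundary point has norm 1.
\<close>

section \<open>The operator norm in coordinates\<close>

text \<open>The squared Euclidean norm of the first \<open>n\<close> entries of a sequence. Vectors are represented by
  sequences throughout, so that slices of a vector in \<open>\<complex>\<^sup>d \<otimes> \<complex>\<^sup>N\<close> need no change of type.\<close>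

definition l2sq :: "nat \<Rightarrow> (nat \<Rightarrow> complex) \<Rightarrow> real" where
  "l2sq n f = (\<Sum>i<n. (cmod (f i))\<^sup>2)"

lemma l2sq_nonneg [simp]: "0 \<le> l2sq n f"
  by (simp add: l2sq_def sum_nonneg)

lemma l2sq_eq_0_iff: "l2sq n f = 0 \<longleftrightarrow> (\<forall>i<n. f i = 0)"
  by (auto simp: l2sq_def sum_nonneg_eq_0_iff)

lemma l2sq_cong: "(\<And>i. i < n \<Longrightarrow> f i = g i) \<Longrightarrow> l2sq n f = l2sq n g"
  by (simp add: l2sq_def)

lemma l2sq_smult: "l2sq n (\<lambda>i. c * f i) = (cmod c)\<^sup>2 * l2sq n f"
  by (simp add: l2sq_def norm_mult power_mult_distrib sum_distrib_left)

lemma l2sq_cnj: "l2sq n (\<lambda>i. cnj (f i)) = l2sq n f"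
  by (simp add: l2sq_def)

lemma entry_le_l2sq: "i < n \<Longrightarrow> (cmod (f i))\<^sup>2 \<le> l2sq n f"
  unfolding l2sq_def by (rule member_le_sum) auto

lemma l2sq_minus:
  "l2sq n (\<lambda>i. f i - g i) = l2sq n f + l2sq n g - 2 * Re (\<Sum>i<n. cnj (g i) * f i)"
proof -
  have "(cmod (f i - g i))\<^sup>2 = (cmod (f i))\<^sup>2 + (cmod (g i))\<^sup>2 - 2 * Re (cnj (g i) * f i)" for i
    unfolding cmod_power2 by (simp add: power2_eq_square algebra_simps)
  then show ?thesis
    by (simp add: l2sq_def sum.distrib sum_subtractf sum_distrib_left)
qed

lemma sum_cnj_self: "(\<Sum>i<n. cnj (f i) * f i) = complex_of_real (l2sq n f)"
  by (simp add: l2sq_def complex_norm_square[symmetric] mult.commute[of "cnj _"])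

lemma cauchy_schwarz_l2sq:
  "(cmod (\<Sum>i<n. f i * g i))\<^sup>2 \<le> l2sq n f * l2sq n g"
proof -
  have "cmod (\<Sum>i<n. f i * g i) \<le> (\<Sum>i<n. cmod (f i) * cmod (g i))"
    by (rule order_trans[OF norm_sum]) (simp add: norm_mult)
  then have "(cmod (\<Sum>i<n. f i * g i))\<^sup>2 \<le> (\<Sum>i<n. cmod (f i) * cmod (g i))\<^sup>2"
    by (intro power_mono) auto
  also have "\<dots> \<le> l2sq n f * l2sq n g"
    using Cauchy_Schwarz_ineq_sum[of "\<lambda>i. cmod (f i)" "\<lambda>i. cmod (g i)" "{..<n}"]
    by (simp add: l2sq_def)
  finally show ?thesis .
qed

lemma l2_vec_norm_eq: "l2_vec_norm (Matrix.vec n f) = sqrt (l2sq n f)"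
  by (simp add: l2_vec_norm_def l2sq_def)

lemma l2_vec_norm_mult:
  assumes "A \<in> carrier_mat m n"
  shows "l2_vec_norm (A *\<^sub>v Matrix.vec n f) = sqrt (l2sq m (\<lambda>i. \<Sum>j<n. A $$ (i, j) * f j))"
  using assms by (auto simp: l2_vec_norm_def l2sq_def scalar_prod_def atLeast0LessThan
      intro!: sum.cong)

text \<open>The square of the Frobenius norm bounds the square of the operator norm; this makes the supremum
  in the definition of the operator norm meaningful.\<close>

lemma l2sq_mult_le_frobenius:
  "l2sq m (\<lambda>i. \<Sum>j<n. A $$ (i, j) * f j) \<le> (\<Sum>i<m. \<Sum>j<n. (cmod (A $$ (i, j)))\<^sup>2) * l2sq n f"
proof -
  have "l2sq m (\<lambda>i. \<Sum>j<n. A $$ (i, j) * f j)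
      \<le> (\<Sum>i<m. l2sq n (\<lambda>j. A $$ (i, j)) * l2sq n f)"
    unfolding l2sq_def[of m] by (intro sum_mono cauchy_schwarz_l2sq)
  then show ?thesis by (simp add: l2sq_def sum_distrib_right)
qed

lemma opnorm_bdd_above:
  "bdd_above ((\<lambda>v. l2_vec_norm (A *\<^sub>v v)) ` {v \<in> carrier_vec (dim_col A). l2_vec_norm v \<le> 1})"
proof (rule bdd_aboveI2)
  fix v assume v: "v \<in> {v \<in> carrier_vec (dim_col A). l2_vec_norm v \<le> 1}"
  let ?F = "\<Sum>i<dim_row A. \<Sum>j<dim_col A. (cmod (A $$ (i, j)))\<^sup>2"
  have v': "v = Matrix.vec (dim_col A) (\<lambda>i. v $ i)" using v by auto
  have n: "l2sq (dim_col A) (\<lambda>i. v $ i) \<le> 1"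
    using v l2_vec_norm_eq[of "dim_col A" "\<lambda>i. v $ i"] v' by simp
  have "l2_vec_norm (A *\<^sub>v v)
      = sqrt (l2sq (dim_row A) (\<lambda>i. \<Sum>j<dim_col A. A $$ (i, j) * (v $ j)))"
    by (subst v', rule l2_vec_norm_mult) auto
  also have "\<dots> \<le> sqrt (?F * 1)"
    by (intro real_sqrt_le_mono order_trans[OF l2sq_mult_le_frobenius] mult_left_mono n)
      (auto intro!: sum_nonneg)
  finally show "l2_vec_norm (A *\<^sub>v v) \<le> sqrt (?F * 1)" .
qed

lemma l2sq_mult_le_opnorm_unit:
  assumes A: "A \<in> carrier_mat m n" and f: "l2sq n f \<le> 1"
  shows "sqrt (l2sq m (\<lambda>i. \<Sum>j<n. A $$ (i, j) * f j)) \<le> mat_opnorm A"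
proof -
  have "l2_vec_norm (A *\<^sub>v Matrix.vec n f) \<le> mat_opnorm A"
    unfolding mat_opnorm_def using A f
    by (intro cSUP_upper opnorm_bdd_above) (auto simp: l2_vec_norm_eq)
  then show ?thesis using l2_vec_norm_mult[OF A] by simp
qed

lemma mat_opnorm_nonneg [simp]: "0 \<le> mat_opnorm A"
  using l2sq_mult_le_opnorm_unit[of A "dim_row A" "dim_col A" "\<lambda>_. 0"]
  by (auto simp: l2sq_def)

lemma l2sq_mult_le_opnorm:
  assumes A: "A \<in> carrier_mat m n"
  shows "l2sq m (\<lambda>i. \<Sum>j<n. A $$ (i, j) * f j) \<le> (mat_opnorm A)\<^sup>2 * l2sq n f"
proof (cases "l2sq n f = 0")
  case True
  then show ?thesis by (simp add: l2sq_eq_0_iff) (simp add: l2sq_def)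
next
  case False
  define c where "c = complex_of_real (1 / sqrt (l2sq n f))"
  have pos: "0 < l2sq n f" using False l2sq_nonneg[of n f] by linarith
  have c: "(cmod c)\<^sup>2 = 1 / l2sq n f"
    using pos by (simp add: c_def norm_divide power_divide)
  have "l2sq n (\<lambda>j. c * f j) \<le> 1" using pos by (simp add: l2sq_smult c)
  from l2sq_mult_le_opnorm_unit[OF A this]
  have "l2sq m (\<lambda>i. \<Sum>j<n. A $$ (i, j) * (c * f j)) \<le> (mat_opnorm A)\<^sup>2"
    by (rule sqrt_le_D)
  also have "(\<lambda>i. \<Sum>j<n. A $$ (i, j) * (c * f j)) = (\<lambda>i. c * (\<Sum>j<n. A $$ (i, j) * f j))"
    by (simp add: sum_distrib_left mult_ac)
  finally show ?thesis using pos by (simp add: l2sq_smult c field_simps)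
qed

lemma mat_opnorm_leI:
  assumes A: "A \<in> carrier_mat m n" and c: "0 \<le> c"
    and le: "\<And>f. l2sq m (\<lambda>i. \<Sum>j<n. A $$ (i, j) * f j) \<le> c\<^sup>2 * l2sq n f"
  shows "mat_opnorm A \<le> c"
  unfolding mat_opnorm_def
proof (rule cSUP_least)
  have "0\<^sub>v (dim_col A) \<in> {v \<in> carrier_vec (dim_col A). l2_vec_norm v \<le> 1}"
    by (simp add: l2_vec_norm_def)
  then show "{v \<in> carrier_vec (dim_col A). l2_vec_norm v \<le> 1} \<noteq> {}" by blast
next
  fix v assume v: "v \<in> {v \<in> carrier_vec (dim_col A). l2_vec_norm v \<le> 1}"
  have n: "n = dim_col A" using A by auto
  have v': "v = Matrix.vec n (\<lambda>i. v $ i)" using v n by auto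
  have "l2sq n (\<lambda>i. v $ i) \<le> 1"
    using v l2_vec_norm_eq[of n "\<lambda>i. v $ i"] v' by simp
  then have "c\<^sup>2 * l2sq n (\<lambda>i. v $ i) \<le> c\<^sup>2 * 1" by (intro mult_left_mono) auto
  then have "sqrt (l2sq m (\<lambda>i. \<Sum>j<n. A $$ (i, j) * (v $ j))) \<le> sqrt (c\<^sup>2)"
    using le[of "\<lambda>i. v $ i"] by (intro real_sqrt_le_mono) linarith
  then show "l2_vec_norm (A *\<^sub>v v) \<le> c"
    using l2_vec_norm_mult[OF A, of "\<lambda>i. v $ i"] v' c by simp
qed

lemma mat_opnorm_le_1I:
  assumes "A \<in> carrier_mat m n"
    and "\<And>f. l2sq m (\<lambda>i. \<Sum>j<n. A $$ (i, j) * f j) \<le> l2sq n f"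
  shows "mat_opnorm A \<le> 1"
  by (rule mat_opnorm_leI[OF assms(1)]) (auto simp: assms(2))

lemma l2sq_mult_le_of_opnorm_le_1:
  assumes A: "A \<in> carrier_mat m n" and "mat_opnorm A \<le> 1"
  shows "l2sq m (\<lambda>i. \<Sum>j<n. A $$ (i, j) * f j) \<le> l2sq n f"
proof -
  have "(mat_opnorm A)\<^sup>2 \<le> 1" using assms(2) by (simp add: power_le_one)
  then have "(mat_opnorm A)\<^sup>2 * l2sq n f \<le> 1 * l2sq n f" by (intro mult_right_mono) auto
  then show ?thesis using l2sq_mult_le_opnorm[OF A, of f] by linarith
qed

lemma mat_opnorm_zero [simp]: "mat_opnorm (0\<^sub>m m n) = 0"
  by (rule antisym[OF mat_opnorm_leI[of _ m n] mat_opnorm_nonneg]) (auto simp: l2sq_def)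

lemma mat_opnorm_smult:
  assumes A: "A \<in> carrier_mat m n"
  shows "mat_opnorm (z \<cdot>\<^sub>m A) = cmod z * mat_opnorm A"
proof -
  have *: "l2sq m (\<lambda>i. \<Sum>j<n. (z \<cdot>\<^sub>m B) $$ (i, j) * f j)
      = (cmod z)\<^sup>2 * l2sq m (\<lambda>i. \<Sum>j<n. B $$ (i, j) * f j)"
    if "B \<in> carrier_mat m n" for z f and B :: "complex mat"
  proof -
    have "l2sq m (\<lambda>i. \<Sum>j<n. (z \<cdot>\<^sub>m B) $$ (i, j) * f j)
      = l2sq m (\<lambda>i. z * (\<Sum>j<n. B $$ (i, j) * f j))"
      using that by (intro l2sq_cong) (auto simp: sum_distrib_left mult_ac)
    then show ?thesis by (simp add: l2sq_smult)
  qed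
  have le: "mat_opnorm (z \<cdot>\<^sub>m B) \<le> cmod z * mat_opnorm B"
    if B: "B \<in> carrier_mat m n" for z and B :: "complex mat"
    using l2sq_mult_le_opnorm[OF B]
    by (intro mat_opnorm_leI[of _ m n])
      (auto simp: B *[OF B] power_mult_distrib mult.assoc intro!: mult_left_mono)
  show ?thesis
  proof (cases "z = 0")
    case True
    with le[OF A, of z] show ?thesis
      using mat_opnorm_nonneg[of "z \<cdot>\<^sub>m A"] by (simp add: antisym)
  next
    case False
    have "mat_opnorm A = mat_opnorm (inverse z \<cdot>\<^sub>m (z \<cdot>\<^sub>m A))"
      using False by (intro arg_cong[where f = mat_opnorm] eq_matI) auto
    also have "\<dots> \<le> cmod (inverse z) * mat_opnorm (z \<cdot>\<^sub>m A)"
      using A by (intro le) auto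
    finally show ?thesis using le[OF A, of z] False
      by (intro antisym) (simp_all add: norm_inverse norm_divide field_simps)
  qed
qed

lemma l2sq_add_le:
  "sqrt (l2sq n (\<lambda>i. f i + g i)) \<le> sqrt (l2sq n f) + sqrt (l2sq n g)"
proof -
  have *: "sqrt (l2sq n h) = L2_set (\<lambda>i. cmod (h i)) {..<n}" for h
    by (simp add: l2sq_def L2_set_def)
  have "L2_set (\<lambda>i. cmod (f i + g i)) {..<n} \<le> L2_set (\<lambda>i. cmod (f i) + cmod (g i)) {..<n}"
    by (intro L2_set_mono norm_triangle_ineq) auto
  also have "\<dots> \<le> L2_set (\<lambda>i. cmod (f i)) {..<n} + L2_set (\<lambda>i. cmod (g i)) {..<n}"
    by (rule L2_set_triangle_ineq)
  finally show ?thesis unfolding * .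
qed

lemma sqrt_l2sq_mult_le_opnorm:
  assumes A: "A \<in> carrier_mat m n"
  shows "sqrt (l2sq m (\<lambda>i. \<Sum>j<n. A $$ (i, j) * f j)) \<le> mat_opnorm A * sqrt (l2sq n f)"
  using real_sqrt_le_mono[OF l2sq_mult_le_opnorm[OF A, of f]]
  by (simp add: real_sqrt_mult)

lemma mat_opnorm_leI_sqrt:
  assumes A: "A \<in> carrier_mat m n" and c: "0 \<le> c"
    and le: "\<And>f. sqrt (l2sq m (\<lambda>i. \<Sum>j<n. A $$ (i, j) * f j)) \<le> c * sqrt (l2sq n f)"
  shows "mat_opnorm A \<le> c"
proof (rule mat_opnorm_leI[OF A c])
  fix f
  have "(sqrt (l2sq m (\<lambda>i. \<Sum>j<n. A $$ (i, j) * f j)))\<^sup>2 \<le> (c * sqrt (l2sq n f))\<^sup>2"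
    by (intro power_mono le) auto
  then show "l2sq m (\<lambda>i. \<Sum>j<n. A $$ (i, j) * f j) \<le> c\<^sup>2 * l2sq n f"
    by (simp add: power_mult_distrib)
qed

lemma mat_opnorm_add:
  assumes A: "A \<in> carrier_mat m n" and B: "B \<in> carrier_mat m n"
  shows "mat_opnorm (A + B) \<le> mat_opnorm A + mat_opnorm B"
proof (rule mat_opnorm_leI_sqrt[of _ m n])
  fix f
  have "l2sq m (\<lambda>i. \<Sum>j<n. (A + B) $$ (i, j) * f j)
      = l2sq m (\<lambda>i. (\<Sum>j<n. A $$ (i, j) * f j) + (\<Sum>j<n. B $$ (i, j) * f j))"
    using A B by (intro l2sq_cong) (simp add: algebra_simps sum.distrib)
  then have "sqrt (l2sq m (\<lambda>i. \<Sum>j<n. (A + B) $$ (i, j) * f j))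
      \<le> sqrt (l2sq m (\<lambda>i. \<Sum>j<n. A $$ (i, j) * f j)) + sqrt (l2sq m (\<lambda>i. \<Sum>j<n. B $$ (i, j) * f j))"
    using l2sq_add_le by simp
  also have "\<dots> \<le> mat_opnorm A * sqrt (l2sq n f) + mat_opnorm B * sqrt (l2sq n f)"
    by (intro add_mono sqrt_l2sq_mult_le_opnorm A B)
  finally show "sqrt (l2sq m (\<lambda>i. \<Sum>j<n. (A + B) $$ (i, j) * f j))
      \<le> (mat_opnorm A + mat_opnorm B) * sqrt (l2sq n f)" by (simp add: algebra_simps)
qed (use A B in auto)

lemma mat_opnorm_mult:
  assumes A: "A \<in> carrier_mat m n" and B: "B \<in> carrier_mat n k"
  shows "mat_opnorm (A * B) \<le> mat_opnorm A * mat_opnorm B"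
proof (rule mat_opnorm_leI[of _ m k])
  fix f
  have "l2sq m (\<lambda>i. \<Sum>j<k. (A * B) $$ (i, j) * f j)
      = l2sq m (\<lambda>i. \<Sum>l<n. A $$ (i, l) * (\<Sum>j<k. B $$ (l, j) * f j))"
  proof (rule l2sq_cong)
    fix i assume i: "i < m"
    have "(\<Sum>j<k. (A * B) $$ (i, j) * f j) = (\<Sum>j<k. \<Sum>l<n. A $$ (i, l) * B $$ (l, j) * f j)"
      using A B i by (intro sum.cong) (auto simp: scalar_prod_def sum_distrib_right atLeast0LessThan)
    also have "\<dots> = (\<Sum>l<n. \<Sum>j<k. A $$ (i, l) * B $$ (l, j) * f j)" by (rule sum.swap)
    finally show "(\<Sum>j<k. (A * B) $$ (i, j) * f j)
        = (\<Sum>l<n. A $$ (i, l) * (\<Sum>j<k. B $$ (l, j) * f j))"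
      by (simp add: sum_distrib_left mult.assoc)
  qed
  also have "\<dots> \<le> (mat_opnorm A)\<^sup>2 * l2sq n (\<lambda>l. \<Sum>j<k. B $$ (l, j) * f j)"
    by (rule l2sq_mult_le_opnorm[OF A])
  also have "\<dots> \<le> (mat_opnorm A)\<^sup>2 * ((mat_opnorm B)\<^sup>2 * l2sq k f)"
    by (intro mult_left_mono l2sq_mult_le_opnorm[OF B]) auto
  finally show "l2sq m (\<lambda>i. \<Sum>j<k. (A * B) $$ (i, j) * f j)
      \<le> (mat_opnorm A * mat_opnorm B)\<^sup>2 * l2sq k f" by (simp add: power_mult_distrib mult.assoc)
qed (use A B in auto)

lemma entry_le_mat_opnorm:
  assumes A: "A \<in> carrier_mat m n" and "i < m" "j < n"
  shows "cmod (A $$ (i, j)) \<le> mat_opnorm A"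
proof -
  let ?e = "\<lambda>l. of_bool (l = j) :: complex"
  have "l2sq n ?e = (\<Sum>i<n. if i = j then 1 else 0)"
    unfolding l2sq_def by (rule sum.cong) auto
  then have e: "l2sq n ?e = 1" using assms by simp
  have *: "(\<Sum>l<n. A $$ (i, l) * ?e l) = A $$ (i, j)"
    using assms(3) by (simp add: of_bool_def if_distrib cong: if_cong)
  have "(cmod (A $$ (i, j)))\<^sup>2 \<le> l2sq m (\<lambda>i. \<Sum>l<n. A $$ (i, l) * ?e l)"
    using entry_le_l2sq[OF \<open>i < m\<close>, of "\<lambda>i. \<Sum>l<n. A $$ (i, l) * ?e l"] unfolding * .
  also have "\<dots> \<le> (mat_opnorm A)\<^sup>2" using l2sq_mult_le_opnorm[OF A, of ?e] unfolding e by simp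
  finally show ?thesis by (rule power2_le_imp_le) simp
qed

lemma mat_opnorm_attained:
  assumes A: "A \<in> carrier_mat m n"
  obtains f where "l2sq n f \<le> 1" "l2sq m (\<lambda>i. \<Sum>j<n. A $$ (i, j) * f j) = (mat_opnorm A)\<^sup>2"
proof -
  let ?B = "PiE UNIV (\<lambda>i. if i < n then cball (0::complex) 1 else {0})"
  let ?g = "\<lambda>f. l2sq m (\<lambda>i. \<Sum>j<n. A $$ (i, j) * f j)"
  have cont: "continuous_on UNIV (\<lambda>f. f j :: complex)" for j :: nat
    by (rule continuous_on_product_coordinates)
  have cB: "compact ?B"
  proof -
    have "compactin (product_topology (\<lambda>i. euclidean) UNIV) ?B"
      unfolding compactin_PiE by auto
    then show ?thesis by (simp add: euclidean_product_topology)
  qed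
  define K where "K = ?B \<inter> {f. l2sq n f \<le> 1}"
  have "continuous_on UNIV (l2sq n)"
    unfolding l2sq_def by (intro continuous_intros cont)
  then have "closed {f. l2sq n f \<le> 1}"
    using closed_Collect_le[of "l2sq n" "\<lambda>_. 1"] by simp
  then have K: "compact K" unfolding K_def using cB by (rule compact_Int_closed[rotated])
  have "(\<lambda>_. 0) \<in> K" by (auto simp: K_def l2sq_def)
  then have ne: "K \<noteq> {}" by blast
  have cg: "continuous_on K ?g"
    unfolding l2sq_def
    by (intro continuous_intros continuous_on_subset[OF cont]) auto
  obtain f where f: "f \<in> K" "\<And>h. h \<in> K \<Longrightarrow> ?g h \<le> ?g f"
    using continuous_attains_sup[OF K ne cg] by blast
  have le: "?g h \<le> ?g f * l2sq n h" for h
  proof (cases "l2sq n h = 0")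
    case True
    then have "?g h = 0" by (simp add: l2sq_eq_0_iff)
    then show ?thesis by simp
  next
    case False
    then have pos: "0 < l2sq n h" using l2sq_nonneg[of n h] by linarith
    define c where "c = complex_of_real (1 / sqrt (l2sq n h))"
    have c: "(cmod c)\<^sup>2 = 1 / l2sq n h"
      using pos by (simp add: c_def norm_divide power_divide)
    define h' where "h' = (\<lambda>i. if i < n then c * h i else 0)"
    have "l2sq n h' = l2sq n (\<lambda>i. c * h i)" by (rule l2sq_cong) (simp add: h'_def)
    also have "\<dots> = 1" using pos by (simp add: l2sq_smult c)
    finally have h'1: "l2sq n h' = 1" .
    have "cmod (h' i) \<le> 1" if "i < n" for i
      using entry_le_l2sq[OF that, of h'] h'1 by (simp add: power_le_one_iff abs_square_le_1)
    then have "h' \<in> K" using h'1 by (auto simp: K_def h'_def)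
    then have "?g h' \<le> ?g f" by (rule f)
    also have "?g h' = l2sq m (\<lambda>i. c * (\<Sum>j<n. A $$ (i, j) * h j))"
      by (intro l2sq_cong) (auto simp: h'_def sum_distrib_left mult_ac intro!: sum.cong)
    finally show ?thesis using pos by (simp add: l2sq_smult c field_simps)
  qed
  have "mat_opnorm A \<le> sqrt (?g f)"
    by (rule mat_opnorm_leI[OF A]) (use le in auto)
  then have "(mat_opnorm A)\<^sup>2 \<le> (sqrt (?g f))\<^sup>2" by (intro power_mono) auto
  then have 1: "(mat_opnorm A)\<^sup>2 \<le> ?g f" by simp
  have f1: "l2sq n f \<le> 1" using f(1) by (simp add: K_def)
  have "(mat_opnorm A)\<^sup>2 * l2sq n f \<le> (mat_opnorm A)\<^sup>2 * 1"
    using f1 by (intro mult_left_mono) auto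
  then have "?g f \<le> (mat_opnorm A)\<^sup>2" using l2sq_mult_le_opnorm[OF A, of f] by simp
  with 1 f1 show thesis by (intro that) auto
qed

section \<open>Adjoints and Kronecker products\<close>

lemma mat_adjoint_carrier [simp, intro]:
  "(A :: complex mat) \<in> carrier_mat m n \<Longrightarrow> mat_adjoint A \<in> carrier_mat n m"
  by (auto simp: mat_adjoint_def)

lemma mat_adjoint_dim [simp]:
  "dim_row (mat_adjoint (A :: complex mat)) = dim_col A" "dim_col (mat_adjoint A) = dim_row A"
  by (auto simp: mat_adjoint_def)

lemma mat_adjoint_index [simp]:
  "i < dim_col A \<Longrightarrow> j < dim_row A \<Longrightarrow> mat_adjoint (A :: complex mat) $$ (i, j) = cnj (A $$ (j, i))"
  unfolding mat_adjoint_def by (subst mat_of_rows_index) auto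

lemma mat_adjoint_adjoint [simp]: "mat_adjoint (mat_adjoint A) = (A :: complex mat)"
  by (rule eq_matI) auto

text \<open>With \<open>B = A\<^sup>*\<close> and \<open>v = B w\<close>: \<open>\<parallel>v\<parallel>\<^sup>2 = \<langle>w, A v\<rangle> \<le> \<parallel>w\<parallel> \<parallel>A\<parallel> \<parallel>v\<parallel>\<close>.\<close>

lemma l2sq_adjoint_le:
  assumes A: "A \<in> carrier_mat m n"
  shows "l2sq n (\<lambda>j. \<Sum>i<m. cnj (y i) * A $$ (i, j)) \<le> (mat_opnorm A)\<^sup>2 * l2sq m y"
proof -
  define t where "t = (\<lambda>j. \<Sum>i<m. cnj (y i) * A $$ (i, j))"
  have "complex_of_real (l2sq n t) = (\<Sum>j<n. \<Sum>i<m. cnj (t j) * (cnj (y i) * A $$ (i, j)))"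
    unfolding sum_cnj_self[symmetric] by (simp add: t_def sum_distrib_left)
  also have "\<dots> = (\<Sum>i<m. \<Sum>j<n. cnj (t j) * (cnj (y i) * A $$ (i, j)))" by (rule sum.swap)
  also have "\<dots> = (\<Sum>i<m. cnj (y i) * (\<Sum>j<n. A $$ (i, j) * cnj (t j)))"
    by (simp add: sum_distrib_left mult_ac)
  finally have *: "complex_of_real (l2sq n t) = \<dots>" .
  have "(l2sq n t)\<^sup>2 = (cmod (complex_of_real (l2sq n t)))\<^sup>2" by simp
  also have "\<dots> \<le> l2sq m (\<lambda>i. cnj (y i)) * l2sq m (\<lambda>i. \<Sum>j<n. A $$ (i, j) * cnj (t j))"
    unfolding * by (rule cauchy_schwarz_l2sq)
  also have "\<dots> \<le> l2sq m y * ((mat_opnorm A)\<^sup>2 * l2sq n t)"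
    using l2sq_mult_le_opnorm[OF A, of "\<lambda>j. cnj (t j)"]
    by (auto simp: l2sq_cnj intro!: mult_left_mono)
  finally have le: "(l2sq n t)\<^sup>2 \<le> l2sq m y * ((mat_opnorm A)\<^sup>2 * l2sq n t)" .
  show ?thesis
  proof (cases "l2sq n t = 0")
    case True then show ?thesis by (simp add: t_def[symmetric])
  next
    case False
    then have "0 < l2sq n t" using l2sq_nonneg[of n t] by linarith
    then show ?thesis using le by (simp add: t_def[symmetric] power2_eq_square mult_ac)
  qed
qed

lemma mat_opnorm_adjoint:
  assumes A: "A \<in> carrier_mat m n"
  shows "mat_opnorm (mat_adjoint A) = mat_opnorm A"
proof -
  have le: "mat_opnorm (mat_adjoint B) \<le> mat_opnorm B" if B: "B \<in> carrier_mat m n"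
    for m n and B :: "complex mat"
  proof (rule mat_opnorm_leI[of _ n m])
    fix f
    have "l2sq n (\<lambda>i. \<Sum>j<m. mat_adjoint B $$ (i, j) * f j)
        = l2sq n (\<lambda>i. cnj (\<Sum>j<m. cnj (f j) * B $$ (j, i)))"
      using B by (intro l2sq_cong) (auto simp: mult.commute)
    also have "\<dots> \<le> (mat_opnorm B)\<^sup>2 * l2sq m f"
      unfolding l2sq_cnj by (rule l2sq_adjoint_le[OF B])
    finally show "l2sq n (\<lambda>i. \<Sum>j<m. mat_adjoint B $$ (i, j) * f j) \<le> (mat_opnorm B)\<^sup>2 * l2sq m f" .
  qed (use B in auto)
  show ?thesis
    using le[OF A] le[OF mat_adjoint_carrier[OF A]] by simp
qed

lemma mat_opnorm_isometry:
  assumes A: "A \<in> carrier_mat m n" and iso: "mat_adjoint A * A = 1\<^sub>m n"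
  shows "mat_opnorm A \<le> 1"
proof (rule mat_opnorm_le_1I[OF A])
  fix f
  have orth: "(\<Sum>i<m. cnj (A $$ (i, k)) * A $$ (i, j)) = of_bool (k = j)" if "k < n" "j < n" for k j
  proof -
    have "(mat_adjoint A * A) $$ (k, j) = of_bool (k = j)" using iso that by simp
    then show ?thesis using A that by (simp add: scalar_prod_def atLeast0LessThan)
  qed
  have "complex_of_real (l2sq m (\<lambda>i. \<Sum>j<n. A $$ (i, j) * f j))
      = (\<Sum>i<m. \<Sum>k<n. \<Sum>j<n. cnj (A $$ (i, k)) * A $$ (i, j) * (cnj (f k) * f j))"
    unfolding sum_cnj_self[symmetric] cnj_sum sum_product by (intro sum.cong refl) simp
  also have "\<dots> = (\<Sum>k<n. \<Sum>i<m. \<Sum>j<n. cnj (A $$ (i, k)) * A $$ (i, j) * (cnj (f k) * f j))"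
    by (rule sum.swap)
  also have "\<dots> = (\<Sum>k<n. \<Sum>j<n. \<Sum>i<m. cnj (A $$ (i, k)) * A $$ (i, j) * (cnj (f k) * f j))"
    by (intro sum.cong sum.swap) auto
  also have "\<dots> = (\<Sum>k<n. \<Sum>j<n. of_bool (k = j) * (cnj (f k) * f j))"
    by (intro sum.cong refl) (simp add: sum_distrib_right[symmetric] orth)
  also have "\<dots> = (\<Sum>k<n. cnj (f k) * f k)"
    by (intro sum.cong refl) (simp add: of_bool_def if_distrib[of "\<lambda>x. x * _"] cong: if_cong)
  finally have "complex_of_real (l2sq m (\<lambda>i. \<Sum>j<n. A $$ (i, j) * f j)) = complex_of_real (l2sq n f)"
    unfolding sum_cnj_self .
  then show "l2sq m (\<lambda>i. \<Sum>j<n. A $$ (i, j) * f j) \<le> l2sq n f"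
    by (simp only: of_real_eq_iff)
qed

lemma kron_carrier [simp, intro]:
  "A \<in> carrier_mat m n \<Longrightarrow> B \<in> carrier_mat k l \<Longrightarrow> kron A B \<in> carrier_mat (m * k) (n * l)"
  by (auto simp: kron_def)

lemma block_index_less: "j < (n::nat) \<Longrightarrow> p < N \<Longrightarrow> j * N + p < n * N"
  using mult_le_mono1[of "Suc j" n N] by simp

lemma sum_blocks:
  fixes f :: "nat \<Rightarrow> 'a::comm_monoid_add"
  shows "(\<Sum>i<n * N. f i) = (\<Sum>j<n. \<Sum>p<N. f (j * N + p))"
proof -
  have "(\<Sum>p\<in>{j * N..<j * N + N}. f p) = (\<Sum>p<N. f (j * N + p))" for j
    by (rule sum.reindex_bij_witness[of _ "\<lambda>p. j * N + p" "\<lambda>p. p - j * N"]) auto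
  then show ?thesis by (simp flip: sum.nat_group)
qed

lemma kron_index:
  assumes "A \<in> carrier_mat m n" "B \<in> carrier_mat M N" "i < m" "j < n" "p < M" "q < N"
  shows "kron A B $$ (i * M + p, j * N + q) = A $$ (i, j) * B $$ (p, q)"
  using assms block_index_less[of i m p M] block_index_less[of j n q N]
  by (simp add: kron_def)

lemma block_index_cases:
  assumes "i < n * (N::nat)"
  obtains j p where "j < n" "p < N" "i = j * N + p"
proof
  have "0 < N" using assms by (cases N) auto
  then show "i mod N < N" by simp
  show "i div N < n" using assms by (simp add: less_mult_imp_div_less)
  show "i = i div N * N + i mod N" by simp
qed

lemma block_mat_eqI:
  assumes "A \<in> carrier_mat (m * M) (n * N)" "B \<in> carrier_mat (m * M) (n * N)"
    and "\<And>i p j q. i < m \<Longrightarrow> p < M \<Longrightarrow> j < n \<Longrightarrow> q < N \<Longrightarrow>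
      A $$ (i * M + p, j * N + q) = B $$ (i * M + p, j * N + q)"
  shows "A = B"
  using assms by (intro eq_matI) (auto elim!: block_index_cases)

lemma mat_mult_index:
  assumes "A \<in> carrier_mat m n" "B \<in> carrier_mat n k" "i < m" "j < k"
  shows "(A * B) $$ (i, j) = (\<Sum>l<n. A $$ (i, l) * B $$ (l, j))"
  using assms by (auto simp: scalar_prod_def atLeast0LessThan)

lemma kron_mult:
  assumes "A \<in> carrier_mat m n" "B \<in> carrier_mat M N" "C \<in> carrier_mat n k" "D \<in> carrier_mat N K"
  shows "kron A B * kron C D = kron (A * C) (B * D)"
proof (rule block_mat_eqI[of _ m M k K])
  fix i p j q assume ij: "i < m" "p < M" "j < k" "q < K"
  have "(kron A B * kron C D) $$ (i * M + p, j * K + q)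
      = (\<Sum>l<n * N. kron A B $$ (i * M + p, l) * kron C D $$ (l, j * K + q))"
    using assms ij by (intro mat_mult_index[of _ "m * M" "n * N" _ "k * K"] block_index_less) auto
  also have "\<dots> = (\<Sum>l<n. \<Sum>r<N. A $$ (i, l) * B $$ (p, r) * (C $$ (l, j) * D $$ (r, q)))"
    unfolding sum_blocks by (intro sum.cong refl) (simp add: kron_index assms ij
        kron_index[OF assms(1,2)] kron_index[OF assms(3,4)])
  also have "\<dots> = (\<Sum>l<n. A $$ (i, l) * C $$ (l, j)) * (\<Sum>r<N. B $$ (p, r) * D $$ (r, q))"
    by (simp add: sum_product mult_ac)
  also have "\<dots> = kron (A * C) (B * D) $$ (i * M + p, j * K + q)"
    using assms ij
    by (subst kron_index[of _ m k _ M K]) (auto simp: mat_mult_index[OF assms(1,3)] mat_mult_index[OF assms(2,4)]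
        simp del: index_mult_mat)
  finally show "(kron A B * kron C D) $$ (i * M + p, j * K + q)
      = kron (A * C) (B * D) $$ (i * M + p, j * K + q)" .
qed (use assms in \<open>auto intro!: mult_carrier_mat[of _ _ "n * N"]\<close>)

lemma kron_one: "kron (1\<^sub>m n) (1\<^sub>m N) = 1\<^sub>m (n * N)"
  by (rule block_mat_eqI[of _ n N n N])
    (auto simp: kron_index[of _ n n _ N N] block_index_less dest: arg_cong[of _ _ "\<lambda>x. x div N"] arg_cong[of _ _ "\<lambda>x. x mod N"])

lemma adjoint_kron:
  assumes A: "A \<in> carrier_mat m n"
  shows "mat_adjoint (kron A (1\<^sub>m N)) = kron (mat_adjoint A) (1\<^sub>m N)"
proof (rule block_mat_eqI[of _ n N m N])
  fix i p j q assume *: "i < n" "p < N" "j < m" "q < N"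
  have "dim_row (kron A (1\<^sub>m N)) = m * N" "dim_col (kron A (1\<^sub>m N)) = n * N"
    using A by (auto simp: kron_def)
  then have "mat_adjoint (kron A (1\<^sub>m N)) $$ (i * N + p, j * N + q)
      = cnj (kron A (1\<^sub>m N) $$ (j * N + q, i * N + p))"
    using * block_index_less by (intro mat_adjoint_index) auto
  then show "mat_adjoint (kron A (1\<^sub>m N)) $$ (i * N + p, j * N + q)
      = kron (mat_adjoint A) (1\<^sub>m N) $$ (i * N + p, j * N + q)"
    using * A by (auto simp: kron_index[OF A] kron_index[OF mat_adjoint_carrier[OF A]])
qed (use A in auto)

lemma mat_opnorm_kron_isometry:
  assumes A: "A \<in> carrier_mat m n" and iso: "mat_adjoint A * A = 1\<^sub>m n"
  shows "mat_opnorm (kron A (1\<^sub>m N)) \<le> 1"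
proof (rule mat_opnorm_isometry)
  show "kron A (1\<^sub>m N) \<in> carrier_mat (m * N) (n * N)" using A by auto
  show "mat_adjoint (kron A (1\<^sub>m N)) * kron A (1\<^sub>m N) = 1\<^sub>m (n * N)"
    using A by (simp add: adjoint_kron[OF A] kron_mult[of _ n m _ N N _ n _ N] iso kron_one)
qed

lemma mat_opnorm_kron_coisometry:
  assumes A: "A \<in> carrier_mat m n" and iso: "A * mat_adjoint A = 1\<^sub>m m"
  shows "mat_opnorm (kron A (1\<^sub>m N)) \<le> 1"
  using mat_opnorm_kron_isometry[OF mat_adjoint_carrier[OF A], of N] A iso
    mat_opnorm_adjoint[of "kron A (1\<^sub>m N)" "m * N" "n * N"]
  by (simp add: adjoint_kron[OF A])

section \<open>Convergence of matrices\<close>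

lemma mat_tendsto_entry:
  assumes lim: "mat_tendsto F L \<F>" and ij: "i < dim_row L" "j < dim_col L"
  shows "((\<lambda>x. F x $$ (i, j)) \<longlongrightarrow> L $$ (i, j)) \<F>"
proof -
  have "\<forall>\<^sub>F x in \<F>. norm (F x $$ (i, j) - L $$ (i, j)) \<le> mat_opnorm (F x - L)"
    using lim unfolding mat_tendsto_def
    by (auto elim!: eventually_mono)
      (use ij entry_le_mat_opnorm[of "F _ - L" "dim_row L" "dim_col L" i j] in \<open>auto simp: minus_carrier_mat\<close>)
  then have "((\<lambda>x. F x $$ (i, j) - L $$ (i, j)) \<longlongrightarrow> 0) \<F>"
    by (rule Lim_null_comparison) (use lim in \<open>simp add: mat_tendsto_def\<close>)
  then show ?thesis by (simp add: LIM_zero_iff)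
qed

lemma mat_tendsto_mult:
  assumes lim: "mat_tendsto F L \<F>" and L: "L \<in> carrier_mat m n"
    and A: "A \<in> carrier_mat k m" and B: "B \<in> carrier_mat n l"
  shows "mat_tendsto (\<lambda>x. A * F x * B) (A * L * B) \<F>"
proof -
  have car: "\<forall>\<^sub>F x in \<F>. F x \<in> carrier_mat m n"
    and lim0: "((\<lambda>x. mat_opnorm (F x - L)) \<longlongrightarrow> 0) \<F>"
    using lim L by (auto simp: mat_tendsto_def)
  have le: "mat_opnorm (A * M * B - A * L * B) \<le> mat_opnorm A * mat_opnorm (M - L) * mat_opnorm B"
    if M: "M \<in> carrier_mat m n" for M
  proof -
    have "A * M * B - A * L * B = A * (M - L) * B"
      using M A B L by (simp add: mult_minus_distrib_mat[OF A M L]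
          minus_mult_distrib_mat[of "A * M" k n "A * L" B l])
    then have "mat_opnorm (A * M * B - A * L * B) \<le> mat_opnorm (A * (M - L)) * mat_opnorm B"
      using M L A B by (simp add: mat_opnorm_mult[of _ k n _ l] minus_carrier_mat mult_carrier_mat[of _ _ m])
    also have "\<dots> \<le> mat_opnorm A * mat_opnorm (M - L) * mat_opnorm B"
      using M L A by (intro mult_right_mono mat_opnorm_mult[of _ k m _ n]) (auto simp: minus_carrier_mat)
    finally show ?thesis .
  qed
  have "((\<lambda>x. mat_opnorm A * mat_opnorm (F x - L) * mat_opnorm B) \<longlongrightarrow> 0) \<F>"
    using tendsto_mult_right[OF tendsto_mult_left[OF lim0, of "mat_opnorm A"], of "mat_opnorm B"]
    by simp
  then have "((\<lambda>x. mat_opnorm (A * F x * B - A * L * B)) \<longlongrightarrow> 0) \<F>"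
    by (rule Lim_null_comparison[rotated]) (use car le in \<open>auto elim!: eventually_mono\<close>)
  moreover have "\<forall>\<^sub>F x in \<F>. A * F x * B \<in> carrier_mat k l"
    using car by (rule eventually_mono) (use A B in auto)
  moreover have "A * L * B \<in> carrier_mat k l" using A L B by auto
  ultimately show ?thesis unfolding mat_tendsto_def by (auto simp del: index_mult_mat)
qed

lemma mat_tendsto_opnorm:
  assumes "mat_tendsto F L \<F>"
  shows "((\<lambda>x. mat_opnorm (F x)) \<longlongrightarrow> mat_opnorm L) \<F>"
proof -
  have "\<bar>mat_opnorm M - mat_opnorm L\<bar> \<le> mat_opnorm (M - L)"
    if M: "M \<in> carrier_mat (dim_row L) (dim_col L)" for M
  proof -
    have "M = (M - L) + L" "L = (-1) \<cdot>\<^sub>m (M - L) + M" using M by (auto intro!: eq_matI)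
    moreover have "mat_opnorm ((M - L) + L) \<le> mat_opnorm (M - L) + mat_opnorm L"
      "mat_opnorm ((-1) \<cdot>\<^sub>m (M - L) + M) \<le> mat_opnorm ((-1) \<cdot>\<^sub>m (M - L)) + mat_opnorm M"
      using M by (auto intro!: mat_opnorm_add[of _ "dim_row L" "dim_col L"] minus_carrier_mat)
    moreover have "mat_opnorm ((-1) \<cdot>\<^sub>m (M - L)) = mat_opnorm (M - L)"
      using mat_opnorm_smult[of "M - L" "dim_row L" "dim_col L" "-1"] by (simp add: minus_carrier_mat)
    ultimately show ?thesis by (smt (verit))
  qed
  then have "\<forall>\<^sub>F x in \<F>. norm (mat_opnorm (F x) - mat_opnorm L) \<le> mat_opnorm (F x - L)"
    using assms unfolding mat_tendsto_def by (auto elim!: eventually_mono)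
  then have "((\<lambda>x. mat_opnorm (F x) - mat_opnorm L) \<longlongrightarrow> 0) \<F>"
    by (rule Lim_null_comparison) (use assms in \<open>simp add: mat_tendsto_def\<close>)
  then show ?thesis by (simp add: LIM_zero_iff)
qed

section \<open>Analytic functions of several variables\<close>

lemma analytic_several_cong:
  assumes "analytic_several K W \<phi>" "\<And>z. z \<in> W \<Longrightarrow> \<psi> z = \<phi> z"
  shows "analytic_several K W \<psi>"
  using assms unfolding analytic_several_def by simp

lemma analytic_several_cmult:
  assumes "analytic_several K W \<phi>"
  shows "analytic_several K W (\<lambda>z. c * \<phi> z)"
  unfolding analytic_several_def
proof
  fix p assume "p \<in> W"
  then obtain r b where "r > 0" and b: "\<forall>z\<in>W. (\<forall>i<K. cmod (z i - p i) < r) \<longrightarrow>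
      ((\<lambda>\<alpha>. b \<alpha> * (\<Prod>i<K. (z i - p i) ^ \<alpha> i)) has_sum \<phi> z) {\<alpha>. \<forall>i\<ge>K. \<alpha> i = 0}"
    using assms unfolding analytic_several_def by blast
  then show "\<exists>r>0. \<exists>b. \<forall>z\<in>W. (\<forall>i<K. cmod (z i - p i) < r) \<longrightarrow>
      ((\<lambda>\<alpha>. b \<alpha> * (\<Prod>i<K. (z i - p i) ^ \<alpha> i)) has_sum c * \<phi> z) {\<alpha>. \<forall>i\<ge>K. \<alpha> i = 0}"
    by (intro exI[of _ r] conjI exI[of _ "\<lambda>\<alpha>. c * b \<alpha>"])
      (auto simp: mult.assoc intro!: has_sum_cmult_right)
qed

lemma analytic_several_add:
  assumes "analytic_several K W \<phi>" "analytic_several K W \<psi>"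
  shows "analytic_several K W (\<lambda>z. \<phi> z + \<psi> z)"
  unfolding analytic_several_def
proof
  fix p assume p: "p \<in> W"
  obtain r b where "r > 0" and b: "\<forall>z\<in>W. (\<forall>i<K. cmod (z i - p i) < r) \<longrightarrow>
      ((\<lambda>\<alpha>. b \<alpha> * (\<Prod>i<K. (z i - p i) ^ \<alpha> i)) has_sum \<phi> z) {\<alpha>. \<forall>i\<ge>K. \<alpha> i = 0}"
    using assms(1) p unfolding analytic_several_def by blast
  moreover obtain s b' where "s > 0" and b': "\<forall>z\<in>W. (\<forall>i<K. cmod (z i - p i) < s) \<longrightarrow>
      ((\<lambda>\<alpha>. b' \<alpha> * (\<Prod>i<K. (z i - p i) ^ \<alpha> i)) has_sum \<psi> z) {\<alpha>. \<forall>i\<ge>K. \<alpha> i = 0}"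
    using assms(2) p unfolding analytic_several_def by blast
  ultimately show "\<exists>r>0. \<exists>b. \<forall>z\<in>W. (\<forall>i<K. cmod (z i - p i) < r) \<longrightarrow>
      ((\<lambda>\<alpha>. b \<alpha> * (\<Prod>i<K. (z i - p i) ^ \<alpha> i)) has_sum (\<phi> z + \<psi> z)) {\<alpha>. \<forall>i\<ge>K. \<alpha> i = 0}"
    by (intro exI[of _ "min r s"] conjI exI[of _ "\<lambda>\<alpha>. b \<alpha> + b' \<alpha>"])
      (auto simp: distrib_right intro!: has_sum_add)
qed

lemma analytic_several_0: "analytic_several K W (\<lambda>_. 0)"
  unfolding analytic_several_def by (intro ballI exI[of _ 1] conjI exI[of _ "\<lambda>_. 0"]) auto

lemma analytic_several_sum:
  assumes "\<And>i. i \<in> I \<Longrightarrow> analytic_several K W (\<phi> i)"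
  shows "analytic_several K W (\<lambda>z. \<Sum>i\<in>I. \<phi> i z)"
  using assms by (induction I rule: infinite_finite_induct)
    (auto intro: analytic_several_0 analytic_several_add)

text \<open>The disc of radius \<open>R\<close> as a domain in \<open>\<complex>\<^sup>1\<close>, and the passage between one variable and \<open>\<complex>\<^sup>1\<close>.\<close>

definition disc1 :: "real \<Rightarrow> (nat \<Rightarrow> complex) set" where
  "disc1 R = {z \<in> cspace 1. cmod (z 0) < R}"

definition embed1 :: "complex \<Rightarrow> nat \<Rightarrow> complex" where
  "embed1 z = (\<lambda>i. if i = 0 then z else 0)"

lemma disc1_eq_image: "disc1 R = embed1 ` ball 0 R"
proof (intro equalityI subsetI)
  fix z assume "z \<in> disc1 R"
  then have "z = embed1 (z 0)" "z 0 \<in> ball 0 R"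
    by (auto simp: disc1_def cspace_def embed1_def)
  then show "z \<in> embed1 ` ball 0 R" by blast
qed (auto simp: disc1_def cspace_def embed1_def)

lemma cdomain_disc1:
  assumes "R > 0"
  shows "cdomain 1 (disc1 R)"
proof -
  have "continuous_on UNIV embed1"
  proof (rule continuous_on_coordinatewise_then_product)
    show "continuous_on UNIV (\<lambda>z. embed1 z i)" for i
      by (cases "i = 0") (auto simp: embed1_def)
  qed
  then have "connected (disc1 R)"
    unfolding disc1_eq_image
    by (intro connected_continuous_image) (auto intro: continuous_on_subset)
  moreover have "embed1 0 \<in> disc1 R" using assms by (auto simp: disc1_eq_image)
  moreover have "open {z :: nat \<Rightarrow> complex. cmod (z 0) < R}"
    by (intro open_Collect_less continuous_intros continuous_on_product_coordinates)
  then have "openin (top_of_set (cspace 1)) (disc1 R)"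
    unfolding openin_open disc1_def by auto
  ultimately show ?thesis by (auto simp: cdomain_def)
qed

lemma analytic_several_linear1: "analytic_several 1 W (\<lambda>z. z 0 * c)"
  unfolding analytic_several_def
proof
  fix p assume "p \<in> W"
  define b where "b = (\<lambda>\<alpha>::nat \<Rightarrow> nat. if \<alpha> 0 = 0 then p 0 * c else if \<alpha> 0 = 1 then c else 0)"
  let ?m = "\<lambda>n i::nat. if i = 0 then n else (0::nat)"
  have m: "{\<alpha>::nat \<Rightarrow> nat. \<forall>i\<ge>1. \<alpha> i = 0} = range ?m"
  proof (intro equalityI subsetI)
    fix \<alpha> :: "nat \<Rightarrow> nat" assume "\<alpha> \<in> {\<alpha>. \<forall>i\<ge>1. \<alpha> i = 0}"
    then have "\<alpha> = ?m (\<alpha> 0)" by auto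
    then show "\<alpha> \<in> range ?m" by blast
  qed auto
  have "((\<lambda>\<alpha>. b \<alpha> * (\<Prod>i<1. (z i - p i) ^ \<alpha> i)) has_sum z 0 * c) {\<alpha>. \<forall>i\<ge>1. \<alpha> i = 0}" for z
  proof -
    have "((\<lambda>\<alpha>. b \<alpha> * (\<Prod>i<1. (z i - p i) ^ \<alpha> i)) has_sum
        (\<Sum>\<alpha>\<in>{?m 0, ?m 1}. b \<alpha> * (\<Prod>i<1. (z i - p i) ^ \<alpha> i))) {?m 0, ?m 1}"
      by (rule has_sum_finite) auto
    also have "(\<Sum>\<alpha>\<in>{?m 0, ?m 1}. b \<alpha> * (\<Prod>i<1. (z i - p i) ^ \<alpha> i)) = z 0 * c"
      by (subst sum.insert) (auto simp: b_def fun_eq_iff algebra_simps)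
    finally have "((\<lambda>\<alpha>. b \<alpha> * (\<Prod>i<1. (z i - p i) ^ \<alpha> i)) has_sum z 0 * c) {?m 0, ?m 1}" .
    moreover have "b \<alpha> = 0" if "\<alpha> \<in> range ?m - {?m 0, ?m 1}" for \<alpha>
    proof -
      from that obtain n where n: "\<alpha> = ?m n" by blast
      with that have "n \<noteq> 0" "n \<noteq> 1" by auto
      with n show ?thesis by (simp add: b_def)
    qed
    moreover have "{?m 0, ?m 1} \<subseteq> range ?m" by blast
    ultimately show ?thesis
      unfolding m by (subst has_sum_cong_neutral[where T = "{?m 0, ?m 1}"]) auto
  qed
  then show "\<exists>r>0. \<exists>b. \<forall>z\<in>W. (\<forall>i<1. cmod (z i - p i) < r) \<longrightarrow>
      ((\<lambda>\<alpha>. b \<alpha> * (\<Prod>i<1. (z i - p i) ^ \<alpha> i)) has_sum z 0 * c) {\<alpha>. \<forall>i\<ge>1. \<alpha> i = 0}"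
    by (intro exI[of _ 1] conjI exI[of _ b]) auto
qed

lemma analytic_several_disc1_holomorphic:
  assumes "analytic_several 1 (disc1 R) \<phi>"
  shows "(\<lambda>z. \<phi> (embed1 z)) holomorphic_on ball 0 R"
proof -
  have "(\<lambda>z. \<phi> (embed1 z)) analytic_on ball 0 R"
    unfolding analytic_on_def
  proof
    fix c :: complex assume c: "c \<in> ball 0 R"
    then have "embed1 c \<in> disc1 R" by (simp add: disc1_eq_image)
    then obtain r b where r: "r > 0" and b: "\<forall>z\<in>disc1 R. (\<forall>i<1. cmod (z i - embed1 c i) < r) \<longrightarrow>
      ((\<lambda>\<alpha>. b \<alpha> * (\<Prod>i<1. (z i - embed1 c i) ^ \<alpha> i)) has_sum \<phi> z) {\<alpha>. \<forall>i\<ge>1. \<alpha> i = 0}"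
      using assms unfolding analytic_several_def by blast
    define s where "s = min r (R - cmod c)"
    have s: "s > 0" using r c by (simp add: s_def)
    let ?m = "\<lambda>n i::nat. if i = 0 then n else (0::nat)"
    have bij: "bij_betw ?m UNIV {\<alpha>. \<forall>i\<ge>1. \<alpha> i = 0}"
      by (rule bij_betwI[where g = "\<lambda>\<alpha>. \<alpha> 0"]) auto
    have "(\<lambda>n. b (?m n) * (w - c) ^ n) sums \<phi> (embed1 w)" if w: "w \<in> ball c s" for w
    proof -
      have "cmod w \<le> cmod c + cmod (w - c)" using norm_triangle_sub[of w c] by simp
      then have "cmod w < R" "cmod (w - c) < r"
        using w by (auto simp: s_def dist_norm norm_minus_commute)
      then have "((\<lambda>\<alpha>. b \<alpha> * (\<Prod>i<1. (embed1 w i - embed1 c i) ^ \<alpha> i)) has_sum \<phi> (embed1 w))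
          {\<alpha>. \<forall>i\<ge>1. \<alpha> i = 0}"
        using b by (auto simp: disc1_eq_image embed1_def)
      then have "((\<lambda>n. b (?m n) * (\<Prod>i<1. (embed1 w i - embed1 c i) ^ ?m n i)) has_sum \<phi> (embed1 w)) UNIV"
        using has_sum_reindex_bij_betw[OF bij] by fastforce
      then show ?thesis by (intro has_sum_imp_sums) (simp add: embed1_def)
    qed
    then have "(\<lambda>z. \<phi> (embed1 z)) holomorphic_on ball c s" by (rule power_series_holomorphic)
    then show "\<exists>e>0. (\<lambda>z. \<phi> (embed1 z)) holomorphic_on ball c e" using s by blast
  qed
  then show ?thesis by (rule analytic_imp_holomorphic)
qed

section \<open>Power series and their continuation along complex lines\<close>

text \<open>The coefficients in the definition of an NC analytic function, made explicit.\<close>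

definition nc_series_of ::
  "nat \<Rightarrow> nat \<Rightarrow> nat \<Rightarrow> nat \<Rightarrow> (complex mat \<Rightarrow> complex mat) \<Rightarrow> ((nat \<times> nat) list \<Rightarrow> complex mat) \<Rightarrow> bool"
where
  "nc_series_of g' g d' d f a \<longleftrightarrow>
     (\<forall>k. \<forall>w\<in>nc_words g' g k. a w \<in> carrier_mat d' d) \<and>
     (\<exists>\<epsilon>>0. \<forall>N\<ge>1. \<forall>X\<in>nc_int_ball g' g N. mat_opnorm X < \<epsilon> \<longrightarrow>
        mat_tendsto (\<lambda>n. nc_partial_sum g' g d' d a n N X) (f X) sequentially)"

lemma nc_has_power_series_iff: "nc_has_power_series g' g d' d f \<longleftrightarrow> (\<exists>a. nc_series_of g' g d' d f a)"
  by (simp add: nc_has_power_series_def nc_series_of_def)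

lemma nc_series_of_carrier:
  "nc_series_of g' g d' d f a \<Longrightarrow> w \<in> nc_words g' g k \<Longrightarrow> a w \<in> carrier_mat d' d"
  by (auto simp: nc_series_of_def)

lemma finite_nc_words [simp]: "finite (nc_words g' g k)"
proof -
  have "nc_words g' g k = {w. set w \<subseteq> {..<g'} \<times> {..<g} \<and> length w = k}"
    by (auto simp: nc_words_def)
  then show ?thesis by (simp add: finite_lists_length_eq)
qed

lemma nc_block_carrier [simp]: "nc_block N X j l \<in> carrier_mat N N"
  by (simp add: nc_block_def)

lemma word_eval_Nil [simp]: "word_eval N [] X = 1\<^sub>m N"
  by (simp add: word_eval_def)

lemma word_eval_Cons [simp]: "word_eval N (e # w) X = nc_block N X (fst e) (snd e) * word_eval N w X"
  by (simp add: word_eval_def split: prod.split)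

lemma word_eval_carrier [simp, intro]: "word_eval N w X \<in> carrier_mat N N"
  by (induction w) (auto intro: mult_carrier_mat[OF nc_block_carrier])

lemma word_eval_dim [simp]: "dim_row (word_eval N w X) = N" "dim_col (word_eval N w X) = N"
  using word_eval_carrier[of N w X] by (blast dest: carrier_matD)+

lemma word_eval_smult:
  assumes "X \<in> carrier_mat (g' * N) (g * N)" "w \<in> nc_words g' g k"
  shows "word_eval N w (z \<cdot>\<^sub>m X) = z ^ k \<cdot>\<^sub>m word_eval N w X"
  using assms(2)
proof (induction w arbitrary: k)
  case (Cons e w)
  then obtain k' where k: "k = Suc k'" and w: "w \<in> nc_words g' g k'" and e: "fst e < g'" "snd e < g"
    by (auto simp: nc_words_def)
  have blk: "nc_block N (z \<cdot>\<^sub>m X) (fst e) (snd e) = z \<cdot>\<^sub>m nc_block N X (fst e) (snd e)"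
    using assms(1) e block_index_less by (intro eq_matI) (auto simp: nc_block_def)
  show ?case
    by (simp add: blk Cons.IH[OF w] k mult_smult_distrib[of _ N N _ N] mult_smult_assoc_mat[of _ N N _ N]
        mult_carrier_mat[of _ N N]) (rule eq_matI, auto)
qed (auto simp: nc_words_def)

lemma nc_homogeneous_carrier [simp]: "nc_homogeneous g' g d' d a k N X \<in> carrier_mat (d' * N) (d * N)"
  by (simp add: nc_homogeneous_def)

lemma nc_partial_sum_carrier [simp]: "nc_partial_sum g' g d' d a n N X \<in> carrier_mat (d' * N) (d * N)"
  by (simp add: nc_partial_sum_def)

lemma nc_homogeneous_index:
  assumes "\<And>w. w \<in> nc_words g' g k \<Longrightarrow> a w \<in> carrier_mat d' d"
    and "i < d'" "p < N" "c < d" "q < N"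
  shows "nc_homogeneous g' g d' d a k N X $$ (i * N + p, c * N + q)
    = (\<Sum>w\<in>nc_words g' g k. a w $$ (i, c) * word_eval N w X $$ (p, q))"
  unfolding nc_homogeneous_def using assms(2-)
  by (auto simp: block_index_less kron_index[OF assms(1) word_eval_carrier] intro!: sum.cong)

lemma nc_partial_sum_index:
  assumes "I < d' * N" "J < d * N"
  shows "nc_partial_sum g' g d' d a n N X $$ (I, J)
    = (\<Sum>k<n. nc_homogeneous g' g d' d a k N X $$ (I, J))"
  using assms by (simp add: nc_partial_sum_def)

lemma nc_homogeneous_smult:
  assumes "X \<in> carrier_mat (g' * N) (g * N)" "\<And>w. w \<in> nc_words g' g k \<Longrightarrow> a w \<in> carrier_mat d' d"
  shows "nc_homogeneous g' g d' d a k N (z \<cdot>\<^sub>m X) = z ^ k \<cdot>\<^sub>m nc_homogeneous g' g d' d a k N X"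
proof (rule block_mat_eqI[of _ d' N d N])
  fix i p j q assume *: "i < d'" "p < N" "j < d" "q < N"
  have "word_eval N w (z \<cdot>\<^sub>m X) $$ (p, q) = z ^ k * word_eval N w X $$ (p, q)"
    if "w \<in> nc_words g' g k" for w
    using * by (simp add: word_eval_smult[OF assms(1) that])
  then have "nc_homogeneous g' g d' d a k N (z \<cdot>\<^sub>m X) $$ (i * N + p, j * N + q)
      = z ^ k * nc_homogeneous g' g d' d a k N X $$ (i * N + p, j * N + q)"
    using * by (simp add: nc_homogeneous_index[OF assms(2)] sum_distrib_left mult.left_commute[of _ "z ^ k"])
  then show "nc_homogeneous g' g d' d a k N (z \<cdot>\<^sub>m X) $$ (i * N + p, j * N + q)
      = (z ^ k \<cdot>\<^sub>m nc_homogeneous g' g d' d a k N X) $$ (i * N + p, j * N + q)"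
    using * block_index_less[of i d' p N] block_index_less[of j d q N]
    by (simp add: carrier_matD[OF nc_homogeneous_carrier])
qed auto

lemma nc_entry_holomorphic:
  assumes f: "nc_analytic g' g d' d f" and N: "N \<ge> 1" and X: "X \<in> carrier_mat (g' * N) (g * N)"
    and R: "R > 0" "mat_opnorm X * R \<le> 1" and ij: "i < d' * N" "j < d * N"
  shows "(\<lambda>z. f (z \<cdot>\<^sub>m X) $$ (i, j)) holomorphic_on ball 0 R"
proof -
  let ?a = "\<lambda>z :: nat \<Rightarrow> complex. z 0 \<cdot>\<^sub>m X"
  have "mat_analytic_several (g' * N) (g * N) 1 (disc1 R) ?a"
    using X by (auto simp: mat_analytic_several_def
        intro!: analytic_several_cong[OF analytic_several_linear1[unfolded One_nat_def]])
  moreover have "?a ` disc1 R \<subseteq> nc_int_ball g' g N"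
  proof -
    have "mat_opnorm (z \<cdot>\<^sub>m X) < 1" if z: "cmod z < R" for z
    proof (cases "mat_opnorm X = 0")
      case False
      then have "0 < mat_opnorm X" using mat_opnorm_nonneg[of X] by linarith
      then have "cmod z * mat_opnorm X < R * mat_opnorm X" using z by (intro mult_strict_right_mono)
      then show ?thesis using R by (simp add: mat_opnorm_smult[OF X] mult.commute)
    qed (simp add: mat_opnorm_smult[OF X])
    then show ?thesis using X by (auto simp: disc1_def nc_int_ball_def)
  qed
  ultimately have "mat_analytic_several (d' * N) (d * N) 1 (disc1 R) (\<lambda>z. f (?a z))"
    using f N cdomain_disc1[OF R(1)] unfolding nc_analytic_def nc_analytic_on_slices_def by blast
  then have "analytic_several 1 (disc1 R) (\<lambda>z. f (?a z) $$ (i, j))"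
    using ij by (simp add: mat_analytic_several_def)
  from analytic_several_disc1_holomorphic[OF this] show ?thesis by (simp add: embed1_def)
qed

text \<open>On a complex line \<open>z \<mapsto> z X\<close> an entry of \<open>f\<close> is determined, on the whole part of the line in the
  ball, by the power series: both sides below are holomorphic and agree near 0.\<close>

lemma nc_entry_eq_on_line:
  assumes f: "nc_analytic g' g d' d f" and a: "nc_series_of g' g d' d f a"
    and N: "N \<ge> 1" and X: "X \<in> carrier_mat (g' * N) (g * N)"
    and R: "R > 0" "mat_opnorm X * R \<le> 1" and ij: "i < d' * N" "j < d * N"
    and G: "G holomorphic_on ball 0 R"
    and ev: "\<And>z. \<forall>\<^sub>F n in sequentially. nc_partial_sum g' g d' d a n N (z \<cdot>\<^sub>m X) $$ (i, j) = G z"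
    and z: "cmod z < R"
  shows "f (z \<cdot>\<^sub>m X) $$ (i, j) = G z"
proof -
  obtain \<epsilon> where \<epsilon>: "\<epsilon> > 0" and ser: "\<And>X. X \<in> nc_int_ball g' g N \<Longrightarrow> mat_opnorm X < \<epsilon> \<Longrightarrow>
      mat_tendsto (\<lambda>n. nc_partial_sum g' g d' d a n N X) (f X) sequentially"
    using a N unfolding nc_series_of_def by blast
  define \<rho> where "\<rho> = min R (min \<epsilon> 1 / (1 + mat_opnorm X))"
  have pos: "0 < 1 + mat_opnorm X" using mat_opnorm_nonneg[of X] by linarith
  have \<rho>: "\<rho> > 0" "\<rho> \<le> R" using R \<epsilon> pos by (auto simp: \<rho>_def)
  have near0: "f (w \<cdot>\<^sub>m X) $$ (i, j) = G w" if w: "w \<in> ball 0 \<rho>" for w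
  proof -
    have "cmod w < min \<epsilon> 1 / (1 + mat_opnorm X)" using w by (simp add: \<rho>_def)
    then have "cmod w * (1 + mat_opnorm X) < min \<epsilon> 1" using pos by (simp add: pos_less_divide_eq)
    moreover have "cmod w * mat_opnorm X \<le> cmod w * (1 + mat_opnorm X)"
      by (simp add: algebra_simps)
    ultimately have less: "mat_opnorm (w \<cdot>\<^sub>m X) < \<epsilon>" "mat_opnorm (w \<cdot>\<^sub>m X) < 1"
      by (auto simp: mat_opnorm_smult[OF X])
    then have B: "w \<cdot>\<^sub>m X \<in> nc_int_ball g' g N" using X by (auto simp: nc_int_ball_def)
    have "f (w \<cdot>\<^sub>m X) \<in> carrier_mat (d' * N) (d * N)" using f N B by (auto simp: nc_analytic_def)
    then have "(\<lambda>n. nc_partial_sum g' g d' d a n N (w \<cdot>\<^sub>m X) $$ (i, j)) \<longlonglongrightarrow> f (w \<cdot>\<^sub>m X) $$ (i, j)"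
      using ij by (intro mat_tendsto_entry[OF ser[OF B less(1)]]) auto
    moreover have "(\<lambda>n. nc_partial_sum g' g d' d a n N (w \<cdot>\<^sub>m X) $$ (i, j)) \<longlonglongrightarrow> G w"
      using ev[of w] by (rule tendsto_eventually)
    ultimately show ?thesis by (rule LIMSEQ_unique)
  qed
  show ?thesis
    by (rule analytic_continuation_open[of "ball 0 \<rho>" "ball 0 R"])
      (use \<rho> near0 G z nc_entry_holomorphic[OF f N X R ij] in \<open>auto simp: ball_subset_ball_iff\<close>)
qed

section \<open>Compressions\<close>

text \<open>Multiplication by matrices of scalars on both sides, amplified to block size \<open>N\<close>.\<close>

definition nc_compress :: "nat \<Rightarrow> complex mat \<Rightarrow> complex mat \<Rightarrow> complex mat \<Rightarrow> complex mat" where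
  "nc_compress N P Q M = kron P (1\<^sub>m N) * M * kron Q (1\<^sub>m N)"

lemma nc_compress_carrier:
  "P \<in> carrier_mat e' d' \<Longrightarrow> Q \<in> carrier_mat d e \<Longrightarrow> M \<in> carrier_mat (d' * N) (d * N) \<Longrightarrow>
    nc_compress N P Q M \<in> carrier_mat (e' * N) (e * N)"
  unfolding nc_compress_def
  by (intro mult_carrier_mat[of _ _ "d * N"] mult_carrier_mat[of _ _ "d' * N"] kron_carrier) auto

lemma sum_of_bool_mult: "q < (N::nat) \<Longrightarrow> (\<Sum>r<N. f r * of_bool (r = q)) = (f q :: complex)"
  "q < (N::nat) \<Longrightarrow> (\<Sum>r<N. of_bool (q = r) * f r) = (f q :: complex)"
  by (simp_all add: of_bool_def if_distrib[of "\<lambda>x. _ * x"] if_distrib[of "\<lambda>x. x * _"] cong: if_cong)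

lemma nc_compress_index:
  assumes P: "P \<in> carrier_mat e' d'" and Q: "Q \<in> carrier_mat d e"
    and M: "M \<in> carrier_mat (d' * N) (d * N)"
    and rc: "r < e'" "p < N" "c < e" "q < N"
  shows "nc_compress N P Q M $$ (r * N + p, c * N + q)
    = (\<Sum>i<d'. \<Sum>k<d. P $$ (r, i) * M $$ (i * N + p, k * N + q) * Q $$ (k, c))"
proof -
  have PM: "kron P (1\<^sub>m N) * M \<in> carrier_mat (e' * N) (d * N)"
    using P M by (intro mult_carrier_mat[of _ _ "d' * N"]) auto
  have row: "(kron P (1\<^sub>m N) * M) $$ (r * N + p, k * N + q) = (\<Sum>i<d'. P $$ (r, i) * M $$ (i * N + p, k * N + q))"
    if k: "k < d" for k
  proof -
    have "(kron P (1\<^sub>m N) * M) $$ (r * N + p, k * N + q)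
        = (\<Sum>l<d' * N. kron P (1\<^sub>m N) $$ (r * N + p, l) * M $$ (l, k * N + q))"
      using P M rc k by (intro mat_mult_index[of _ "e' * N" _ _ "d * N"] block_index_less) auto
    also have "\<dots> = (\<Sum>i<d'. \<Sum>l<N. of_bool (p = l) * (P $$ (r, i) * M $$ (i * N + l, k * N + q)))"
      unfolding sum_blocks using rc P by (intro sum.cong refl) (simp add: kron_index[OF P one_carrier_mat])
    finally show ?thesis using rc by (simp add: sum_of_bool_mult)
  qed
  have "nc_compress N P Q M $$ (r * N + p, c * N + q)
      = (\<Sum>l<d * N. (kron P (1\<^sub>m N) * M) $$ (r * N + p, l) * kron Q (1\<^sub>m N) $$ (l, c * N + q))"
    unfolding nc_compress_def
    using Q PM rc by (intro mat_mult_index[of _ "e' * N" _ _ "e * N"] block_index_less) auto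
  also have "\<dots> = (\<Sum>k<d. \<Sum>l<N. (kron P (1\<^sub>m N) * M) $$ (r * N + p, k * N + l) * Q $$ (k, c) * of_bool (l = q))"
    unfolding sum_blocks using rc Q by (intro sum.cong refl) (simp add: kron_index[OF Q one_carrier_mat])
  also have "\<dots> = (\<Sum>k<d. (\<Sum>i<d'. P $$ (r, i) * M $$ (i * N + p, k * N + q)) * Q $$ (k, c))"
    using rc by (simp only: sum_of_bool_mult) (simp add: row)
  also have "\<dots> = (\<Sum>k<d. \<Sum>i<d'. P $$ (r, i) * M $$ (i * N + p, k * N + q) * Q $$ (k, c))"
    by (simp add: sum_distrib_right)
  finally show ?thesis by (simp only: sum.swap[of _ "{..<d}"])
qed

lemma nc_compress_homogeneous:
  assumes P: "P \<in> carrier_mat e' d'" and Q: "Q \<in> carrier_mat d e"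
    and a: "\<And>w. w \<in> nc_words g' g k \<Longrightarrow> a w \<in> carrier_mat d' d"
  shows "nc_homogeneous g' g e' e (\<lambda>w. P * a w * Q) k N X
    = nc_compress N P Q (nc_homogeneous g' g d' d a k N X)"
proof (rule block_mat_eqI[of _ e' N e N])
  fix r p c q assume rc: "r < e'" "p < N" "c < e" "q < N"
  have PaQ: "(P * a w * Q) $$ (r, c) = (\<Sum>i<d'. \<Sum>j<d. P $$ (r, i) * a w $$ (i, j) * Q $$ (j, c))"
    if "w \<in> nc_words g' g k" for w
  proof -
    have "P * a w \<in> carrier_mat e' d" using P a[OF that] by auto
    then have "(P * a w * Q) $$ (r, c) = (\<Sum>j<d. (P * a w) $$ (r, j) * Q $$ (j, c))"
      using Q rc by (intro mat_mult_index)
    also have "\<dots> = (\<Sum>j<d. (\<Sum>i<d'. P $$ (r, i) * a w $$ (i, j)) * Q $$ (j, c))"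
      using mat_mult_index[OF P a[OF that] rc(1)] by simp
    finally have "(P * a w * Q) $$ (r, c) = \<dots>" .
    then show ?thesis by (simp add: sum_distrib_right sum.swap[of _ "{..<d}"])
  qed
  have "nc_homogeneous g' g e' e (\<lambda>w. P * a w * Q) k N X $$ (r * N + p, c * N + q)
      = (\<Sum>w\<in>nc_words g' g k. (P * a w * Q) $$ (r, c) * word_eval N w X $$ (p, q))"
    using P Q a rc by (intro nc_homogeneous_index) auto
  also have "\<dots> = (\<Sum>w\<in>nc_words g' g k. \<Sum>i<d'. \<Sum>j<d.
      P $$ (r, i) * a w $$ (i, j) * Q $$ (j, c) * word_eval N w X $$ (p, q))"
    by (simp add: PaQ sum_distrib_right del: index_mult_mat)
  also have "\<dots> = (\<Sum>i<d'. \<Sum>j<d. \<Sum>w\<in>nc_words g' g k.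
      P $$ (r, i) * a w $$ (i, j) * Q $$ (j, c) * word_eval N w X $$ (p, q))"
    by (simp only: sum.swap[of _ "nc_words g' g k"])
  also have "\<dots> = nc_compress N P Q (nc_homogeneous g' g d' d a k N X) $$ (r * N + p, c * N + q)"
    by (simp add: nc_compress_index[OF P Q nc_homogeneous_carrier rc] nc_homogeneous_index[OF a] rc)
      (simp add: sum_distrib_left sum_distrib_right mult_ac)
  finally show "nc_homogeneous g' g e' e (\<lambda>w. P * a w * Q) k N X $$ (r * N + p, c * N + q)
      = nc_compress N P Q (nc_homogeneous g' g d' d a k N X) $$ (r * N + p, c * N + q)" .
qed (rule nc_homogeneous_carrier nc_compress_carrier[OF P Q nc_homogeneous_carrier])+

lemma nc_compress_partial_sum:
  assumes P: "P \<in> carrier_mat e' d'" and Q: "Q \<in> carrier_mat d e"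
    and a: "\<And>k w. w \<in> nc_words g' g k \<Longrightarrow> a w \<in> carrier_mat d' d"
  shows "nc_partial_sum g' g e' e (\<lambda>w. P * a w * Q) n N X
    = nc_compress N P Q (nc_partial_sum g' g d' d a n N X)"
proof (rule block_mat_eqI[of _ e' N e N])
  fix r p c q assume rc: "r < e'" "p < N" "c < e" "q < N"
  let ?H = "\<lambda>k. nc_homogeneous g' g d' d a k N X"
  have "nc_partial_sum g' g e' e (\<lambda>w. P * a w * Q) n N X $$ (r * N + p, c * N + q)
      = (\<Sum>k<n. nc_compress N P Q (?H k) $$ (r * N + p, c * N + q))"
    using rc by (simp add: nc_partial_sum_index block_index_less nc_compress_homogeneous[OF P Q a])
  also have "\<dots> = (\<Sum>k<n. \<Sum>i<d'. \<Sum>j<d. P $$ (r, i) * ?H k $$ (i * N + p, j * N + q) * Q $$ (j, c))"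
    by (simp add: nc_compress_index[OF P Q nc_homogeneous_carrier rc])
  also have "\<dots> = (\<Sum>i<d'. \<Sum>j<d. \<Sum>k<n. P $$ (r, i) * ?H k $$ (i * N + p, j * N + q) * Q $$ (j, c))"
    by (simp only: sum.swap[of _ "{..<n}"])
  also have "\<dots> = nc_compress N P Q (nc_partial_sum g' g d' d a n N X) $$ (r * N + p, c * N + q)"
    by (simp add: nc_compress_index[OF P Q nc_partial_sum_carrier rc] nc_partial_sum_index
        block_index_less rc sum_distrib_left sum_distrib_right)
  finally show "nc_partial_sum g' g e' e (\<lambda>w. P * a w * Q) n N X $$ (r * N + p, c * N + q)
      = nc_compress N P Q (nc_partial_sum g' g d' d a n N X) $$ (r * N + p, c * N + q)" .
qed (rule nc_partial_sum_carrier nc_compress_carrier[OF P Q nc_partial_sum_carrier])+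

text \<open>The block size \<open>N\<close> is recovered from the shape of the argument.\<close>

definition nc_compress_fun ::
  "nat \<Rightarrow> complex mat \<Rightarrow> complex mat \<Rightarrow> (complex mat \<Rightarrow> complex mat) \<Rightarrow> complex mat \<Rightarrow> complex mat"
where
  "nc_compress_fun g' P Q f X = nc_compress (dim_row X div g') P Q (f X)"

lemma nc_compress_fun_eq:
  "1 \<le> g' \<Longrightarrow> X \<in> nc_int_ball g' g N \<Longrightarrow> nc_compress_fun g' P Q f X = nc_compress N P Q (f X)"
  by (auto simp: nc_compress_fun_def nc_int_ball_def)

lemma nc_series_of_compress:
  assumes g': "1 \<le> g'" and P: "P \<in> carrier_mat e' d'" and Q: "Q \<in> carrier_mat d e"
    and a: "nc_series_of g' g d' d f a"
    and f: "\<And>N X. N \<ge> 1 \<Longrightarrow> X \<in> nc_int_ball g' g N \<Longrightarrow> f X \<in> carrier_mat (d' * N) (d * N)"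
  shows "nc_series_of g' g e' e (nc_compress_fun g' P Q f) (\<lambda>w. P * a w * Q)"
proof -
  note car = nc_series_of_carrier[OF a]
  obtain \<epsilon> where \<epsilon>: "\<epsilon> > 0" and ser: "\<And>N X. N \<ge> 1 \<Longrightarrow> X \<in> nc_int_ball g' g N \<Longrightarrow> mat_opnorm X < \<epsilon> \<Longrightarrow>
      mat_tendsto (\<lambda>n. nc_partial_sum g' g d' d a n N X) (f X) sequentially"
    using a unfolding nc_series_of_def by blast
  have ps: "nc_partial_sum g' g e' e (\<lambda>w. P * a w * Q) n N X
      = nc_compress N P Q (nc_partial_sum g' g d' d a n N X)" for n N X
    by (rule nc_compress_partial_sum[OF P Q]) (rule car)
  have "mat_tendsto (\<lambda>n. nc_partial_sum g' g e' e (\<lambda>w. P * a w * Q) n N X)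
      (nc_compress_fun g' P Q f X) sequentially"
    if "N \<ge> 1" "X \<in> nc_int_ball g' g N" "mat_opnorm X < \<epsilon>" for N X
    unfolding nc_compress_fun_eq[OF g' that(2)] ps nc_compress_def
    by (rule mat_tendsto_mult[OF ser[OF that] f[OF that(1,2)] kron_carrier kron_carrier])
      (rule P Q one_carrier_mat)+
  moreover have "P * a w * Q \<in> carrier_mat e' e" if "w \<in> nc_words g' g k" for w k
    using P Q car[OF that] by auto
  ultimately show ?thesis unfolding nc_series_of_def using \<epsilon> by blast
qed

lemma nc_analytic_compress:
  assumes g': "1 \<le> g'" and P: "P \<in> carrier_mat e' d'" and Q: "Q \<in> carrier_mat d e"
    and f: "nc_analytic g' g d' d f"
  shows "nc_analytic g' g e' e (nc_compress_fun g' P Q f)"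
proof -
  let ?F = "nc_compress_fun g' P Q f"
  have car: "f X \<in> carrier_mat (d' * N) (d * N)" if "N \<ge> 1" "X \<in> nc_int_ball g' g N" for N X
    using f that by (auto simp: nc_analytic_def)
  note eq = nc_compress_fun_eq[OF g']
  have carF: "?F X \<in> carrier_mat (e' * N) (e * N)" if "N \<ge> 1" "X \<in> nc_int_ball g' g N" for N X
    unfolding eq[OF that(2)] using P Q car[OF that] by (rule nc_compress_carrier)
  obtain a where "nc_series_of g' g d' d f a"
    using f unfolding nc_analytic_def nc_has_power_series_iff by blast
  then have "nc_series_of g' g e' e ?F (\<lambda>w. P * a w * Q)"
    by (rule nc_series_of_compress[OF g' P Q]) (rule car)
  then have "nc_has_power_series g' g e' e ?F" unfolding nc_has_power_series_iff by blast
  moreover have "nc_analytic_on_slices g' g e' e ?F"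
    unfolding nc_analytic_on_slices_def
  proof (intro allI impI, elim conjE)
    fix N K W a
    assume N: "1 \<le> N" and K: "1 \<le> K" and W: "cdomain K W"
      and a: "mat_analytic_several (g' * N) (g * N) K W a" "a ` W \<subseteq> nc_int_ball g' g N"
    have sl: "mat_analytic_several (d' * N) (d * N) K W (\<lambda>z. f (a z)) \<and>
        (\<forall>b. (\<forall>z\<in>W. b z = a z) \<and> b ` closure W \<subseteq> nc_int_ball g' g N \<and> mat_continuous_on (closure W) b
           \<longrightarrow> mat_continuous_on (closure W) (\<lambda>z. f (b z)))"
      using f N K W a unfolding nc_analytic_def nc_analytic_on_slices_def by blast
    have aB: "a z \<in> nc_int_ball g' g N" if "z \<in> W" for z using a that by auto
    have "analytic_several K W (\<lambda>z. ?F (a z) $$ (I, J))" if IJ: "I < e' * N" "J < e * N" for I J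
    proof -
      obtain r p where rp: "r < e'" "p < N" "I = r * N + p" using IJ(1) by (rule block_index_cases)
      obtain c q where cq: "c < e" "q < N" "J = c * N + q" using IJ(2) by (rule block_index_cases)
      have "analytic_several K W (\<lambda>z. \<Sum>i<d'. \<Sum>k<d.
          P $$ (r, i) * Q $$ (k, c) * (f (a z) $$ (i * N + p, k * N + q)))"
        using sl rp cq unfolding mat_analytic_several_def
        by (intro analytic_several_sum analytic_several_cmult) (auto simp: block_index_less)
      then show ?thesis
        by (rule analytic_several_cong)
          (simp add: eq[OF aB] rp(3) cq(3) nc_compress_index[OF P Q car[OF N aB] rp(1,2) cq(1,2)],
            simp add: mult_ac)
    qed
    then have "mat_analytic_several (e' * N) (e * N) K W (\<lambda>z. ?F (a z))"
      using carF[OF N] aB by (simp add: mat_analytic_several_def)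
    moreover have "mat_continuous_on (closure W) (\<lambda>z. ?F (b z))"
      if b: "\<forall>z\<in>W. b z = a z" "b ` closure W \<subseteq> nc_int_ball g' g N" "mat_continuous_on (closure W) b" for b
      unfolding mat_continuous_on_def
    proof
      fix x assume x: "x \<in> closure W"
      have bB: "b z \<in> nc_int_ball g' g N" if "z \<in> closure W" for z using b(2) that by auto
      have lim: "mat_tendsto (\<lambda>z. f (b z)) (f (b x)) (at x within closure W)"
        using sl b x unfolding mat_continuous_on_def by blast
      have "mat_tendsto (\<lambda>z. nc_compress N P Q (f (b z))) (nc_compress N P Q (f (b x))) (at x within closure W)"
        unfolding nc_compress_def
        by (rule mat_tendsto_mult[OF lim car[OF N bB[OF x]] kron_carrier kron_carrier])
          (rule P Q one_carrier_mat)+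
      moreover have "\<forall>\<^sub>F z in at x within closure W. nc_compress N P Q (f (b z)) = ?F (b z)"
        unfolding eventually_at_filter by (simp add: eq[OF bB])
      ultimately show "mat_tendsto (\<lambda>z. ?F (b z)) (?F (b x)) (at x within closure W)"
        unfolding mat_tendsto_def eq[OF bB[OF x]]
        by (smt (verit, best) eventually_elim2 tendsto_cong eventually_mono)
    qed
    ultimately show "mat_analytic_several (e' * N) (e * N) K W (\<lambda>z. ?F (a z)) \<and>
        (\<forall>b. (\<forall>z\<in>W. b z = a z) \<and> b ` closure W \<subseteq> nc_int_ball g' g N \<and> mat_continuous_on (closure W) b
           \<longrightarrow> mat_continuous_on (closure W) (\<lambda>z. ?F (b z)))" by blast
  qed
  ultimately show ?thesis using carF unfolding nc_analytic_def by blast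
qed

lemma nc_contractive_compress:
  assumes g': "1 \<le> g'" and P: "P \<in> carrier_mat e' d'" and Q: "Q \<in> carrier_mat d e"
    and f: "nc_analytic g' g d' d f" "nc_contractive g' g f"
    and PQ: "P * mat_adjoint P = 1\<^sub>m e'" "mat_adjoint Q * Q = 1\<^sub>m e"
  shows "nc_contractive g' g (nc_compress_fun g' P Q f)"
  unfolding nc_contractive_def
proof (intro allI impI ballI)
  fix N X assume N: "1 \<le> N" and X: "X \<in> nc_int_ball g' g N"
  have fX: "f X \<in> carrier_mat (d' * N) (d * N)" using f N X by (auto simp: nc_analytic_def)
  have kP: "kron P (1\<^sub>m N) \<in> carrier_mat (e' * N) (d' * N)" and kQ: "kron Q (1\<^sub>m N) \<in> carrier_mat (d * N) (e * N)"
    using P Q by auto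
  have "mat_opnorm (kron P (1\<^sub>m N) * f X * kron Q (1\<^sub>m N))
      \<le> mat_opnorm (kron P (1\<^sub>m N)) * mat_opnorm (f X) * mat_opnorm (kron Q (1\<^sub>m N))"
    by (intro order_trans[OF mat_opnorm_mult[OF mult_carrier_mat[OF kP fX] kQ]] mult_right_mono
        mat_opnorm_mult[OF kP fX]) auto
  also have "\<dots> \<le> 1 * 1 * 1"
    using f(2) N X by (intro mult_mono mat_opnorm_kron_coisometry[OF P PQ(1)] mat_opnorm_kron_isometry[OF Q PQ(2)])
      (auto simp: nc_contractive_def)
  finally show "mat_opnorm (nc_compress_fun g' P Q f X) \<le> 1"
    by (simp add: nc_compress_fun_eq[OF g' X] nc_compress_def)
qed

section \<open>Contractive polynomials\<close>

lemma parseval_roots_of_unity: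
  fixes c :: "nat \<Rightarrow> complex"
  assumes K: "K \<ge> 1" and \<omega>: "\<omega> = exp (2 * of_real pi * \<i> / of_nat K)"
  shows "(\<Sum>s<K. (cmod (\<Sum>k<K. (\<omega> ^ s) ^ k * c k))\<^sup>2) = K * (\<Sum>k<K. (cmod (c k))\<^sup>2)"
proof -
  have norm1: "cmod \<omega> = 1" by (simp add: \<omega> norm_exp_eq_Re)
  then have nz: "\<omega> \<noteq> 0" by auto
  have cnj: "cnj \<omega> = inverse \<omega>" using norm1 by (simp add: inverse_eq_divide complex_div_cnj[of 1])
  have pow: "\<omega> ^ k = exp (2 * of_real pi * \<i> * of_nat k / of_nat K)" for k
    by (simp add: \<omega> exp_of_nat_mult[symmetric] mult_ac)
  have \<omega>K: "\<omega> ^ K = 1" using K by (simp add: pow)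
  have ne: "\<omega> ^ k \<noteq> \<omega> ^ l" if "k < K" "l < K" "k \<noteq> l" for k l
    unfolding pow using complex_root_unity_eq[OF K, of k l] that by (simp add: cong_def)
  have orth: "(\<Sum>s<K. (\<omega> ^ k * inverse \<omega> ^ l) ^ s) = (if l = k then of_nat K else 0)"
    if "k < K" "l < K" for k l
  proof (cases "k = l")
    case True
    then show ?thesis using nz by (simp add: power_mult_distrib[symmetric])
  next
    case False
    have "\<omega> ^ k * inverse \<omega> ^ l \<noteq> 1"
      using ne[OF that False] nz by (simp add: field_simps)
    moreover have "(\<omega> ^ k * inverse \<omega> ^ l) ^ K = (\<omega> ^ K) ^ k * inverse (\<omega> ^ K) ^ l"
      by (simp add: power_mult_distrib power_inverse mult.commute flip: power_mult)
    ultimately show ?thesis using False by (simp add: geometric_sum \<omega>K)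
  qed
  have "complex_of_real (\<Sum>s<K. (cmod (\<Sum>k<K. (\<omega> ^ s) ^ k * c k))\<^sup>2)
      = (\<Sum>s<K. \<Sum>k<K. \<Sum>l<K. (\<omega> ^ k * inverse \<omega> ^ l) ^ s * (c k * cnj (c l)))"
    unfolding of_real_sum
  proof (intro sum.cong refl)
    fix s
    have "complex_of_real ((cmod (\<Sum>k<K. (\<omega> ^ s) ^ k * c k))\<^sup>2)
        = (\<Sum>k<K. (\<omega> ^ s) ^ k * c k) * (\<Sum>l<K. (inverse \<omega> ^ s) ^ l * cnj (c l))"
      unfolding complex_norm_square by (simp add: cnj)
    then show "complex_of_real ((cmod (\<Sum>k<K. (\<omega> ^ s) ^ k * c k))\<^sup>2)
        = (\<Sum>k<K. \<Sum>l<K. (\<omega> ^ k * inverse \<omega> ^ l) ^ s * (c k * cnj (c l)))"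
      by (simp add: sum_product power_mult_distrib power_mult[symmetric] mult_ac)
  qed
  also have "\<dots> = (\<Sum>k<K. \<Sum>l<K. (\<Sum>s<K. (\<omega> ^ k * inverse \<omega> ^ l) ^ s) * (c k * cnj (c l)))"
    unfolding sum_distrib_right
    by (rule trans[OF sum.swap], rule sum.cong[OF refl], rule sum.swap)
  also have "\<dots> = (\<Sum>k<K. of_nat K * (c k * cnj (c k)))"
    by (simp add: orth if_distrib[of "\<lambda>x. x * _"] cong: if_cong)
  also have "\<dots> = complex_of_real (K * (\<Sum>k<K. (cmod (c k))\<^sup>2))"
    by (simp add: sum_distrib_left complex_norm_square[symmetric])
  finally show ?thesis by (simp only: of_real_eq_iff)
qed

text \<open>A vector polynomial bounded by \<open>B\<close> on the open disc has coefficients whose squared norms sum to at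
  most \<open>B\<close>: average over the roots of unity on a circle of radius \<open>r\<close> and let \<open>r\<close> tend to 1.\<close>

lemma sum_l2sq_coeffs_le:
  assumes bound: "\<And>z. cmod z < 1 \<Longrightarrow> l2sq m (\<lambda>i. \<Sum>k<K. z ^ k * u k i) \<le> B"
  shows "(\<Sum>k<K. l2sq m (u k)) \<le> B"
proof (cases "K = 0")
  case True
  then show ?thesis using bound[of 0] by (simp add: l2sq_def)
next
  case False
  then have K: "K \<ge> 1" by simp
  define \<omega> where "\<omega> = exp (2 * of_real pi * \<i> / of_nat K)"
  have norm1: "cmod \<omega> = 1" by (simp add: \<omega>_def norm_exp_eq_Re)
  have avg: "(\<Sum>k<K. r ^ (2 * k) * l2sq m (u k)) \<le> B" if r: "0 < r" "r < 1" for r :: real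
  proof -
    have "K * (\<Sum>k<K. r ^ (2 * k) * l2sq m (u k))
        = (\<Sum>i<m. K * (\<Sum>k<K. (cmod (of_real r ^ k * u k i))\<^sup>2))"
      using r by (simp add: l2sq_def sum_distrib_left norm_mult norm_power power_mult_distrib
          power_mult[symmetric] mult.commute[of _ 2] sum.swap[of _ "{..<m}"])
    also have "\<dots> = (\<Sum>i<m. \<Sum>s<K. (cmod (\<Sum>k<K. (\<omega> ^ s) ^ k * (of_real r ^ k * u k i)))\<^sup>2)"
      by (simp only: parseval_roots_of_unity[OF K \<omega>_def])
    also have "\<dots> = (\<Sum>s<K. l2sq m (\<lambda>i. \<Sum>k<K. (of_real r * \<omega> ^ s) ^ k * u k i))"
      unfolding l2sq_def by (subst sum.swap) (simp add: power_mult_distrib mult_ac)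
    also have "\<dots> \<le> (\<Sum>s<K. B)"
      using r norm1 by (intro sum_mono bound) (simp add: norm_mult norm_power)
    finally show ?thesis using K by simp
  qed
  have "((\<lambda>r. \<Sum>k<K. r ^ (2 * k) * l2sq m (u k)) \<longlongrightarrow> (\<Sum>k<K. 1 ^ (2 * k) * l2sq m (u k))) (at_left (1::real))"
    by (intro tendsto_intros)
  moreover have "\<forall>\<^sub>F r in at_left (1::real). (\<Sum>k<K. r ^ (2 * k) * l2sq m (u k)) \<le> B"
    using eventually_at_left_real[of 0 "1::real"] avg by (auto elim!: eventually_mono)
  ultimately show ?thesis
    by (simp add: tendsto_upperbound[of _ _ "at_left (1::real)"])
qed

text \<open>On the line through a jointly nilpotent matrix the power series is a polynomial.\<close>

lemma nc_nilpotent_eval: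
  assumes f: "nc_analytic g' g d' d f" and a: "nc_series_of g' g d' d f a"
    and N: "N \<ge> 1" and X: "X \<in> carrier_mat (g' * N) (g * N)" "mat_opnorm X \<le> 1"
    and nil: "\<And>k w. k \<ge> K \<Longrightarrow> w \<in> nc_words g' g k \<Longrightarrow> word_eval N w X = 0\<^sub>m N N"
    and IJ: "I < d' * N" "J < d * N" and z: "cmod z < 1"
  shows "f (z \<cdot>\<^sub>m X) $$ (I, J) = (\<Sum>k<K. z ^ k * nc_homogeneous g' g d' d a k N X $$ (I, J))"
proof -
  let ?H = "\<lambda>k. nc_homogeneous g' g d' d a k N X"
  note car = nc_series_of_carrier[OF a]
  have H0: "?H k $$ (I, J) = 0" if k: "k \<ge> K" for k
  proof -
    obtain r p where rp: "r < d'" "p < N" "I = r * N + p" using IJ(1) by (rule block_index_cases)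
    obtain c q where cq: "c < d" "q < N" "J = c * N + q" using IJ(2) by (rule block_index_cases)
    show ?thesis
      unfolding rp(3) cq(3) using rp(1,2) cq(1,2)
      by (simp add: nc_homogeneous_index[OF car] nil[OF k])
  qed
  show ?thesis
  proof (rule nc_entry_eq_on_line[OF f a N X(1) _ _ IJ _ _ z])
    show "mat_opnorm X * 1 \<le> 1" using X(2) by simp
    show "\<forall>\<^sub>F n in sequentially. nc_partial_sum g' g d' d a n N (w \<cdot>\<^sub>m X) $$ (I, J)
        = (\<Sum>k<K. w ^ k * ?H k $$ (I, J))" for w
      unfolding eventually_sequentially
    proof (intro exI[of _ K] allI impI)
      fix n assume n: "K \<le> n"
      have "nc_homogeneous g' g d' d a k N (w \<cdot>\<^sub>m X) $$ (I, J) = w ^ k * ?H k $$ (I, J)" for k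
        using IJ by (simp add: nc_homogeneous_smult[OF X(1) car] carrier_matD[OF nc_homogeneous_carrier])
      then have "nc_partial_sum g' g d' d a n N (w \<cdot>\<^sub>m X) $$ (I, J) = (\<Sum>k<n. w ^ k * ?H k $$ (I, J))"
        by (simp add: nc_partial_sum_index[OF IJ])
      also have "\<dots> = (\<Sum>k<K. w ^ k * ?H k $$ (I, J))"
        using n H0 by (intro sum.mono_neutral_right) auto
      finally show "nc_partial_sum g' g d' d a n N (w \<cdot>\<^sub>m X) $$ (I, J) = (\<Sum>k<K. w ^ k * ?H k $$ (I, J))" .
    qed
  qed (auto intro!: holomorphic_intros)
qed

lemma smult_in_nc_int_ball:
  assumes "X \<in> carrier_mat (g' * N) (g * N)" "mat_opnorm X \<le> 1" "cmod z < 1"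
  shows "z \<cdot>\<^sub>m X \<in> nc_int_ball g' g N"
proof -
  have "cmod z * mat_opnorm X \<le> cmod z * 1" using assms by (intro mult_left_mono) auto
  then show ?thesis using assms by (simp add: nc_int_ball_def mat_opnorm_smult[OF assms(1)])
qed

lemma l2sq_blocks: "l2sq (n * N) f = (\<Sum>p<N. l2sq n (\<lambda>j. f (j * N + p)))"
  unfolding l2sq_def sum_blocks by (rule sum.swap)

lemma sum_block_column:
  fixes f :: "nat \<Rightarrow> complex"
  assumes "q < N"
  shows "(\<Sum>J<n * N. f J * (if J mod N = q then x (J div N) else 0)) = (\<Sum>c<n. f (c * N + q) * x c)"
  unfolding sum_blocks using assms
  by (intro sum.cong refl) (simp add: if_distrib[of "\<lambda>x. _ * x"] cong: if_cong)

lemma l2sq_block_column: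
  assumes "q < N"
  shows "l2sq (n * N) (\<lambda>J. if J mod N = q then x (J div N) else 0) = l2sq n x"
proof -
  have "l2sq (n * N) (\<lambda>J. if J mod N = q then x (J div N) else 0)
      = (\<Sum>p<N. if p = q then l2sq n x else 0)"
    unfolding l2sq_blocks by (intro sum.cong refl) (auto simp: l2sq_def)
  then show ?thesis using assms by simp
qed

text \<open>The Schwarz-type inequality that carries the argument: the homogeneous parts of a contractive \<open>f\<close>
  at a nilpotent contraction, applied to one block vector, have squared norms summing to at most the
  squared norm of the vector. Likewise for the adjoints.\<close>

lemma nc_contractive_block_column:
  assumes f: "nc_analytic g' g d' d f" "nc_contractive g' g f" and a: "nc_series_of g' g d' d f a"
    and N: "N \<ge> 1" and X: "X \<in> carrier_mat (g' * N) (g * N)" "mat_opnorm X \<le> 1"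
    and nil: "\<And>k w. k \<ge> K \<Longrightarrow> w \<in> nc_words g' g k \<Longrightarrow> word_eval N w X = 0\<^sub>m N N"
    and q: "q < N"
  shows "(\<Sum>k<K. \<Sum>p<N. l2sq d' (\<lambda>i. \<Sum>c<d. nc_homogeneous g' g d' d a k N X $$ (i * N + p, c * N + q) * x c))
    \<le> l2sq d x"
proof -
  let ?H = "\<lambda>k. nc_homogeneous g' g d' d a k N X"
  define v where "v = (\<lambda>J. if J mod N = q then x (J div N) else 0)"
  have "(\<Sum>k<K. l2sq (d' * N) (\<lambda>I. \<Sum>J<d * N. ?H k $$ (I, J) * v J)) \<le> l2sq (d * N) v"
  proof (rule sum_l2sq_coeffs_le)
    fix z assume z: "cmod z < 1"
    have B: "z \<cdot>\<^sub>m X \<in> nc_int_ball g' g N" by (rule smult_in_nc_int_ball[OF X z])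
    have car: "f (z \<cdot>\<^sub>m X) \<in> carrier_mat (d' * N) (d * N)"
      using f N B by (auto simp: nc_analytic_def)
    have "l2sq (d' * N) (\<lambda>I. \<Sum>k<K. z ^ k * (\<Sum>J<d * N. ?H k $$ (I, J) * v J))
        = l2sq (d' * N) (\<lambda>I. \<Sum>J<d * N. f (z \<cdot>\<^sub>m X) $$ (I, J) * v J)"
      by (intro l2sq_cong) (simp add: nc_nilpotent_eval[OF f(1) a N X nil _ _ z] sum_distrib_left
          sum_distrib_right mult.assoc sum.swap[of _ "{..<K}"])
    also have "\<dots> \<le> l2sq (d * N) v"
      using f(2) N B by (intro l2sq_mult_le_of_opnorm_le_1[OF car]) (auto simp: nc_contractive_def)
    finally show "l2sq (d' * N) (\<lambda>I. \<Sum>k<K. z ^ k * (\<Sum>J<d * N. ?H k $$ (I, J) * v J)) \<le> l2sq (d * N) v" .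
  qed
  moreover have "(\<Sum>J<d * N. ?H k $$ (I, J) * v J) = (\<Sum>c<d. ?H k $$ (I, c * N + q) * x c)" for k I
    unfolding v_def by (rule sum_block_column[OF q])
  moreover have "l2sq (d * N) v = l2sq d x" unfolding v_def by (rule l2sq_block_column[OF q])
  ultimately show ?thesis by (simp add: l2sq_blocks)
qed

lemma nc_contractive_block_row:
  assumes f: "nc_analytic g' g d' d f" "nc_contractive g' g f" and a: "nc_series_of g' g d' d f a"
    and N: "N \<ge> 1" and X: "X \<in> carrier_mat (g' * N) (g * N)" "mat_opnorm X \<le> 1"
    and nil: "\<And>k w. k \<ge> K \<Longrightarrow> w \<in> nc_words g' g k \<Longrightarrow> word_eval N w X = 0\<^sub>m N N"
    and p: "p < N"
  shows "(\<Sum>k<K. \<Sum>q<N. l2sq d (\<lambda>c. \<Sum>i<d'. cnj (y i) * nc_homogeneous g' g d' d a k N X $$ (i * N + p, c * N + q)))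
    \<le> l2sq d' y"
proof -
  let ?H = "\<lambda>k. nc_homogeneous g' g d' d a k N X"
  define v where "v = (\<lambda>J. if J mod N = p then y (J div N) else 0)"
  have "(\<Sum>k<K. l2sq (d * N) (\<lambda>J. \<Sum>I<d' * N. cnj (v I) * ?H k $$ (I, J))) \<le> l2sq (d' * N) v"
  proof (rule sum_l2sq_coeffs_le)
    fix z assume z: "cmod z < 1"
    have B: "z \<cdot>\<^sub>m X \<in> nc_int_ball g' g N" by (rule smult_in_nc_int_ball[OF X z])
    have car: "f (z \<cdot>\<^sub>m X) \<in> carrier_mat (d' * N) (d * N)"
      using f N B by (auto simp: nc_analytic_def)
    have 1: "mat_opnorm (f (z \<cdot>\<^sub>m X)) \<le> 1" using f(2) N B by (auto simp: nc_contractive_def)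
    have "l2sq (d * N) (\<lambda>J. \<Sum>k<K. z ^ k * (\<Sum>I<d' * N. cnj (v I) * ?H k $$ (I, J)))
        = l2sq (d * N) (\<lambda>J. \<Sum>I<d' * N. cnj (v I) * f (z \<cdot>\<^sub>m X) $$ (I, J))"
      by (intro l2sq_cong) (simp add: nc_nilpotent_eval[OF f(1) a N X nil _ _ z] sum_distrib_left
          mult.left_commute[of "z ^ _"] sum.swap[of _ "{..<K}"])
    also have "\<dots> \<le> (mat_opnorm (f (z \<cdot>\<^sub>m X)))\<^sup>2 * l2sq (d' * N) v"
      by (rule l2sq_adjoint_le[OF car])
    also have "\<dots> \<le> 1 * l2sq (d' * N) v"
      using 1 by (intro mult_right_mono power_le_one) auto
    finally show "l2sq (d * N) (\<lambda>J. \<Sum>k<K. z ^ k * (\<Sum>I<d' * N. cnj (v I) * ?H k $$ (I, J)))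
        \<le> l2sq (d' * N) v" by simp
  qed
  moreover have "(\<Sum>I<d' * N. cnj (v I) * ?H k $$ (I, J)) = (\<Sum>i<d'. cnj (y i) * ?H k $$ (i * N + p, J))" for k J
    using sum_block_column[OF p, of "\<lambda>I. ?H k $$ (I, J)" "\<lambda>i. cnj (y i)" d']
    by (simp add: v_def mult.commute if_distrib[of cnj] cong: if_cong)
  moreover have "l2sq (d' * N) v = l2sq d' y" unfolding v_def by (rule l2sq_block_column[OF p])
  ultimately show ?thesis by (simp add: l2sq_blocks)
qed

section \<open>Matrices that detect a word\<close>

lemma mat_opnorm_partial_matching:
  assumes A: "A \<in> carrier_mat m n"
    and ent: "\<And>i j. i < m \<Longrightarrow> j < n \<Longrightarrow> A $$ (i, j) = of_bool (S i j)"
    and row: "\<And>i j j'. i < m \<Longrightarrow> j < n \<Longrightarrow> j' < n \<Longrightarrow> S i j \<Longrightarrow> S i j' \<Longrightarrow> j = j'"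
    and col: "\<And>i i' j. i < m \<Longrightarrow> i' < m \<Longrightarrow> j < n \<Longrightarrow> S i j \<Longrightarrow> S i' j \<Longrightarrow> i = i'"
  shows "mat_opnorm A \<le> 1"
proof (rule mat_opnorm_le_1I[OF A])
  fix f
  have one: "(cmod (\<Sum>j<n. A $$ (i, j) * f j))\<^sup>2 = (\<Sum>j<n. of_bool (S i j) * (cmod (f j))\<^sup>2)" if i: "i < m" for i
  proof (cases "\<exists>j<n. S i j")
    case True
    then obtain l where l: "l < n" "S i l" by blast
    have S: "S i j \<longleftrightarrow> j = l" if "j < n" for j using row[OF i that l(1) _ l(2)] l(2) by blast
    have "(\<Sum>j<n. A $$ (i, j) * f j) = (\<Sum>j<n. if j = l then f l else 0)"
      by (rule sum.cong) (auto simp: ent i S)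
    moreover have "(\<Sum>j<n. of_bool (S i j) * (cmod (f j))\<^sup>2) = (\<Sum>j<n. if j = l then (cmod (f l))\<^sup>2 else 0)"
      by (rule sum.cong) (auto simp: S)
    ultimately show ?thesis using l(1) by simp
  qed (simp add: ent i)
  have le1: "(\<Sum>i<m. of_bool (S i j) :: real) \<le> 1" if j: "j < n" for j
  proof (cases "\<exists>i<m. S i j")
    case True
    then obtain l where l: "l < m" "S l j" by blast
    have S: "S i j \<longleftrightarrow> i = l" if "i < m" for i using col[OF that l(1) j _ l(2)] l(2) by blast
    have "(\<Sum>i<m. of_bool (S i j) :: real) = (\<Sum>i<m. if i = l then 1 else 0)"
      by (rule sum.cong) (auto simp: S)
    then show ?thesis using l(1) by simp
  qed simp
  have "l2sq m (\<lambda>i. \<Sum>j<n. A $$ (i, j) * f j) = (\<Sum>i<m. \<Sum>j<n. of_bool (S i j) * (cmod (f j))\<^sup>2)"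
    by (simp add: l2sq_def one)
  also have "\<dots> = (\<Sum>j<n. (\<Sum>i<m. of_bool (S i j)) * (cmod (f j))\<^sup>2)"
    unfolding sum_distrib_right by (rule sum.swap)
  also have "\<dots> \<le> (\<Sum>j<n. 1 * (cmod (f j))\<^sup>2)"
    by (intro sum_mono mult_right_mono le1) auto
  finally show "l2sq m (\<lambda>i. \<Sum>j<n. A $$ (i, j) * f j) \<le> l2sq n f" by (simp add: l2sq_def)
qed

lemma word_eval_Cons_index:
  assumes "p < N" "q < N"
  shows "word_eval N (e # w) X $$ (p, q)
    = (\<Sum>r<N. nc_block N X (fst e) (snd e) $$ (p, r) * word_eval N w X $$ (r, q))"
  unfolding word_eval_Cons
  using assms by (intro mat_mult_index[of _ N N _ N]) auto

lemma word_eval_single: "word_eval N [e] X = nc_block N X (fst e) (snd e)"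
  by (simp add: right_mult_one_mat[OF nc_block_carrier])

text \<open>If every nonzero entry of the blocks of \<open>X\<close> raises a rank function by one, then a word of length \<open>k\<close>
  raises it by \<open>k\<close>; in particular long words vanish.\<close>

lemma word_eval_rank:
  assumes rank: "\<And>j l p q. j < g' \<Longrightarrow> l < g \<Longrightarrow> p < N \<Longrightarrow> q < N \<Longrightarrow>
      nc_block N X j l $$ (p, q) \<noteq> 0 \<Longrightarrow> \<rho> q = Suc (\<rho> p)"
    and w: "w \<in> nc_words g' g k" and "p < N" "q < N" and ne: "word_eval N w X $$ (p, q) \<noteq> 0"
  shows "\<rho> q = \<rho> p + k"
  using w \<open>p < N\<close> ne
proof (induction w arbitrary: k p)
  case Nil
  then show ?case using \<open>q < N\<close> by (auto simp: nc_words_def split: if_splits)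
next
  case (Cons e w)
  obtain k' where k: "k = Suc k'" and w: "w \<in> nc_words g' g k'" and e: "fst e < g'" "snd e < g"
    using Cons.prems(1) by (auto simp: nc_words_def)
  obtain r where r: "r < N" "nc_block N X (fst e) (snd e) $$ (p, r) * word_eval N w X $$ (r, q) \<noteq> 0"
    using Cons.prems(3) word_eval_Cons_index[OF Cons.prems(2) \<open>q < N\<close>, of e w X]
    by (auto elim!: sum.not_neutral_contains_not_neutral)
  then have "\<rho> r = Suc (\<rho> p)" "\<rho> q = \<rho> r + k'"
    using rank[OF e Cons.prems(2) r(1)] Cons.IH[OF w r(1)] by auto
  then show ?case by (simp add: k)
qed

lemma word_eval_zero_of_rank:
  assumes rank: "\<And>j l p q. j < g' \<Longrightarrow> l < g \<Longrightarrow> p < N \<Longrightarrow> q < N \<Longrightarrow>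
      nc_block N X j l $$ (p, q) \<noteq> 0 \<Longrightarrow> \<rho> q = Suc (\<rho> p)"
    and bound: "\<And>p. p < N \<Longrightarrow> \<rho> p < K" and w: "w \<in> nc_words g' g k" and k: "K \<le> k"
  shows "word_eval N w X = 0\<^sub>m N N"
proof (rule eq_matI)
  fix p q assume "p < dim_row (0\<^sub>m N N)" "q < dim_col (0\<^sub>m N N :: complex mat)"
  then have pq: "p < N" "q < N" by auto
  have "word_eval N w X $$ (p, q) = 0"
  proof (rule ccontr)
    assume ne: "word_eval N w X $$ (p, q) \<noteq> 0"
    have "\<rho> q = \<rho> p + k"
      by (rule word_eval_rank[where g' = g' and g = g, OF _ w pq ne]) (rule rank)
    then show False using bound[OF pq(2)] k by linarith
  qed
  then show "word_eval N w X $$ (p, q) = 0\<^sub>m N N $$ (p, q)" using pq by simp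
qed auto

text \<open>For a word \<open>w = (j\<^sub>0, l\<^sub>0) \<dots> (j\<^sub>k\<^sub>-\<^sub>1, l\<^sub>k\<^sub>-\<^sub>1)\<close>, the detecting matrix is the sum of
  \<open>E\<^sub>j\<^sub>l \<otimes> E\<^sub>p\<^sub>q\<close> over the edges \<open>p \<rightarrow> q\<close> with label \<open>(j, l)\<close> of the graph below: the path \<open>0 \<rightarrow> 1 \<rightarrow> \<dots> \<rightarrow> k\<close> that spells \<open>w\<close>, and at most
  two further edges, one into \<open>k\<close> with second label \<open>m\<close> and one out of \<open>0\<close> with first label \<open>m'\<close>. The latter
  are added only if the path has no such edge; so the matrix is a partial isometry that is isometric on
  \<open>e\<^sub>m \<otimes> e\<^sub>k\<close> and whose adjoint is isometric on \<open>e\<^sub>m\<^sub>' \<otimes> e\<^sub>0\<close>.\<close>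

definition word_edge :: "(nat \<times> nat) list \<Rightarrow> nat \<Rightarrow> nat \<Rightarrow> nat \<Rightarrow> nat \<Rightarrow> nat \<Rightarrow> nat \<Rightarrow> bool" where
  "word_edge w m m' j p l q \<longleftrightarrow>
     (p < length w \<and> q = Suc p \<and> w ! p = (j, l)) \<or>
     (m \<noteq> snd (last w) \<and> j = 0 \<and> p = length w + 1 \<and> l = m \<and> q = length w) \<or>
     (m' \<noteq> fst (hd w) \<and> j = m' \<and> p = 0 \<and> l = 0 \<and> q = length w + 2)"

lemma word_detector:
  assumes w: "w \<in> nc_words g' g k" and k: "1 \<le> k" and m: "m < g" and m': "m' < g'"
  obtains N X p q j l where "k < N" "p < N" "q < N" "j < g'" "l < g"
    "X \<in> carrier_mat (g' * N) (g * N)" "mat_opnorm X \<le> 1"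
    "\<And>k' w'. Suc k \<le> k' \<Longrightarrow> w' \<in> nc_words g' g k' \<Longrightarrow> word_eval N w' X = 0\<^sub>m N N"
    "\<And>w'. w' \<in> nc_words g' g k \<Longrightarrow> word_eval N w' X $$ (0, k) = of_bool (w' = w)"
    "\<And>w'. w' \<in> nc_words g' g 1 \<Longrightarrow> word_eval N w' X $$ (p, k) = of_bool (w' = [(j, m)])"
    "\<And>w'. w' \<in> nc_words g' g 1 \<Longrightarrow> word_eval N w' X $$ (0, q) = of_bool (w' = [(m', l)])"
    "w \<noteq> [(j, m)] \<Longrightarrow> k \<noteq> 1 \<or> p \<noteq> 0" "w \<noteq> [(m', l)] \<Longrightarrow> k \<noteq> 1 \<or> q \<noteq> k"
proof -
  \<comment> \<open>Vertices \<open>0, \<dots>, k\<close> of the path, and \<open>k + 1\<close>, \<open>k + 2\<close> for the two further edges.\<close>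
  define N where "N = k + 3"
  define E where "E = word_edge w m m'"
  define X :: "complex mat" where "X = Matrix.mat (g' * N) (g * N)
    (\<lambda>(I, J). of_bool (E (I div N) (I mod N) (J div N) (J mod N)))"
  have len: "length w = k" and ws: "set w \<subseteq> {..<g'} \<times> {..<g}" and wne: "w \<noteq> []"
    using w k by (auto simp: nc_words_def)
  have hd: "hd w = w ! 0" and last: "last w = w ! (k - 1)"
    using wne len by (auto simp: hd_conv_nth last_conv_nth)
  have wi: "fst (w ! i) < g'" "snd (w ! i) < g" if "i < k" for i
    using subsetD[OF ws nth_mem[of i w]] that len by (auto simp: mem_Times_iff)
  have X: "X \<in> carrier_mat (g' * N) (g * N)" by (simp add: X_def)
  have blk: "nc_block N X j l $$ (p, q) = of_bool (E j p l q)" if "j < g'" "l < g" "p < N" "q < N" for j l p q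
    using that by (simp add: nc_block_def X_def block_index_less)
  have norm: "mat_opnorm X \<le> 1"
  proof (rule mat_opnorm_partial_matching[OF X])
    show "X $$ (I, J) = of_bool (E (I div N) (I mod N) (J div N) (J mod N))"
      if "I < g' * N" "J < g * N" for I J using that by (simp add: X_def)
    have div_mod: "I = J" if "I div N = J div N \<and> I mod N = J mod N" for I J
      using that by (metis div_mult_mod_eq)
    have row: "l = l' \<and> q = q'" if "E j p l q" "E j p l' q'" for j p l q l' q'
      using that k unfolding E_def word_edge_def len hd by (elim disjE conjE) auto
    have col: "j = j' \<and> p = p'" if "E j p l q" "E j' p' l q" for j p l q j' p'
      using that k unfolding E_def word_edge_def len last by (elim disjE conjE) auto
    show "J = J'" if "E (I div N) (I mod N) (J div N) (J mod N)" "E (I div N) (I mod N) (J' div N) (J' mod N)"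
      for I J J' by (rule div_mod, rule row[OF that])
    show "I = I'" if "E (I div N) (I mod N) (J div N) (J mod N)" "E (I' div N) (I' mod N) (J div N) (J mod N)"
      for I I' J by (rule div_mod, rule col[OF that])
  qed
  define \<rho> where "\<rho> = (\<lambda>i. if i \<le> k then i else if i = k + 1 then k - 1 else 1)"
  have rank: "\<rho> q = Suc (\<rho> p)" if "E j p l q" for j p l q
    using that k by (auto simp: E_def word_edge_def len \<rho>_def)
  have nil: "word_eval N w' X = 0\<^sub>m N N" if "Suc k \<le> k'" "w' \<in> nc_words g' g k'" for k' w'
    by (rule word_eval_zero_of_rank[where \<rho> = \<rho>, OF _ _ that(2,1)])
      (use rank k in \<open>auto simp: blk \<rho>_def\<close>)
  \<comment> \<open>No edge leaves \<open>k + 2\<close>, so the detour through it contributes nothing from \<open>0\<close> to \<open>k\<close>.\<close>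
  have dead: "word_eval N v X $$ (k + 2, k) = 0" if "set v \<subseteq> {..<g'} \<times> {..<g}" for v
  proof (cases v)
    case (Cons e u)
    then have e: "fst e < g'" "snd e < g" using that by auto
    have "\<not> E j (k + 2) l q" for j l q by (auto simp: E_def word_edge_def len)
    then have "nc_block N X (fst e) (snd e) $$ (k + 2, r) = 0" if "r < N" for r
      using blk[OF e _ that, of "k + 2"] by (simp add: N_def)
    then show ?thesis unfolding Cons by (subst word_eval_Cons_index) (auto simp: N_def)
  qed (simp add: N_def)
  \<comment> \<open>Hence the only walk of length \<open>k - i\<close> from \<open>i\<close> to \<open>k\<close> is the end of the path.\<close>
  have path: "word_eval N v X $$ (i, k) = of_bool (v = drop i w)"
    if "set v \<subseteq> {..<g'} \<times> {..<g}" "i + length v = k" for v i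
    using that
  proof (induction v arbitrary: i)
    case Nil
    then show ?case by (simp add: N_def len)
  next
    case (Cons e v)
    then have i: "i < k" and e: "fst e < g'" "snd e < g" and iv: "Suc i + length v = k"
      and v: "set v \<subseteq> {..<g'} \<times> {..<g}" by auto
    let ?t = "\<lambda>r. nc_block N X (fst e) (snd e) $$ (i, r) * word_eval N v X $$ (r, k)"
    have E: "E (fst e) i (snd e) r \<longleftrightarrow> r = Suc i \<and> w ! i = e \<or> r = k + 2 \<and> E (fst e) i (snd e) r" for r
      using i by (auto simp: E_def word_edge_def len)
    have "?t r = 0" if "r < N" "r \<noteq> Suc i" for r
    proof (cases "r = k + 2")
      case True
      then show ?thesis using dead[OF v] by simp
    next
      case False
      then show ?thesis using blk[OF e _ that(1), of i] E[of r] that i by (simp add: N_def)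
    qed
    then have "(\<Sum>r<N. ?t r) = (\<Sum>r\<in>{Suc i}. ?t r)"
      using i by (intro sum.mono_neutral_right) (auto simp: N_def)
    also have "\<dots> = of_bool (w ! i = e) * of_bool (v = drop (Suc i) w)"
      using blk[OF e, of i "Suc i"] E[of "Suc i"] i Cons.IH[OF v iv] by (simp add: N_def)
    also have "\<dots> = of_bool (e # v = drop i w)"
      using i len by (auto simp: Cons_nth_drop_Suc[symmetric])
    finally show ?case using i by (subst word_eval_Cons_index) (auto simp: N_def)
  qed
  define p where "p = (if m = snd (last w) then k - 1 else k + 1)"
  define j where "j = (if m = snd (last w) then fst (last w) else 0)"
  define q where "q = (if m' = fst (hd w) then 1 else k + 2)"
  define l where "l = (if m' = fst (hd w) then snd (hd w) else 0)"
  have single: "\<exists>e. w' = [e] \<and> fst e < g' \<and> snd e < g" if "w' \<in> nc_words g' g 1" for w'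
    using that by (auto simp: nc_words_def length_Suc_conv)
  show thesis
  proof (rule that[of N p q j l X])
    show "j < g'" using wi[of "k - 1"] m' k by (auto simp: j_def last)
    show "l < g" using wi[of 0] m k by (auto simp: l_def hd)
    show "word_eval N w' X $$ (0, k) = of_bool (w' = w)" if "w' \<in> nc_words g' g k" for w'
      using that path[of w' 0] by (auto simp: nc_words_def)
    show "word_eval N w' X $$ (p, k) = of_bool (w' = [(j, m)])" if "w' \<in> nc_words g' g 1" for w'
    proof -
      obtain e where e: "w' = [e]" "fst e < g'" "snd e < g" using single[OF \<open>w' \<in> _\<close>] by blast
      have "E (fst e) p (snd e) k \<longleftrightarrow> e = (j, m)"
        using k by (cases e) (auto simp: E_def word_edge_def len p_def j_def last)
      moreover have "p < N" "k < N" by (auto simp: p_def N_def)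
      ultimately show ?thesis using blk[OF e(2,3), of p k]
        by (simp add: e(1) word_eval_single del: word_eval_Cons)
    qed
    show "word_eval N w' X $$ (0, q) = of_bool (w' = [(m', l)])" if "w' \<in> nc_words g' g 1" for w'
    proof -
      obtain e where e: "w' = [e]" "fst e < g'" "snd e < g" using single[OF \<open>w' \<in> _\<close>] by blast
      have "E (fst e) 0 (snd e) q \<longleftrightarrow> e = (m', l)"
        using k by (cases e) (auto simp: E_def word_edge_def len q_def l_def hd)
      moreover have "0 < N" "q < N" by (auto simp: q_def N_def)
      ultimately show ?thesis using blk[OF e(2,3), of 0 q]
        by (simp add: e(1) word_eval_single del: word_eval_Cons)
    qed
    have w1: "w = [hd w]" "last w = hd w" if "k = 1"
      using len that by (auto simp: length_Suc_conv)
    show "k \<noteq> 1 \<or> p \<noteq> 0" if "w \<noteq> [(j, m)]"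
      using that w1 by (auto simp: p_def j_def)
    show "k \<noteq> 1 \<or> q \<noteq> k" if "w \<noteq> [(m', l)]"
      using that w1 by (auto simp: q_def l_def)
  qed (use X norm nil k in \<open>auto simp: N_def p_def q_def\<close>)
qed

section \<open>Orthogonality relations between the coefficients\<close>

lemma nc_homogeneous_detect:
  assumes a: "nc_series_of g' g d' d f a" and w: "w \<in> nc_words g' g k"
    and det: "\<And>w'. w' \<in> nc_words g' g k \<Longrightarrow> word_eval N w' X $$ (p, q) = of_bool (w' = w)"
    and "i < d'" "p < N" "c < d" "q < N"
  shows "nc_homogeneous g' g d' d a k N X $$ (i * N + p, c * N + q) = a w $$ (i, c)"
proof -
  have "nc_homogeneous g' g d' d a k N X $$ (i * N + p, c * N + q)
      = (\<Sum>w'\<in>nc_words g' g k. a w' $$ (i, c) * of_bool (w' = w))"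
    using assms by (simp add: nc_homogeneous_index[OF nc_series_of_carrier[OF a]])
  also have "\<dots> = (\<Sum>w'\<in>{w}. a w' $$ (i, c) * of_bool (w' = w))"
    using w by (intro sum.mono_neutral_right) auto
  finally show ?thesis by simp
qed

lemma pair_sum_le:
  fixes F :: "nat \<Rightarrow> nat \<Rightarrow> real"
  assumes nn: "\<And>k p. 0 \<le> F k p" and kp: "k < K" "p < N" "k' < K" "p' < N" "(k, p) \<noteq> (k', p')"
    and le: "(\<Sum>k<K. \<Sum>p<N. F k p) \<le> B"
  shows "F k p + F k' p' \<le> B"
proof -
  have "F k p + F k' p' = (\<Sum>(k, p)\<in>{(k, p), (k', p')}. F k p)" using kp(5) by auto
  also have "\<dots> \<le> (\<Sum>(k, p)\<in>{..<K} \<times> {..<N}. F k p)"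
    using nn kp by (intro sum_mono2) auto
  also have "\<dots> \<le> B" using le by (simp add: sum.cartesian_product)
  finally show ?thesis .
qed

lemma single_sum_le:
  fixes F :: "nat \<Rightarrow> nat \<Rightarrow> real"
  assumes nn: "\<And>k p. 0 \<le> F k p" and kp: "k < K" "p < N" and le: "(\<Sum>k<K. \<Sum>p<N. F k p) \<le> B"
  shows "F k p \<le> B"
proof -
  have "F k p \<le> (\<Sum>p<N. F k p)" using nn kp by (intro member_le_sum) auto
  also have "\<dots> \<le> (\<Sum>k<K. \<Sum>p<N. F k p)"
    using nn kp by (intro member_le_sum[where f = "\<lambda>k. \<Sum>p<N. F k p"] sum_nonneg) auto
  finally show ?thesis using le by simp
qed

text \<open>The inequalities of the previous section read off at a detecting matrix: for the column inequality,
  \<open>a\<^sub>w x\<close> is a block of the part of degree \<open>k\<close> and \<open>a\<^sub>j\<^sub>m x\<close> a block of the linear part, and these are two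
  different blocks unless \<open>w\<close> is the letter \<open>(j, m)\<close>.\<close>

lemma nc_coeff_pairs:
  assumes f: "nc_analytic g' g d' d f" "nc_contractive g' g f" and a: "nc_series_of g' g d' d f a"
    and w: "w \<in> nc_words g' g k" and k: "1 \<le> k" and m: "m < g" and m': "m' < g'"
  obtains j l where "j < g'" "l < g"
    "\<And>x. w \<noteq> [(j, m)] \<Longrightarrow> l2sq d' (\<lambda>i. \<Sum>c<d. a w $$ (i, c) * x c)
      + l2sq d' (\<lambda>i. \<Sum>c<d. a [(j, m)] $$ (i, c) * x c) \<le> l2sq d x"
    "\<And>y. w \<noteq> [(m', l)] \<Longrightarrow> l2sq d (\<lambda>c. \<Sum>i<d'. cnj (y i) * a w $$ (i, c))
      + l2sq d (\<lambda>c. \<Sum>i<d'. cnj (y i) * a [(m', l)] $$ (i, c)) \<le> l2sq d' y"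
    "\<And>x. l2sq d' (\<lambda>i. \<Sum>c<d. a w $$ (i, c) * x c) \<le> l2sq d x"
    "\<And>y. l2sq d (\<lambda>c. \<Sum>i<d'. cnj (y i) * a w $$ (i, c)) \<le> l2sq d' y"
proof -
  obtain N X p q j l where N: "k < N" "p < N" "q < N" and jl: "j < g'" "l < g"
    and X: "X \<in> carrier_mat (g' * N) (g * N)" "mat_opnorm X \<le> 1"
    and nil: "\<And>k' w'. Suc k \<le> k' \<Longrightarrow> w' \<in> nc_words g' g k' \<Longrightarrow> word_eval N w' X = 0\<^sub>m N N"
    and dw: "\<And>w'. w' \<in> nc_words g' g k \<Longrightarrow> word_eval N w' X $$ (0, k) = of_bool (w' = w)"
    and dc: "\<And>w'. w' \<in> nc_words g' g 1 \<Longrightarrow> word_eval N w' X $$ (p, k) = of_bool (w' = [(j, m)])"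
    and dr: "\<And>w'. w' \<in> nc_words g' g 1 \<Longrightarrow> word_eval N w' X $$ (0, q) = of_bool (w' = [(m', l)])"
    and pk: "w \<noteq> [(j, m)] \<Longrightarrow> k \<noteq> 1 \<or> p \<noteq> 0" "w \<noteq> [(m', l)] \<Longrightarrow> k \<noteq> 1 \<or> q \<noteq> k"
    by (rule word_detector[OF w k m m']) blast
  have N1: "1 \<le> N" "0 < N" using N by auto
  let ?H = "\<lambda>k. nc_homogeneous g' g d' d a k N X"
  have e: "[(j, m)] \<in> nc_words g' g 1" "[(m', l)] \<in> nc_words g' g 1"
    using jl m m' by (auto simp: nc_words_def)
  have Hw: "?H k $$ (i * N + 0, c * N + k) = a w $$ (i, c)" if "i < d'" "c < d" for i c
    by (rule nc_homogeneous_detect[OF a w dw]) (use that N N1 in auto)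
  have Hc: "?H 1 $$ (i * N + p, c * N + k) = a [(j, m)] $$ (i, c)" if "i < d'" "c < d" for i c
    by (rule nc_homogeneous_detect[OF a e(1) dc]) (use that N N1 in auto)
  have Hr: "?H 1 $$ (i * N + 0, c * N + q) = a [(m', l)] $$ (i, c)" if "i < d'" "c < d" for i c
    by (rule nc_homogeneous_detect[OF a e(2) dr]) (use that N N1 in auto)
  define C where "C = (\<lambda>x k' p'. l2sq d' (\<lambda>i. \<Sum>c<d. ?H k' $$ (i * N + p', c * N + k) * x c))"
  define R where "R = (\<lambda>y k' q'. l2sq d (\<lambda>c. \<Sum>i<d'. cnj (y i) * ?H k' $$ (i * N + 0, c * N + q')))"
  have sumC: "(\<Sum>k'<Suc k. \<Sum>p'<N. C x k' p') \<le> l2sq d x" for x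
    unfolding C_def by (rule nc_contractive_block_column[OF f a N1(1) X nil N(1)])
  have sumR: "(\<Sum>k'<Suc k. \<Sum>q'<N. R y k' q') \<le> l2sq d' y" for y
    unfolding R_def by (rule nc_contractive_block_row[OF f a N1(1) X nil N1(2)])
  have nnC: "0 \<le> C x k' p'" and nnR: "0 \<le> R y k' q'" for x y k' p' q' by (simp_all add: C_def R_def)
  have Cw: "C x k 0 = l2sq d' (\<lambda>i. \<Sum>c<d. a w $$ (i, c) * x c)" for x
    unfolding C_def by (rule l2sq_cong) (use Hw in simp)
  have Ce: "C x 1 p = l2sq d' (\<lambda>i. \<Sum>c<d. a [(j, m)] $$ (i, c) * x c)" for x
    unfolding C_def by (rule l2sq_cong) (use Hc in simp)
  have Rw: "R y k k = l2sq d (\<lambda>c. \<Sum>i<d'. cnj (y i) * a w $$ (i, c))" for y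
    unfolding R_def by (rule l2sq_cong) (use Hw in simp)
  have Re: "R y 1 q = l2sq d (\<lambda>c. \<Sum>i<d'. cnj (y i) * a [(m', l)] $$ (i, c))" for y
    unfolding R_def by (rule l2sq_cong) (use Hr in simp)
  show thesis
  proof (rule that[OF jl])
    show "l2sq d' (\<lambda>i. \<Sum>c<d. a w $$ (i, c) * x c)
      + l2sq d' (\<lambda>i. \<Sum>c<d. a [(j, m)] $$ (i, c) * x c) \<le> l2sq d x" if "w \<noteq> [(j, m)]" for x
      using pair_sum_le[where F = "C x", OF nnC _ N1(2) _ N(2) _ sumC, of k 1] pk(1)[OF that] k
      by (auto simp: Cw Ce[unfolded One_nat_def])
    show "l2sq d (\<lambda>c. \<Sum>i<d'. cnj (y i) * a w $$ (i, c))
      + l2sq d (\<lambda>c. \<Sum>i<d'. cnj (y i) * a [(m', l)] $$ (i, c)) \<le> l2sq d' y" if "w \<noteq> [(m', l)]" for y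
      using pair_sum_le[where F = "R y", OF nnR _ N(1) _ N(3) _ sumR, of k 1] pk(2)[OF that] k
      by (auto simp: Rw Re[unfolded One_nat_def])
    show "l2sq d' (\<lambda>i. \<Sum>c<d. a w $$ (i, c) * x c) \<le> l2sq d x" for x
      using single_sum_le[where F = "C x", OF nnC _ N1(2) sumC, of k] by (simp add: Cw)
    show "l2sq d (\<lambda>c. \<Sum>i<d'. cnj (y i) * a w $$ (i, c)) \<le> l2sq d' y" for y
      using single_sum_le[where F = "R y", OF nnR _ N(1) sumR, of k] by (simp add: Rw)
  qed
qed

lemma nc_coeff_annihilates:
  assumes f: "nc_analytic g' g d' d f" "nc_contractive g' g f" and a: "nc_series_of g' g d' d f a"
    and g': "1 \<le> g'" and w: "w \<in> nc_words g' g k" and k: "1 \<le> k" and m: "m < g"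
    and iso: "\<And>j. j < g' \<Longrightarrow> l2sq d' (\<lambda>i. \<Sum>c<d. a [(j, m)] $$ (i, c) * x c) = l2sq d x"
    and ne: "\<And>j. w \<noteq> [(j, m)]" and i: "i < d'"
  shows "(\<Sum>c<d. a w $$ (i, c) * x c) = 0"
proof -
  have "0 < g'" using g' by simp
  obtain j where j: "j < g'"
    and le: "w \<noteq> [(j, m)] \<Longrightarrow> l2sq d' (\<lambda>i. \<Sum>c<d. a w $$ (i, c) * x c)
      + l2sq d' (\<lambda>i. \<Sum>c<d. a [(j, m)] $$ (i, c) * x c) \<le> l2sq d x"
    by (rule nc_coeff_pairs[OF f a w k m \<open>0 < g'\<close>]) blast
  have "l2sq d' (\<lambda>i. \<Sum>c<d. a w $$ (i, c) * x c) \<le> 0" using le[OF ne] iso[OF j] by linarith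
  then have "l2sq d' (\<lambda>i. \<Sum>c<d. a w $$ (i, c) * x c) = 0" by (intro antisym) auto
  then show ?thesis using i by (simp add: l2sq_eq_0_iff)
qed

lemma nc_coeff_adjoint_annihilates:
  assumes f: "nc_analytic g' g d' d f" "nc_contractive g' g f" and a: "nc_series_of g' g d' d f a"
    and g: "1 \<le> g" and w: "w \<in> nc_words g' g k" and k: "1 \<le> k" and m': "m' < g'"
    and iso: "\<And>l. l < g \<Longrightarrow> l2sq d (\<lambda>c. \<Sum>i<d'. cnj (y i) * a [(m', l)] $$ (i, c)) = l2sq d' y"
    and ne: "\<And>l. w \<noteq> [(m', l)]" and c: "c < d"
  shows "(\<Sum>i<d'. cnj (y i) * a w $$ (i, c)) = 0"
proof -
  have "0 < g" using g by simp
  obtain l where l: "l < g"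
    and le: "w \<noteq> [(m', l)] \<Longrightarrow> l2sq d (\<lambda>c. \<Sum>i<d'. cnj (y i) * a w $$ (i, c))
      + l2sq d (\<lambda>c. \<Sum>i<d'. cnj (y i) * a [(m', l)] $$ (i, c)) \<le> l2sq d' y"
    by (rule nc_coeff_pairs[OF f a w k \<open>0 < g\<close> m']) blast
  have "l2sq d (\<lambda>c. \<Sum>i<d'. cnj (y i) * a w $$ (i, c)) \<le> 0" using le[OF ne] iso[OF l] by linarith
  then have "l2sq d (\<lambda>c. \<Sum>i<d'. cnj (y i) * a w $$ (i, c)) = 0" by (intro antisym) auto
  then show ?thesis using c by (simp add: l2sq_eq_0_iff)
qed

section \<open>Extremal vectors of the linear part\<close>

lemma sum_cmod_minus_mean:
  fixes u :: "nat \<Rightarrow> complex"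
  assumes s: "of_nat g * s = (\<Sum>l<g. u l)"
  shows "(\<Sum>l<g. (cmod (u l - s))\<^sup>2) = (\<Sum>l<g. (cmod (u l))\<^sup>2) - g * (cmod s)\<^sup>2"
proof -
  have "(\<Sum>l<g. cnj s * u l) = cnj s * (of_nat g * s)" by (simp add: sum_distrib_left s)
  also have "\<dots> = of_real (g * (cmod s)\<^sup>2)"
    by (simp add: complex_norm_square mult_ac del: of_real_power)
  finally have "(\<Sum>l<g. cnj s * u l) = of_real (g * (cmod s)\<^sup>2)" .
  then show ?thesis
    using l2sq_minus[of g u "\<lambda>_. s"] by (simp add: l2sq_def)
qed

text \<open>The equality case of the triangle and Cauchy-Schwarz inequalities: if \<open>\<parallel>u\<^sub>j\<^sub>l\<parallel> \<le> \<parallel>x\<^sub>l\<parallel>\<close> and the means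
  \<open>s\<^sub>j\<close> of the \<open>u\<^sub>j\<^sub>l\<close> over \<open>l\<close> are as long as possible, then \<open>u\<^sub>j\<^sub>l\<close> does not depend on \<open>l\<close>.\<close>

lemma extremal_means:
  fixes u :: "nat \<Rightarrow> nat \<Rightarrow> nat \<Rightarrow> complex" and x :: "nat \<Rightarrow> nat \<Rightarrow> complex"
  assumes g: "1 \<le> g" "1 \<le> g'"
    and s: "\<And>j i. of_nat g * s j i = (\<Sum>l<g. u j l i)"
    and u: "\<And>j l. j < g' \<Longrightarrow> l < g \<Longrightarrow> l2sq d' (u j l) \<le> l2sq d (x l)"
    and x: "(\<Sum>l<g. l2sq d (x l)) \<le> g" and sg: "(\<Sum>j<g'. l2sq d' (s j)) = g'"
    and jl: "j < g'" "l < g"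
  shows "l2sq d (x l) = 1" "l2sq d' (s j) = 1" "\<And>i. i < d' \<Longrightarrow> u j l i = s j i"
proof -
  have var: "(\<Sum>l<g. l2sq d' (\<lambda>i. u j l i - s j i)) = (\<Sum>l<g. l2sq d' (u j l)) - g * l2sq d' (s j)" for j
  proof -
    have "(\<Sum>l<g. l2sq d' (\<lambda>i. u j l i - s j i)) = (\<Sum>i<d'. \<Sum>l<g. (cmod (u j l i - s j i))\<^sup>2)"
      unfolding l2sq_def by (rule sum.swap)
    also have "\<dots> = (\<Sum>i<d'. (\<Sum>l<g. (cmod (u j l i))\<^sup>2) - g * (cmod (s j i))\<^sup>2)"
      by (simp only: sum_cmod_minus_mean[OF s])
    also have "\<dots> = (\<Sum>l<g. l2sq d' (u j l)) - g * l2sq d' (s j)"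
      unfolding l2sq_def sum_subtractf sum_distrib_left by (simp only: sum.swap[of _ "{..<d'}"])
    finally show ?thesis .
  qed
  have total: "(\<Sum>j<g'. \<Sum>l<g. l2sq d (x l)) \<le> (\<Sum>j<g'. real g)" by (intro sum_mono x)
  have "(\<Sum>j<g'. \<Sum>l<g. l2sq d' (\<lambda>i. u j l i - s j i))
      = (\<Sum>j<g'. \<Sum>l<g. l2sq d' (u j l)) - g * g'"
    by (simp add: var sum_subtractf sum_distrib_left[symmetric] sg)
  also have "(\<Sum>j<g'. \<Sum>l<g. l2sq d' (u j l)) \<le> (\<Sum>j<g'. \<Sum>l<g. l2sq d (x l))"
    by (intro sum_mono u) auto
  finally have le0: "(\<Sum>j<g'. \<Sum>l<g. l2sq d' (\<lambda>i. u j l i - s j i)) \<le> 0" using total by (simp add: mult.commute)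
  have nn: "0 \<le> (\<Sum>l<g. l2sq d' (\<lambda>i. u j l i - s j i))" for j by (simp add: sum_nonneg)
  have "(\<Sum>j<g'. \<Sum>l<g. l2sq d' (\<lambda>i. u j l i - s j i)) = 0"
    using le0 by (intro antisym sum_nonneg nn)
  then have "l2sq d' (\<lambda>i. u j l i - s j i) = 0" if "j < g'" "l < g" for j l
    using that nn by (simp add: sum_nonneg_eq_0_iff)
  then have us: "u j l i = s j i" if "j < g'" "l < g" "i < d'" for j l i
    using that by (simp add: l2sq_eq_0_iff)
  have sx: "l2sq d' (s j) \<le> l2sq d (x l)" if "j < g'" "l < g" for j l
    using u[OF that] l2sq_cong[of d' "u j l" "s j"] us[OF that] by simp
  have "(\<Sum>j<g'. \<Sum>l<g. l2sq d (x l) - l2sq d' (s j)) = (\<Sum>j<g'. \<Sum>l<g. l2sq d (x l)) - g * g'"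
    by (simp add: sum_subtractf sum_distrib_left[symmetric] sg)
  then have le0': "(\<Sum>j<g'. \<Sum>l<g. l2sq d (x l) - l2sq d' (s j)) \<le> 0" using total by (simp add: mult.commute)
  have nn': "0 \<le> (\<Sum>l<g. l2sq d (x l) - l2sq d' (s j))" if "j < g'" for j
    using sx[OF that] by (intro sum_nonneg) auto
  have "(\<Sum>j<g'. \<Sum>l<g. l2sq d (x l) - l2sq d' (s j)) = 0"
    by (rule antisym[OF le0' sum_nonneg]) (use nn' in auto)
  then have "(\<Sum>l<g. l2sq d (x l) - l2sq d' (s j)) = 0" if "j < g'" for j
    using that nn' by (subst (asm) sum_nonneg_eq_0_iff) auto
  then have s0: "(\<Sum>l<g. l2sq d (x l) - l2sq d' (s j)) = 0" if "j < g'" for j using that by blast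
  have eq: "l2sq d (x l) = l2sq d' (s j)" if "j < g'" "l < g" for j l
  proof -
    have "\<forall>l\<in>{..<g}. l2sq d (x l) - l2sq d' (s j) = 0"
      by (rule iffD1[OF sum_nonneg_eq_0_iff s0[OF that(1)]]) (use sx[OF that(1)] in auto)
    then show ?thesis using that by simp
  qed
  have "(\<Sum>j<g'. l2sq d' (s j)) = (\<Sum>j<g'. l2sq d (x l))" by (intro sum.cong) (auto simp: eq jl)
  then show x1: "l2sq d (x l) = 1" using sg g by simp
  show "l2sq d' (s j) = 1" using eq[OF jl] x1 by simp
  show "u j l i = s j i" if "i < d'" for i using us[OF jl that] .
qed

lemma sum_swap_pairs:
  "(\<Sum>i\<in>A. \<Sum>j\<in>B. \<Sum>k\<in>C. \<Sum>l\<in>D. F i j k l) = (\<Sum>k\<in>C. \<Sum>l\<in>D. \<Sum>i\<in>A. \<Sum>j\<in>B. F i j k l)"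
  by (simp only: sum.swap[where A = A and B = C] sum.swap[where A = A and B = D]
      sum.swap[where A = B and B = C] sum.swap[where A = B and B = D])

lemma nc_words_1: "nc_words g' g 1 = (\<lambda>e. [e]) ` ({..<g'} \<times> {..<g})"
  by (auto simp: nc_words_def length_Suc_conv)

lemma nc_words_0: "nc_words g' g 0 = {[]}"
  by (auto simp: nc_words_def)

text \<open>The test matrix \<open>\<kappa> \<Sum>\<^sub>j\<^sub>l E\<^sub>j\<^sub>l \<otimes> E\<^sub>j\<^sub>,\<^sub>g\<^sub>'\<^sub>+\<^sub>l\<close> with \<open>\<kappa> = 1 / sqrt (g' g)\<close> is of rank one and norm one, and the
  products of two of its blocks vanish. So the radial limit of \<open>h\<close> along it is the value of the linear part
  of \<open>h\<close>, and this value must attain the norm 1 at some unit vector.\<close>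

lemma nc_ball_map_extremal_vectors:
  assumes h: "nc_ball_map g' g d' d h" and a: "nc_series_of g' g d' d h a" and a0: "a [] = 0\<^sub>m d' d"
    and g: "1 \<le> g" "1 \<le> g'"
  obtains x s :: "nat \<Rightarrow> nat \<Rightarrow> complex" where
    "\<And>l. l < g \<Longrightarrow> l2sq d (x l) = 1" "\<And>j. j < g' \<Longrightarrow> l2sq d' (s j) = 1"
    "\<And>j l i. j < g' \<Longrightarrow> l < g \<Longrightarrow> i < d' \<Longrightarrow> (\<Sum>c<d. a [(j, l)] $$ (i, c) * x l c) = s j i"
proof -
  have f: "nc_analytic g' g d' d h" "nc_contractive g' g h" using h by (auto simp: nc_ball_map_def)
  define N where "N = g' + g"
  have N: "1 \<le> N" using g by (simp add: N_def)
  define \<kappa> where "\<kappa> = 1 / sqrt (real g * real g')"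
  have \<kappa>2: "\<kappa>\<^sup>2 = 1 / (real g * real g')" by (simp add: \<kappa>_def power_divide)
  define X :: "complex mat" where "X = Matrix.mat (g' * N) (g * N)
    (\<lambda>(I, J). of_real \<kappa> * of_bool (I mod N = I div N) * of_bool (J mod N = g' + J div N))"
  have X: "X \<in> carrier_mat (g' * N) (g * N)" by (simp add: X_def)
  have ent: "X $$ (j * N + p, l * N + q) = of_real \<kappa> * of_bool (p = j) * of_bool (q = g' + l)"
    if "j < g'" "p < N" "l < g" "q < N" for j p l q
    using that by (simp add: X_def block_index_less)
  have blk: "nc_block N X j l $$ (p, q) = of_real \<kappa> * of_bool (p = j) * of_bool (q = g' + l)"
    if "j < g'" "l < g" "p < N" "q < N" for j l p q
    using that by (simp add: nc_block_def ent)
  have Xf: "l2sq (g' * N) (\<lambda>I. \<Sum>J<g * N. X $$ (I, J) * v J)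
      = (cmod (\<Sum>l<g. v (l * N + (g' + l))))\<^sup>2 / g" for v
  proof -
    have "(\<Sum>J<g * N. X $$ (j * N + p, J) * v J)
        = of_bool (p = j) * (of_real \<kappa> * (\<Sum>l<g. v (l * N + (g' + l))))" if "j < g'" "p < N" for j p
    proof -
      have "(\<Sum>J<g * N. X $$ (j * N + p, J) * v J)
        = (\<Sum>l<g. \<Sum>q<N. (of_real \<kappa> * of_bool (p = j) * v (l * N + q)) * of_bool (q = g' + l))"
        unfolding sum_blocks using that by (intro sum.cong refl) (simp add: ent)
      also have "\<dots> = (\<Sum>l<g. of_real \<kappa> * of_bool (p = j) * v (l * N + (g' + l)))"
        by (intro sum.cong refl sum_of_bool_mult) (simp add: N_def)
      finally show ?thesis by (simp add: sum_distrib_left mult_ac)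
    qed
    then have "l2sq (g' * N) (\<lambda>I. \<Sum>J<g * N. X $$ (I, J) * v J)
        = (\<Sum>j<g'. \<Sum>p<N. (cmod (of_bool (p = j) * (of_real \<kappa> * (\<Sum>l<g. v (l * N + (g' + l))))))\<^sup>2)"
      unfolding l2sq_def sum_blocks by (intro sum.cong refl) simp
    also have "\<dots> = (\<Sum>j<g'. \<Sum>p<N. if p = j then \<kappa>\<^sup>2 * (cmod (\<Sum>l<g. v (l * N + (g' + l))))\<^sup>2 else 0)"
      by (intro sum.cong refl) (simp add: norm_mult power_mult_distrib)
    also have "\<dots> = (\<Sum>j<g'. \<kappa>\<^sup>2 * (cmod (\<Sum>l<g. v (l * N + (g' + l))))\<^sup>2)"
      by (intro sum.cong refl) (simp add: N_def)
    finally show ?thesis using g by (simp add: \<kappa>2)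
  qed
  have diag_le: "(\<Sum>l<g. F (g' + l)) \<le> (\<Sum>p<N. F p)" if "\<And>p. 0 \<le> F p" for F :: "nat \<Rightarrow> real"
  proof -
    have "(\<Sum>l<g. F (g' + l)) = sum F ((\<lambda>l. g' + l) ` {..<g})"
      by (subst sum.reindex) (auto simp: inj_on_def)
    also have "\<dots> \<le> (\<Sum>p<N. F p)" using that by (intro sum_mono2) (auto simp: N_def)
    finally show ?thesis .
  qed
  have X_le: "mat_opnorm X \<le> 1"
  proof (rule mat_opnorm_le_1I[OF X])
    fix v
    have "(cmod (\<Sum>l<g. 1 * v (l * N + (g' + l))))\<^sup>2 \<le> l2sq g (\<lambda>_. 1) * l2sq g (\<lambda>l. v (l * N + (g' + l)))"
      by (rule cauchy_schwarz_l2sq)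
    also have "l2sq g (\<lambda>l. v (l * N + (g' + l))) \<le> l2sq (g * N) v"
    proof -
      have "l2sq g (\<lambda>l. v (l * N + (g' + l))) \<le> (\<Sum>l<g. \<Sum>p<N. (cmod (v (l * N + p)))\<^sup>2)"
        unfolding l2sq_def
        by (intro sum_mono member_le_sum[where f = "\<lambda>p. (cmod (v (_ * N + p)))\<^sup>2"]) (auto simp: N_def)
      then show ?thesis by (simp add: l2sq_def sum_blocks)
    qed
    finally have "(cmod (\<Sum>l<g. v (l * N + (g' + l))))\<^sup>2 \<le> g * l2sq (g * N) v"
      by (simp add: l2sq_def mult_left_mono)
    then show "l2sq (g' * N) (\<lambda>I. \<Sum>J<g * N. X $$ (I, J) * v J) \<le> l2sq (g * N) v"
      unfolding Xf using g by (simp add: divide_le_eq mult.commute)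
  qed
  have X_ge: "1 \<le> mat_opnorm X"
  proof -
    let ?v = "\<lambda>J. of_bool (J mod N = g' + J div N) :: complex"
    have v: "?v (l * N + p) = of_bool (p = g' + l)" if "p < N" for l p using that by simp
    have "l2sq (g * N) ?v = (\<Sum>l<g. \<Sum>p<N. if p = g' + l then 1 else 0)"
      unfolding l2sq_def sum_blocks by (intro sum.cong refl) (simp add: v)
    also have "\<dots> = (\<Sum>l<g. 1)" by (intro sum.cong refl) (simp add: N_def)
    finally have nv: "l2sq (g * N) ?v = g" by simp
    have "(\<Sum>l<g. ?v (l * N + (g' + l))) = (\<Sum>l<g. 1)"
      by (intro sum.cong refl) (simp add: v N_def)
    then have "l2sq (g' * N) (\<lambda>I. \<Sum>J<g * N. X $$ (I, J) * ?v J) = g"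
      unfolding Xf using g by (simp add: power2_eq_square)
    then have "g * 1 \<le> (mat_opnorm X)\<^sup>2 * g" using l2sq_mult_le_opnorm[OF X, of ?v] nv by simp
    then have "1 \<le> (mat_opnorm X)\<^sup>2" using g by simp
    then show ?thesis using power2_le_imp_le[of 1 "mat_opnorm X"] by simp
  qed
  have X1: "mat_opnorm X = 1" using X_le X_ge by simp
  define \<rho> :: "nat \<Rightarrow> nat" where "\<rho> = (\<lambda>p. if p < g' then 0 else 1)"
  have nil: "word_eval N w X = 0\<^sub>m N N" if "2 \<le> k" "w \<in> nc_words g' g k" for k w
    by (rule word_eval_zero_of_rank[where \<rho> = \<rho> and K = 2, OF _ _ that(2,1)])
      (auto simp: blk \<rho>_def split: if_splits)
  define H where "H = nc_homogeneous g' g d' d a 1 N X"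
  have H: "H \<in> carrier_mat (d' * N) (d * N)" by (simp add: H_def)
  have H0: "nc_homogeneous g' g d' d a 0 N X $$ (I, J) = 0" if IJ: "I < d' * N" "J < d * N" for I J
  proof -
    obtain r p where rp: "r < d'" "p < N" "I = r * N + p" using IJ(1) by (rule block_index_cases)
    obtain c q where cq: "c < d" "q < N" "J = c * N + q" using IJ(2) by (rule block_index_cases)
    show ?thesis unfolding rp(3) cq(3) using rp(1,2) cq(1,2)
      by (simp add: nc_homogeneous_index[OF nc_series_of_carrier[OF a]] nc_words_0 a0)
  qed
  have hz: "h (z \<cdot>\<^sub>m X) = z \<cdot>\<^sub>m H" if z: "cmod z < 1" for z
  proof (rule eq_matI)
    have "h (z \<cdot>\<^sub>m X) \<in> carrier_mat (d' * N) (d * N)"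
      using f(1) N smult_in_nc_int_ball[OF X X_le z] by (auto simp: nc_analytic_def)
    then show "dim_row (h (z \<cdot>\<^sub>m X)) = dim_row (z \<cdot>\<^sub>m H)" "dim_col (h (z \<cdot>\<^sub>m X)) = dim_col (z \<cdot>\<^sub>m H)"
      using H by auto
    fix I J assume "I < dim_row (z \<cdot>\<^sub>m H)" "J < dim_col (z \<cdot>\<^sub>m H)"
    then have IJ: "I < d' * N" "J < d * N" using H by auto
    show "h (z \<cdot>\<^sub>m X) $$ (I, J) = (z \<cdot>\<^sub>m H) $$ (I, J)"
      using H IJ by (simp add: nc_nilpotent_eval[OF f(1) a N X X_le nil IJ z] numeral_2_eq_2 H0 H_def[symmetric, unfolded One_nat_def])
  qed
  have "nc_radial_limit h X 0 H"
    unfolding nc_radial_limit_def mat_tendsto_def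
  proof
    have ev: "\<forall>\<^sub>F r in at_left (1::real). r \<in> {0<..<1}"
      by (rule eventually_at_left_real) simp
    show "\<forall>\<^sub>F r in at_left (1::real). h ((complex_of_real r * cis 0) \<cdot>\<^sub>m X) \<in> carrier_mat (dim_row H) (dim_col H)"
      using ev by (rule eventually_mono) (simp add: hz)
    have "\<forall>\<^sub>F r in at_left (1::real). mat_opnorm (h ((complex_of_real r * cis 0) \<cdot>\<^sub>m X) - H) = (1 - r) * mat_opnorm H"
      using ev
    proof (rule eventually_mono)
      fix r :: real assume r: "r \<in> {0<..<1}"
      then have "h ((complex_of_real r * cis 0) \<cdot>\<^sub>m X) - H = of_real (r - 1) \<cdot>\<^sub>m H"
        by (auto simp: hz algebra_simps intro!: eq_matI)
      moreover have "cmod (of_real (r - 1)) = 1 - r" using r by (simp only: norm_of_real) auto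
      ultimately show "mat_opnorm (h ((complex_of_real r * cis 0) \<cdot>\<^sub>m X) - H) = (1 - r) * mat_opnorm H"
        by (simp only: mat_opnorm_smult[OF H])
    qed
    moreover have "((\<lambda>r. (1 - r) * mat_opnorm H) \<longlongrightarrow> (1 - 1) * mat_opnorm H) (at_left (1::real))"
      by (intro tendsto_intros)
    ultimately show "((\<lambda>r. mat_opnorm (h ((complex_of_real r * cis 0) \<cdot>\<^sub>m X) - H)) \<longlongrightarrow> 0) (at_left 1)"
      by (simp add: tendsto_cong)
  qed
  then have H1: "mat_opnorm H = 1" using h N X X1 unfolding nc_ball_map_def by blast
  obtain v where v: "l2sq (d * N) v \<le> 1" "l2sq (d' * N) (\<lambda>I. \<Sum>J<d * N. H $$ (I, J) * v J) = 1"
    using mat_opnorm_attained[OF H] H1 by auto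
  define x where "x = (\<lambda>l c. of_real (sqrt g) * v (c * N + (g' + l)))"
  define u where "u = (\<lambda>j l i. \<Sum>c<d. a [(j, l)] $$ (i, c) * x l c)"
  define s where "s = (\<lambda>j i. (\<Sum>l<g. u j l i) / of_nat g)"
  have gs: "of_nat g * s j i = (\<Sum>l<g. u j l i)" for j i using g by (simp add: s_def)
  have Hent: "H $$ (i * N + p, c * N + q)
      = (\<Sum>j<g'. \<Sum>l<g. a [(j, l)] $$ (i, c) * (of_real \<kappa> * of_bool (p = j) * of_bool (q = g' + l)))"
    if "i < d'" "p < N" "c < d" "q < N" for i p c q
  proof -
    have "H $$ (i * N + p, c * N + q) = (\<Sum>w\<in>nc_words g' g 1. a w $$ (i, c) * word_eval N w X $$ (p, q))"
      unfolding H_def using that by (intro nc_homogeneous_index nc_series_of_carrier[OF a])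
    also have "\<dots> = (\<Sum>e\<in>{..<g'} \<times> {..<g}. a [e] $$ (i, c) * nc_block N X (fst e) (snd e) $$ (p, q))"
      unfolding nc_words_1 by (subst sum.reindex) (auto simp: inj_on_def word_eval_single simp del: word_eval_Cons)
    also have "\<dots> = (\<Sum>j<g'. \<Sum>l<g. a [(j, l)] $$ (i, c) * nc_block N X j l $$ (p, q))"
      by (simp add: sum.cartesian_product split_beta)
    also have "\<dots> = (\<Sum>j<g'. \<Sum>l<g. a [(j, l)] $$ (i, c) * (of_real \<kappa> * of_bool (p = j) * of_bool (q = g' + l)))"
      using that by (intro sum.cong refl) (simp add: blk)
    finally show ?thesis .
  qed
  have Hv: "(\<Sum>J<d * N. H $$ (i * N + p, J) * v J)
      = (\<Sum>j<g'. of_bool (p = j) * (of_real (\<kappa> * sqrt g) * s j i))" if ip: "i < d'" "p < N" for i p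
  proof -
    have xv: "of_real \<kappa> * v (c * N + (g' + l)) = of_real (\<kappa> / sqrt g) * x l c" for l c
      using g by (simp add: x_def)
    have "(\<Sum>J<d * N. H $$ (i * N + p, J) * v J) = (\<Sum>c<d. \<Sum>q<N. \<Sum>j<g'. \<Sum>l<g.
        (a [(j, l)] $$ (i, c) * of_real \<kappa> * of_bool (p = j) * v (c * N + q)) * of_bool (q = g' + l))"
      unfolding sum_blocks using ip by (intro sum.cong refl) (simp only: Hent lessThan_iff sum_distrib_right, simp only: mult_ac)
    also have "\<dots> = (\<Sum>j<g'. \<Sum>l<g. \<Sum>c<d. \<Sum>q<N.
        (a [(j, l)] $$ (i, c) * of_real \<kappa> * of_bool (p = j) * v (c * N + q)) * of_bool (q = g' + l))"
      by (rule sum_swap_pairs)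
    also have "\<dots> = (\<Sum>j<g'. \<Sum>l<g. \<Sum>c<d.
        a [(j, l)] $$ (i, c) * of_real \<kappa> * of_bool (p = j) * v (c * N + (g' + l)))"
      by (intro sum.cong refl sum_of_bool_mult) (simp add: N_def)
    also have "\<dots> = (\<Sum>j<g'. \<Sum>l<g. \<Sum>c<d.
        of_bool (p = j) * (of_real (\<kappa> / sqrt g) * (a [(j, l)] $$ (i, c) * x l c)))"
    proof (intro sum.cong refl)
      fix j l c
      have "a [(j, l)] $$ (i, c) * of_real \<kappa> * of_bool (p = j) * v (c * N + (g' + l))
        = of_bool (p = j) * (a [(j, l)] $$ (i, c) * (of_real \<kappa> * v (c * N + (g' + l))))" by simp
      then show "a [(j, l)] $$ (i, c) * of_real \<kappa> * of_bool (p = j) * v (c * N + (g' + l))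
        = of_bool (p = j) * (of_real (\<kappa> / sqrt g) * (a [(j, l)] $$ (i, c) * x l c))"
        unfolding xv by (simp add: mult_ac)
    qed
    also have "\<dots> = (\<Sum>j<g'. of_bool (p = j) * (of_real (\<kappa> / sqrt g) * (of_nat g * s j i)))"
      unfolding gs u_def by (simp add: sum_distrib_left)
    also have "\<dots> = (\<Sum>j<g'. of_bool (p = j) * (of_real (\<kappa> * sqrt g) * s j i))"
    proof -
      have "(\<kappa> / sqrt g) * g = \<kappa> * sqrt g" using g by (simp add: field_simps)
      then have "complex_of_real (\<kappa> / sqrt g) * of_nat g = of_real (\<kappa> * sqrt g)"
        by (metis of_real_mult of_real_of_nat_eq)
      then show ?thesis by (simp add: mult.assoc[symmetric])
    qed
    finally show ?thesis .
  qed
  have "1 = (\<Sum>p<N. l2sq d' (\<lambda>i. \<Sum>j<g'. of_bool (p = j) * (of_real (\<kappa> * sqrt g) * s j i)))"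
    using v(2) unfolding l2sq_blocks by (simp add: Hv cong: l2sq_cong)
  also have "\<dots> = (\<Sum>p<N. if p < g' then (\<kappa> * sqrt g)\<^sup>2 * l2sq d' (s p) else 0)"
  proof (intro sum.cong refl)
    fix p
    have "(\<Sum>j<g'. of_bool (p = j) * (of_real (\<kappa> * sqrt g) * s j i))
        = (if p < g' then of_real (\<kappa> * sqrt g) * s p i else 0)" for i
      by (auto simp: sum_of_bool_mult intro!: sum.neutral)
    then show "l2sq d' (\<lambda>i. \<Sum>j<g'. of_bool (p = j) * (of_real (\<kappa> * sqrt g) * s j i))
        = (if p < g' then (\<kappa> * sqrt g)\<^sup>2 * l2sq d' (s p) else 0)"
      by (simp add: l2sq_smult norm_mult power_mult_distrib) (simp add: l2sq_def)
  qed
  also have "\<dots> = (\<Sum>p<g'. (\<kappa> * sqrt g)\<^sup>2 * l2sq d' (s p))"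
    by (intro sum.mono_neutral_cong_right) (auto simp: N_def)
  also have "\<dots> = (\<Sum>p<g'. l2sq d' (s p)) / g'"
    using g by (simp add: power_mult_distrib \<kappa>2 sum_divide_distrib)
  finally have sg: "(\<Sum>j<g'. l2sq d' (s j)) = g'" using g by simp
  have xg: "(\<Sum>l<g. l2sq d (x l)) \<le> g"
  proof -
    have "(\<Sum>l<g. l2sq d (x l)) = g * (\<Sum>l<g. l2sq d (\<lambda>c. v (c * N + (g' + l))))"
      by (simp add: x_def l2sq_smult sum_distrib_left)
    also have "\<dots> \<le> g * (\<Sum>p<N. l2sq d (\<lambda>c. v (c * N + p)))"
      by (intro mult_left_mono diag_le[where F = "\<lambda>p. l2sq d (\<lambda>c. v (c * N + p))"]) auto
    also have "\<dots> \<le> real g * 1" using v(1) by (intro mult_left_mono) (auto simp: l2sq_blocks)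
    finally show ?thesis by simp
  qed
  have ux: "l2sq d' (u j l) \<le> l2sq d (x l)" if "j < g'" "l < g" for j l
  proof -
    have "[(j, l)] \<in> nc_words g' g 1" using that by (simp add: nc_words_def)
    from nc_coeff_pairs[OF f a this _ that(2,1)] show ?thesis unfolding u_def by blast
  qed
  have ext: "l2sq d (x l) = 1 \<and> l2sq d' (s j) = 1 \<and> (\<forall>i<d'. u j l i = s j i)"
    if "j < g'" "l < g" for j l
    by (intro conjI allI impI extremal_means[where u = u and s = s and x = x, OF g gs _ xg sg that])
      (auto intro: ux)
  show thesis
  proof (rule that[of x s])
    show "l2sq d (x l) = 1" if "l < g" for l using ext[of 0 l] that g by simp
    show "l2sq d' (s j) = 1" if "j < g'" for j using ext[of j 0] that g by simp
    show "(\<Sum>c<d. a [(j, l)] $$ (i, c) * x l c) = s j i" if "j < g'" "l < g" "i < d'" for j l i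
      using ext[OF that(1,2)] that(3) by (simp add: u_def)
  qed
qed

section \<open>Extending orthonormal families to unitary matrices\<close>

text \<open>Orthonormality of the vectors \<open>x 0, \<dots>, x (g - 1)\<close> in \<open>\<complex>\<^sup>d\<close>.\<close>

definition orthonormal :: "nat \<Rightarrow> nat \<Rightarrow> (nat \<Rightarrow> nat \<Rightarrow> complex) \<Rightarrow> bool" where
  "orthonormal d g x \<longleftrightarrow> (\<forall>l<g. \<forall>m<g. (\<Sum>c<d. cnj (x l c) * x m c) = of_bool (l = m))"

text \<open>The residual of the \<open>i\<close>-th standard basis vector after projection onto the span.\<close>

lemma orthonormal_residual:
  assumes x: "orthonormal d g x" and i: "i < d"
  defines "r \<equiv> (\<lambda>c. of_bool (c = i) - (\<Sum>l<g. cnj (x l i) * x l c))"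
  shows "\<And>m. m < g \<Longrightarrow> (\<Sum>c<d. cnj (x m c) * r c) = 0"
    and "l2sq d r = 1 - (\<Sum>l<g. (cmod (x l i))\<^sup>2)"
proof -
  have orth: "(\<Sum>c<d. cnj (x m c) * r c) = 0" if m: "m < g" for m
  proof -
    have "(\<Sum>c<d. cnj (x m c) * r c)
        = (\<Sum>c<d. cnj (x m c) * of_bool (c = i)) - (\<Sum>c<d. \<Sum>l<g. cnj (x l i) * (cnj (x m c) * x l c))"
      by (simp add: r_def right_diff_distrib sum_subtractf sum_distrib_left mult_ac)
    also have "(\<Sum>c<d. \<Sum>l<g. cnj (x l i) * (cnj (x m c) * x l c))
        = (\<Sum>l<g. cnj (x l i) * (\<Sum>c<d. cnj (x m c) * x l c))"
      by (subst sum.swap) (simp add: sum_distrib_left)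
    also have "\<dots> = (\<Sum>l<g. of_bool (m = l) * cnj (x l i))"
      using x m by (intro sum.cong refl) (simp add: orthonormal_def)
    finally show ?thesis using i m by (simp add: sum_of_bool_mult)
  qed
  then show "\<And>m. m < g \<Longrightarrow> (\<Sum>c<d. cnj (x m c) * r c) = 0" .
  have ri: "r i = of_real (1 - (\<Sum>l<g. (cmod (x l i))\<^sup>2))"
    by (simp add: r_def complex_norm_square[symmetric] mult.commute[of "cnj _"])
  have cnj_r: "cnj (r c) = of_bool (c = i) - (\<Sum>l<g. x l i * cnj (x l c))" for c
    by (cases "c = i") (simp_all add: r_def)
  have "complex_of_real (l2sq d r)
      = (\<Sum>c<d. (of_bool (c = i) - (\<Sum>l<g. x l i * cnj (x l c))) * r c)"
    unfolding sum_cnj_self[symmetric] cnj_r ..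
  also have "\<dots> = (\<Sum>c<d. r c * of_bool (c = i)) - (\<Sum>c<d. \<Sum>l<g. x l i * (cnj (x l c) * r c))"
    unfolding left_diff_distrib sum_subtractf sum_distrib_right by (simp only: mult_ac)
  also have "(\<Sum>c<d. \<Sum>l<g. x l i * (cnj (x l c) * r c)) = (\<Sum>l<g. x l i * (\<Sum>c<d. cnj (x l c) * r c))"
    by (subst sum.swap) (simp add: sum_distrib_left)
  also have "\<dots> = 0" by (simp add: orth)
  finally have "complex_of_real (l2sq d r) = r i" using i by (simp add: sum_of_bool_mult)
  then show "l2sq d r = 1 - (\<Sum>l<g. (cmod (x l i))\<^sup>2)" unfolding ri by (simp only: of_real_eq_iff)
qed

text \<open>Summed over \<open>i\<close>, the squared norms of the residuals give \<open>d - g\<close>. Hence \<open>g \<le> d\<close>, and if \<open>g < d\<close> some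
  residual is nonzero and can be normalised to extend the family.\<close>

lemma orthonormal_residual_sum:
  assumes x: "orthonormal d g x"
  shows "(\<Sum>i<d. 1 - (\<Sum>l<g. (cmod (x l i))\<^sup>2)) = real d - real g"
proof -
  have "l2sq d (x l) = 1" if "l < g" for l
  proof -
    have "complex_of_real (l2sq d (x l)) = complex_of_real 1"
      using x that by (simp add: sum_cnj_self[symmetric] orthonormal_def)
    then show ?thesis by (simp only: of_real_eq_iff)
  qed
  then have "(\<Sum>l<g. l2sq d (x l)) = g" by simp
  then have "(\<Sum>i<d. \<Sum>l<g. (cmod (x l i))\<^sup>2) = g" unfolding l2sq_def by (subst sum.swap)
  then show ?thesis by (simp add: sum_subtractf)
qed

lemma orthonormal_card_le:
  assumes x: "orthonormal d g x"
  shows "g \<le> d"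
proof -
  have "0 \<le> 1 - (\<Sum>l<g. (cmod (x l i))\<^sup>2)" if "i < d" for i
    by (rule ord_le_eq_trans[OF l2sq_nonneg orthonormal_residual(2)[OF x that]])
  then have "0 \<le> (\<Sum>i<d. 1 - (\<Sum>l<g. (cmod (x l i))\<^sup>2))" by (intro sum_nonneg) auto
  then show ?thesis unfolding orthonormal_residual_sum[OF x] by simp
qed

lemma orthonormal_extend:
  assumes "orthonormal d g x"
  shows "\<exists>U. unitary_mat d U \<and> (\<forall>l<g. \<forall>c<d. U $$ (c, l) = x l c)"
  using assms
proof (induction "d - g" arbitrary: g x)
  case 0
  then have g: "g = d" using orthonormal_card_le by fastforce
  define U where "U = Matrix.mat d d (\<lambda>(c, l). x l c)"
  have U: "U \<in> carrier_mat d d" by (simp add: U_def)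
  have "mat_adjoint U * U = 1\<^sub>m d"
  proof (rule eq_matI)
    fix l m assume "l < dim_row (1\<^sub>m d :: complex mat)" "m < dim_col (1\<^sub>m d :: complex mat)"
    then have lm: "l < d" "m < d" by auto
    then have "(mat_adjoint U * U) $$ (l, m) = (\<Sum>c<d. cnj (x l c) * x m c)"
      using mat_mult_index[OF mat_adjoint_carrier[OF U] U lm] by (simp add: U_def)
    then show "(mat_adjoint U * U) $$ (l, m) = 1\<^sub>m d $$ (l, m)"
      using 0(2) lm by (simp add: orthonormal_def g)
  qed (use U in auto)
  moreover from this have "U * mat_adjoint U = 1\<^sub>m d"
    by (rule mat_mult_left_right_inverse[OF mat_adjoint_carrier[OF U] U])
  ultimately show ?case using U by (intro exI[of _ U]) (auto simp: unitary_mat_def U_def g)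
next
  case (Suc n)
  then have g: "g < d" by simp
  have "\<exists>i<d. 0 < 1 - (\<Sum>l<g. (cmod (x l i))\<^sup>2)"
  proof (rule ccontr)
    assume "\<not> ?thesis"
    then have "(\<Sum>i<d. 1 - (\<Sum>l<g. (cmod (x l i))\<^sup>2)) \<le> (\<Sum>i<d. 0)" by (intro sum_mono) force
    then show False unfolding orthonormal_residual_sum[OF Suc(3)] using g by simp
  qed
  then obtain i where i: "i < d" and pos: "0 < 1 - (\<Sum>l<g. (cmod (x l i))\<^sup>2)" by blast
  define r where "r = (\<lambda>c. of_bool (c = i) - (\<Sum>l<g. cnj (x l i) * x l c))"
  have orth: "(\<Sum>c<d. cnj (x m c) * r c) = 0" if "m < g" for m
    unfolding r_def by (rule orthonormal_residual(1)[OF Suc(3) i that])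
  have r0: "0 < l2sq d r" using orthonormal_residual(2)[OF Suc(3) i] pos by (simp add: r_def)
  define e where "e = (\<lambda>c. of_real (1 / sqrt (l2sq d r)) * r c)"
  have "l2sq d e = 1" unfolding e_def l2sq_smult using r0 by (simp add: norm_divide power_divide)
  then have ee: "(\<Sum>c<d. cnj (e c) * e c) = 1" by (simp add: sum_cnj_self)
  have xe: "(\<Sum>c<d. cnj (x m c) * e c) = 0" if "m < g" for m
  proof -
    have "(\<Sum>c<d. cnj (x m c) * e c) = of_real (1 / sqrt (l2sq d r)) * (\<Sum>c<d. cnj (x m c) * r c)"
      unfolding e_def sum_distrib_left by (intro sum.cong refl) (simp only: mult_ac)
    then show ?thesis using orth[OF that] by simp
  qed
  have ex: "(\<Sum>c<d. cnj (e c) * x m c) = 0" if "m < g" for m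
  proof -
    have "(\<Sum>c<d. cnj (e c) * x m c) = cnj (\<Sum>c<d. cnj (x m c) * e c)" by (simp add: mult.commute)
    then show ?thesis using xe[OF that] by simp
  qed
  have "orthonormal d (Suc g) (x(g := e))"
    using Suc(3) ee xe ex by (auto simp: orthonormal_def less_Suc_eq)
  moreover have "n = d - Suc g" using Suc(2) by simp
  ultimately obtain U where U: "unitary_mat d U"
    "\<forall>l<Suc g. \<forall>c<d. U $$ (c, l) = (x(g := e)) l c" using Suc(1) by blast
  have "\<forall>l<g. \<forall>c<d. U $$ (c, l) = x l c" using U(2) by auto
  with U(1) show ?case by blast
qed

section \<open>Block identities give ball maps\<close>

text \<open>The norm of \<open>h(X)\<close> is that of \<open>X \<oplus> ht(X)\<close>, hence between \<open>\<parallel>X\<parallel>\<close> and 1.\<close>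

lemma nc_block_identity_opnorm:
  assumes g': "1 \<le> g'" and h: "nc_analytic g' g d' d h" and U: "unitary_mat d U" and V: "unitary_mat d' V"
    and ht: "nc_analytic g' g (d' - g') (d - g) ht" "nc_contractive g' g ht"
    and id: "nc_block_identity g' g d' d h V U ht"
    and N: "1 \<le> N" and X: "X \<in> nc_int_ball g' g N"
  shows "mat_opnorm (h X) \<le> 1" "mat_opnorm X \<le> mat_opnorm (h X)"
proof -
  have le: "g' \<le> d'" "g \<le> d" using id by (auto simp: nc_block_identity_def)
  have Uc: "U \<in> carrier_mat d d" and UU: "U * mat_adjoint U = 1\<^sub>m d" "mat_adjoint U * U = 1\<^sub>m d"
    and Vc: "V \<in> carrier_mat d' d'" and VV: "V * mat_adjoint V = 1\<^sub>m d'" "mat_adjoint V * V = 1\<^sub>m d'"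
    using U V by (auto simp: unitary_mat_def)
  define Y where "Y = ht X"
  have Xc: "X \<in> carrier_mat (g' * N) (g * N)" and X1: "mat_opnorm X < 1"
    using X by (auto simp: nc_int_ball_def)
  have Yc: "Y \<in> carrier_mat ((d' - g') * N) ((d - g) * N)" using ht N X by (auto simp: nc_analytic_def Y_def)
  have Y1: "mat_opnorm Y \<le> 1" using ht N X by (auto simp: nc_contractive_def Y_def)
  define Z where "Z = four_block_mat X (0\<^sub>m (g' * N) ((d - g) * N)) (0\<^sub>m ((d' - g') * N) (g * N)) Y"
  define kV where "kV = kron V (1\<^sub>m N)"
  define kU where "kU = kron U (1\<^sub>m N)"
  have dims: "g' * N + (d' - g') * N = d' * N" "g * N + (d - g) * N = d * N"
    using le by (simp_all flip: distrib_right)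
  have Zc: "Z \<in> carrier_mat (d' * N) (d * N)"
    unfolding Z_def using four_block_carrier_mat[OF Xc Yc] dims by simp
  have kc: "kV \<in> carrier_mat (d' * N) (d' * N)" "kU \<in> carrier_mat (d * N) (d * N)"
    using Uc Vc by (auto simp: kV_def kU_def)
  have hX: "h X = kV * Z * mat_adjoint kU"
    using id N X by (simp add: nc_block_identity_def kV_def kU_def Z_def Y_def)
  have hc: "h X \<in> carrier_mat (d' * N) (d * N)" using h N X by (auto simp: nc_analytic_def)
  have n1: "mat_opnorm kV \<le> 1" "mat_opnorm kU \<le> 1"
    unfolding kV_def kU_def
    by (rule mat_opnorm_kron_isometry[OF Vc VV(2)], rule mat_opnorm_kron_isometry[OF Uc UU(2)])
  have n2: "mat_opnorm (mat_adjoint kV) \<le> 1" "mat_opnorm (mat_adjoint kU) \<le> 1"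
    using n1 by (simp_all add: mat_opnorm_adjoint[OF kc(1)] mat_opnorm_adjoint[OF kc(2)])
  have sandwich: "mat_opnorm (A * M * B) \<le> mat_opnorm M"
    if "A \<in> carrier_mat (d' * N) (d' * N)" "M \<in> carrier_mat (d' * N) (d * N)" "B \<in> carrier_mat (d * N) (d * N)"
      "mat_opnorm A \<le> 1" "mat_opnorm B \<le> 1" for A M B
  proof -
    have "mat_opnorm (A * M * B) \<le> mat_opnorm (A * M) * mat_opnorm B"
      using that by (intro mat_opnorm_mult) auto
    also have "\<dots> \<le> mat_opnorm (A * M) * 1" using that by (intro mult_left_mono) auto
    also have "\<dots> \<le> mat_opnorm A * mat_opnorm M" using mat_opnorm_mult[OF that(1,2)] by simp
    also have "\<dots> \<le> 1 * mat_opnorm M" using that by (intro mult_right_mono) auto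
    finally show ?thesis by simp
  qed
  have Z1: "mat_opnorm Z \<le> 1"
  proof (rule mat_opnorm_le_1I[OF Zc])
    fix f
    have split: "l2sq (m + n) F = l2sq m F + l2sq n (\<lambda>i. F (m + i))" for m n F
      by (induction n) (simp_all add: l2sq_def add.assoc)
    have splits: "(\<Sum>j<m + n. F j) = (\<Sum>j<m. F j) + (\<Sum>j<n. F (m + j))" for m n and F :: "nat \<Rightarrow> complex"
      by (induction n) (simp_all add: add.assoc)
    have "l2sq (g' * N) (\<lambda>i. \<Sum>j<d * N. Z $$ (i, j) * f j) = l2sq (g' * N) (\<lambda>i. \<Sum>j<g * N. X $$ (i, j) * f j)"
      unfolding dims[symmetric] splits Z_def using Xc Yc by (intro l2sq_cong) simp
    moreover have "l2sq ((d' - g') * N) (\<lambda>i. \<Sum>j<d * N. Z $$ (g' * N + i, j) * f j)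
        = l2sq ((d' - g') * N) (\<lambda>i. \<Sum>j<(d - g) * N. Y $$ (i, j) * f (g * N + j))"
      unfolding dims[symmetric] splits Z_def using Xc Yc by (intro l2sq_cong) simp
    moreover have "l2sq (g' * N) (\<lambda>i. \<Sum>j<g * N. X $$ (i, j) * f j) \<le> l2sq (g * N) f"
      using X1 by (intro l2sq_mult_le_of_opnorm_le_1[OF Xc]) auto
    moreover have "l2sq ((d' - g') * N) (\<lambda>i. \<Sum>j<(d - g) * N. Y $$ (i, j) * f (g * N + j))
        \<le> l2sq ((d - g) * N) (\<lambda>j. f (g * N + j))"
      by (rule l2sq_mult_le_of_opnorm_le_1[OF Yc Y1])
    ultimately have "l2sq (g' * N + (d' - g') * N) (\<lambda>i. \<Sum>j<d * N. Z $$ (i, j) * f j)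
        \<le> l2sq (g * N + (d - g) * N) f"
      unfolding split by linarith
    then show "l2sq (d' * N) (\<lambda>i. \<Sum>j<d * N. Z $$ (i, j) * f j) \<le> l2sq (d * N) f" unfolding dims .
  qed
  show "mat_opnorm (h X) \<le> 1"
    unfolding hX using sandwich[OF kc(1) Zc mat_adjoint_carrier[OF kc(2)] n1(1) n2(2)] Z1 by linarith
  have kk: "mat_adjoint kV * kV = 1\<^sub>m (d' * N)" "mat_adjoint kU * kU = 1\<^sub>m (d * N)"
    unfolding kV_def kU_def adjoint_kron[OF Vc] adjoint_kron[OF Uc]
    using Vc Uc by (simp_all add: kron_mult[of _ d' d' _ N N _ d' _ N] kron_mult[of _ d d _ N N _ d _ N]
        VV UU kron_one)
  have "mat_adjoint kV * h X * kU = (mat_adjoint kV * kV) * Z * (mat_adjoint kU * kU)"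
    unfolding hX using kc Zc
    by (simp add: assoc_mult_mat[of _ "d' * N" "d' * N" _ "d' * N" _ "d * N"]
        assoc_mult_mat[of _ "d' * N" "d' * N" _ "d * N" _ "d * N"]
        assoc_mult_mat[of _ "d' * N" "d * N" _ "d * N" _ "d * N"] mult_carrier_mat[of _ _ "d' * N"]
        mult_carrier_mat[of _ _ "d * N"])
  then have Z: "Z = mat_adjoint kV * h X * kU" using Zc by (simp add: kk)
  have "mat_opnorm X \<le> mat_opnorm Z"
  proof (rule mat_opnorm_leI[OF Xc])
    fix f :: "nat \<Rightarrow> complex"
    define f0 where "f0 = (\<lambda>j. if j < g * N then f j else 0)"
    have gd: "g' * N \<le> d' * N" "g * N \<le> d * N" using le by auto
    have "l2sq (g' * N) (\<lambda>i. \<Sum>j<g * N. X $$ (i, j) * f j) = l2sq (g' * N) (\<lambda>i. \<Sum>j<d * N. Z $$ (i, j) * f0 j)"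
    proof (rule l2sq_cong)
      fix i assume i: "i < g' * N"
      show "(\<Sum>j<g * N. X $$ (i, j) * f j) = (\<Sum>j<d * N. Z $$ (i, j) * f0 j)"
        using gd i Xc Yc by (intro sum.mono_neutral_cong_left) (auto simp: f0_def Z_def)
    qed
    also have "\<dots> \<le> l2sq (d' * N) (\<lambda>i. \<Sum>j<d * N. Z $$ (i, j) * f0 j)"
      unfolding l2sq_def using gd by (intro sum_mono2) auto
    also have "\<dots> \<le> (mat_opnorm Z)\<^sup>2 * l2sq (d * N) f0" by (rule l2sq_mult_le_opnorm[OF Zc])
    also have "l2sq (d * N) f0 = l2sq (g * N) f"
      unfolding l2sq_def using gd by (intro sum.mono_neutral_cong_right) (auto simp: f0_def)
    finally show "l2sq (g' * N) (\<lambda>i. \<Sum>j<g * N. X $$ (i, j) * f j) \<le> (mat_opnorm Z)\<^sup>2 * l2sq (g * N) f" .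
  qed simp
  also have "mat_opnorm Z \<le> mat_opnorm (h X)"
    unfolding Z by (rule sandwich[OF mat_adjoint_carrier[OF kc(1)] hc kc(2) n2(1) n1(2)])
  finally show "mat_opnorm X \<le> mat_opnorm (h X)" .
qed

lemma nc_block_identity_ball_map:
  assumes g': "1 \<le> g'" and h: "nc_analytic g' g d' d h" and U: "unitary_mat d U" and V: "unitary_mat d' V"
    and ht: "nc_analytic g' g (d' - g') (d - g) ht" "nc_contractive g' g ht"
    and id: "nc_block_identity g' g d' d h V U ht"
  shows "nc_ball_map g' g d' d h"
proof -
  note norm = nc_block_identity_opnorm[OF g' h U V ht id]
  have "mat_opnorm L = 1"
    if N: "1 \<le> N" and X: "X \<in> carrier_mat (g' * N) (g * N)" "mat_opnorm X = 1" and lim: "nc_radial_limit h X t L"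
    for N X t L
  proof -
    let ?h = "\<lambda>r::real. mat_opnorm (h ((complex_of_real r * cis t) \<cdot>\<^sub>m X))"
    have conv: "(?h \<longlongrightarrow> mat_opnorm L) (at_left 1)"
      using lim unfolding nc_radial_limit_def by (rule mat_tendsto_opnorm)
    have ev: "\<forall>\<^sub>F r in at_left (1::real). r \<in> {0<..<1}"
      by (rule eventually_at_left_real) simp
    have "\<forall>\<^sub>F r in at_left (1::real). r \<le> ?h r \<and> ?h r \<le> 1"
      using ev
    proof (rule eventually_mono)
      fix r :: real assume r: "r \<in> {0<..<1}"
      then have nr: "mat_opnorm ((complex_of_real r * cis t) \<cdot>\<^sub>m X) = r"
        by (simp add: mat_opnorm_smult[OF X(1)] X(2) norm_mult)
      then have "(complex_of_real r * cis t) \<cdot>\<^sub>m X \<in> nc_int_ball g' g N"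
        using X(1) r by (simp add: nc_int_ball_def)
      from norm[OF N this] show "r \<le> ?h r \<and> ?h r \<le> 1" unfolding nr by blast
    qed
    then have ge: "\<forall>\<^sub>F r in at_left (1::real). r \<le> ?h r" and le: "\<forall>\<^sub>F r in at_left (1::real). ?h r \<le> 1"
      by (auto elim: eventually_mono)
    have "1 \<le> mat_opnorm L" by (rule tendsto_le[OF _ conv tendsto_ident_at ge]) simp
    moreover have "mat_opnorm L \<le> 1" by (rule tendsto_upperbound[OF conv le]) simp
    ultimately show ?thesis by simp
  qed
  then show ?thesis unfolding nc_ball_map_def nc_contractive_def using h norm(1) by blast
qed

lemma nc_block_identity_zero:
  assumes id: "nc_block_identity g' g d' d h V U ht"
    and U: "unitary_mat d U" and V: "unitary_mat d' V"
    and ht0: "ht (0\<^sub>m g' g) = 0\<^sub>m (d' - g') (d - g)"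
  shows "h (0\<^sub>m g' g) = 0\<^sub>m d' d"
proof -
  have le: "g' \<le> d'" "g \<le> d" using id by (auto simp: nc_block_identity_def)
  have "0\<^sub>m g' g \<in> nc_int_ball g' g 1" by (simp add: nc_int_ball_def)
  then have "h (0\<^sub>m g' g) = kron V (1\<^sub>m 1) *
      four_block_mat (0\<^sub>m g' g) (0\<^sub>m (g' * 1) ((d - g) * 1)) (0\<^sub>m ((d' - g') * 1) (g * 1)) (0\<^sub>m (d' - g') (d - g)) *
      mat_adjoint (kron U (1\<^sub>m 1))"
    using id ht0 unfolding nc_block_identity_def by (metis order_refl)
  also have "four_block_mat (0\<^sub>m g' g) (0\<^sub>m (g' * 1) ((d - g) * 1)) (0\<^sub>m ((d' - g') * 1) (g * 1))
      (0\<^sub>m (d' - g') (d - g)) = (0\<^sub>m d' d :: complex mat)"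
    using le by (intro eq_matI) auto
  also have "kron V (1\<^sub>m 1) * 0\<^sub>m d' d * mat_adjoint (kron U (1\<^sub>m 1)) = 0\<^sub>m d' d"
  proof -
    have k: "kron V (1\<^sub>m 1) \<in> carrier_mat d' d'" "mat_adjoint (kron U (1\<^sub>m 1)) \<in> carrier_mat d d"
      using U V kron_carrier[of V d' d' "1\<^sub>m 1" 1 1] kron_carrier[of U d d "1\<^sub>m 1" 1 1]
      by (auto simp: unitary_mat_def)
    show ?thesis unfolding right_mult_zero_mat[OF k(1)] by (rule left_mult_zero_mat[OF k(2)])
  qed
  finally show ?thesis .
qed

section \<open>Splitting off the identity\<close>

lemma nc_coeff_Nil_zero:
  assumes a: "nc_series_of g' g d' d f a" and f0: "f (0\<^sub>m g' g) = 0\<^sub>m d' d"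
  shows "a [] = 0\<^sub>m d' d"
proof (rule eq_matI)
  note car = nc_series_of_carrier[OF a]
  show dims: "dim_row (a []) = dim_row (0\<^sub>m d' d :: complex mat)" "dim_col (a []) = dim_col (0\<^sub>m d' d :: complex mat)"
    using car[of "[]" 0] by (auto simp: nc_words_def)
  have B: "0\<^sub>m g' g \<in> nc_int_ball g' g 1" by (simp add: nc_int_ball_def)
  then have lim: "mat_tendsto (\<lambda>n. nc_partial_sum g' g d' d a n 1 (0\<^sub>m g' g)) (0\<^sub>m d' d) sequentially"
    using a f0 unfolding nc_series_of_def by (metis mat_opnorm_zero order_refl)
  fix i j assume "i < dim_row (0\<^sub>m d' d :: complex mat)" "j < dim_col (0\<^sub>m d' d :: complex mat)"
  then have ij: "i < d'" "j < d" by auto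
  have H: "nc_homogeneous g' g d' d a k 1 (0\<^sub>m g' g) $$ (i, j) = (if k = 0 then a [] $$ (i, j) else 0)" for k
  proof -
    have "nc_homogeneous g' g d' d a k 1 (0\<^sub>m g' g) $$ (i * 1 + 0, j * 1 + 0)
        = (\<Sum>w\<in>nc_words g' g k. a w $$ (i, j) * word_eval 1 w (0\<^sub>m g' g) $$ (0, 0))"
      using ij by (intro nc_homogeneous_index car) auto
    also have "\<dots> = (if k = 0 then a [] $$ (i, j) else 0)"
    proof (cases k)
      case (Suc k')
      have "word_eval 1 w (0\<^sub>m g' g) $$ (0, 0) = 0" if w: "w \<in> nc_words g' g k" for w
      proof -
        obtain e v where ev: "w = e # v" "fst e < g'" "snd e < g"
          using w Suc by (cases w) (auto simp: nc_words_def)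
        have "nc_block 1 (0\<^sub>m g' g) (fst e) (snd e) $$ (0, 0) = 0" using ev by (cases e) (simp add: nc_block_def)
        then show ?thesis unfolding ev(1) by (subst word_eval_Cons_index) auto
      qed
      then show ?thesis using Suc by simp
    qed (simp add: nc_words_0)
    finally show ?thesis by simp
  qed
  have "nc_partial_sum g' g d' d a n 1 (0\<^sub>m g' g) $$ (i, j) = a [] $$ (i, j)" if "1 \<le> n" for n
    using ij that by (simp add: nc_partial_sum_index H[unfolded One_nat_def])
  then have "\<forall>\<^sub>F n in sequentially. nc_partial_sum g' g d' d a n 1 (0\<^sub>m g' g) $$ (i, j) = a [] $$ (i, j)"
    unfolding eventually_sequentially by blast
  then have "(\<lambda>n. nc_partial_sum g' g d' d a n 1 (0\<^sub>m g' g) $$ (i, j)) \<longlonglongrightarrow> a [] $$ (i, j)"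
    by (rule tendsto_eventually)
  moreover have "(\<lambda>n. nc_partial_sum g' g d' d a n 1 (0\<^sub>m g' g) $$ (i, j)) \<longlonglongrightarrow> 0\<^sub>m d' d $$ (i, j)"
    using ij by (intro mat_tendsto_entry[OF lim]) auto
  ultimately show "a [] $$ (i, j) = 0\<^sub>m d' d $$ (i, j)" by (rule LIMSEQ_unique)
qed

text \<open>In suitable orthonormal bases, the coefficients of an NC ball map fixing the origin agree with those
  of \<open>x\<close> in the first \<open>g'\<close> rows and in the first \<open>g\<close> columns.\<close>

lemma nc_ball_map_coefficients:
  assumes h: "nc_ball_map g' g d' d h" and h0: "h (0\<^sub>m g' g) = 0\<^sub>m d' d"
    and g: "1 \<le> g" "1 \<le> g'" and a: "nc_series_of g' g d' d h a"
  obtains U V where "g \<le> d" "g' \<le> d'" "unitary_mat d U" "unitary_mat d' V"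
    "\<And>k w r c. w \<in> nc_words g' g k \<Longrightarrow> r < d' \<Longrightarrow> c < d \<Longrightarrow> r < g' \<or> c < g \<Longrightarrow>
      (mat_adjoint V * a w * U) $$ (r, c) = of_bool (w = [(r, c)])"
proof -
  have f: "nc_analytic g' g d' d h" "nc_contractive g' g h" using h by (auto simp: nc_ball_map_def)
  have a0: "a [] = 0\<^sub>m d' d" by (rule nc_coeff_Nil_zero[OF a h0])
  obtain x s where x1: "\<And>l. l < g \<Longrightarrow> l2sq d (x l) = 1" and s1: "\<And>j. j < g' \<Longrightarrow> l2sq d' (s j) = 1"
    and axs: "\<And>j l i. j < g' \<Longrightarrow> l < g \<Longrightarrow> i < d' \<Longrightarrow> (\<Sum>c<d. a [(j, l)] $$ (i, c) * x l c) = s j i"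
    by (rule nc_ball_map_extremal_vectors[OF h a a0 g]) blast
  have e: "[(j, l)] \<in> nc_words g' g 1" if "j < g'" "l < g" for j l
    using that by (simp add: nc_words_def)
  have swap: "(\<Sum>c<d. (\<Sum>i<d'. cnj (y i) * A $$ (i, c)) * z c) = (\<Sum>i<d'. cnj (y i) * (\<Sum>c<d. A $$ (i, c) * z c))"
    for A :: "complex mat" and y z
    unfolding sum_distrib_left sum_distrib_right by (subst sum.swap) (simp only: mult.assoc)
  have norm_a: "l2sq d' (\<lambda>i. \<Sum>c<d. a [(j, l)] $$ (i, c) * x l c) = l2sq d (x l)" if "j < g'" "l < g" for j l
    using l2sq_cong[of d' _ "s j"] axs[OF that] s1 x1 that by simp
  \<comment> \<open>A contraction maps the unit vector \<open>x\<^sub>l\<close> to the unit vector \<open>s\<^sub>j\<close>, so its adjoint maps \<open>s\<^sub>j\<close> back to \<open>x\<^sub>l\<close>.\<close>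
  have asx: "(\<Sum>i<d'. cnj (s j i) * a [(j, l)] $$ (i, c)) = cnj (x l c)" if jl: "j < g'" "l < g" and c: "c < d" for j l c
  proof -
    define t where "t = (\<lambda>c. \<Sum>i<d'. cnj (s j i) * a [(j, l)] $$ (i, c))"
    have "l2sq d t \<le> l2sq d' (s j)"
      unfolding t_def by (rule nc_coeff_pairs[OF f a e[OF jl] order_refl jl(2,1)]) blast
    then have t1: "l2sq d t \<le> 1" using s1[OF jl(1)] by simp
    have "(\<Sum>c<d. t c * x l c) = (\<Sum>i<d'. cnj (s j i) * s j i)"
      unfolding t_def swap using axs[OF jl] by (intro sum.cong) auto
    then have "(\<Sum>c<d. t c * x l c) = 1" unfolding sum_cnj_self using s1[OF jl(1)] by simp
    then have "(\<Sum>c<d. cnj (cnj (x l c)) * t c) = 1" by (simp add: mult.commute)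
    then have "l2sq d (\<lambda>c. t c - cnj (x l c)) = l2sq d t + 1 - 2"
      by (simp only: l2sq_minus l2sq_cnj x1[OF jl(2)]) simp
    then have "l2sq d (\<lambda>c. t c - cnj (x l c)) = 0" using t1 l2sq_nonneg[of d "\<lambda>c. t c - cnj (x l c)"] by linarith
    then show ?thesis using c by (simp add: l2sq_eq_0_iff t_def)
  qed
  have norm_adj: "l2sq d (\<lambda>c. \<Sum>i<d'. cnj (s j i) * a [(j, l)] $$ (i, c)) = l2sq d' (s j)" if "j < g'" "l < g" for j l
    using l2sq_cong[of d _ "\<lambda>c. cnj (x l c)"] asx[OF that] s1 x1 that by (simp add: l2sq_cnj)
  have col: "(\<Sum>c<d. a w $$ (i, c) * x m c) = 0"
    if w: "w \<in> nc_words g' g k" and m: "m < g" and ne: "\<And>j. w \<noteq> [(j, m)]" and i: "i < d'" for w k m i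
  proof (cases "k = 0")
    case True
    then show ?thesis using w i by (simp add: nc_words_0 a0)
  next
    case False
    then show ?thesis
      using norm_a m by (intro nc_coeff_annihilates[OF f a g(2) w _ m _ ne i]) auto
  qed
  have row: "(\<Sum>i<d'. cnj (s m i) * a w $$ (i, c)) = 0"
    if w: "w \<in> nc_words g' g k" and m: "m < g'" and ne: "\<And>l. w \<noteq> [(m, l)]" and c: "c < d" for w k m c
  proof (cases "k = 0")
    case True
    then show ?thesis using w c by (simp add: nc_words_0 a0)
  next
    case False
    then show ?thesis
      using norm_adj m by (intro nc_coeff_adjoint_annihilates[OF f a g(1) w _ m _ ne c]) auto
  qed
  have "orthonormal d g x"
    unfolding orthonormal_def
  proof (intro allI impI)
    fix l m assume lm: "l < g" "m < g"
    have "(\<Sum>c<d. cnj (x l c) * x m c) = (\<Sum>c<d. (\<Sum>i<d'. cnj (s 0 i) * a [(0, l)] $$ (i, c)) * x m c)"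
      using asx[of 0 l] g lm by (intro sum.cong) auto
    also have "\<dots> = (\<Sum>i<d'. cnj (s 0 i) * (\<Sum>c<d. a [(0, l)] $$ (i, c) * x m c))" by (rule swap)
    also have "\<dots> = of_bool (l = m)"
    proof (cases "l = m")
      case True
      then have "(\<Sum>i<d'. cnj (s 0 i) * (\<Sum>c<d. a [(0, l)] $$ (i, c) * x m c)) = (\<Sum>i<d'. cnj (s 0 i) * s 0 i)"
        using axs[of 0 l] g lm by (intro sum.cong) auto
      then show ?thesis using True s1[of 0] g by (simp add: sum_cnj_self)
    next
      case False
      then show ?thesis using col[OF e[of 0 l] lm(2)] g lm by simp
    qed
    finally show "(\<Sum>c<d. cnj (x l c) * x m c) = of_bool (l = m)" .
  qed
  then obtain U where U: "unitary_mat d U" "\<And>l c. l < g \<Longrightarrow> c < d \<Longrightarrow> U $$ (c, l) = x l c" and gd: "g \<le> d"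
    using orthonormal_extend orthonormal_card_le by blast
  have "orthonormal d' g' s"
    unfolding orthonormal_def
  proof (intro allI impI)
    fix j m assume jm: "j < g'" "m < g'"
    have "(\<Sum>i<d'. cnj (s j i) * s m i) = (\<Sum>i<d'. cnj (s j i) * (\<Sum>c<d. a [(m, 0)] $$ (i, c) * x 0 c))"
      using axs[of m 0] g jm by (intro sum.cong) auto
    also have "\<dots> = (\<Sum>c<d. (\<Sum>i<d'. cnj (s j i) * a [(m, 0)] $$ (i, c)) * x 0 c)" by (rule swap[symmetric])
    also have "\<dots> = of_bool (j = m)"
    proof (cases "j = m")
      case True
      then have "(\<Sum>c<d. (\<Sum>i<d'. cnj (s j i) * a [(m, 0)] $$ (i, c)) * x 0 c) = (\<Sum>c<d. cnj (x 0 c) * x 0 c)"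
        using asx[of j 0] g jm by (intro sum.cong) auto
      then show ?thesis using True x1[of 0] g by (simp add: sum_cnj_self)
    next
      case False
      then show ?thesis using row[OF e[of m 0] jm(1)] g jm by simp
    qed
    finally show "(\<Sum>i<d'. cnj (s j i) * s m i) = of_bool (j = m)" .
  qed
  then obtain V where V: "unitary_mat d' V" "\<And>j i. j < g' \<Longrightarrow> i < d' \<Longrightarrow> V $$ (i, j) = s j i" and gd': "g' \<le> d'"
    using orthonormal_extend orthonormal_card_le by blast
  have Uc: "U \<in> carrier_mat d d" and UU: "mat_adjoint U * U = 1\<^sub>m d"
    and Vc: "V \<in> carrier_mat d' d'" and VV: "mat_adjoint V * V = 1\<^sub>m d'"
    using U(1) V(1) by (auto simp: unitary_mat_def)
  have Uorth: "(\<Sum>k<d. cnj (U $$ (k, l)) * U $$ (k, c)) = of_bool (l = c)" if "l < d" "c < d" for l c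
    using arg_cong[OF UU, of "\<lambda>M. M $$ (l, c)"] mat_mult_index[OF mat_adjoint_carrier[OF Uc] Uc that] that Uc by simp
  have Vorth: "(\<Sum>i<d'. cnj (V $$ (i, r)) * V $$ (i, j)) = of_bool (r = j)" if "r < d'" "j < d'" for r j
    using arg_cong[OF VV, of "\<lambda>M. M $$ (r, j)"] mat_mult_index[OF mat_adjoint_carrier[OF Vc] Vc that] that Vc by simp
  have "(mat_adjoint V * a w * U) $$ (r, c) = of_bool (w = [(r, c)])"
    if w: "w \<in> nc_words g' g k" and rc: "r < d'" "c < d" and or: "r < g' \<or> c < g" for k w r c
  proof -
    have aw: "a w \<in> carrier_mat d' d" by (rule nc_series_of_carrier[OF a w])
    have Va: "mat_adjoint V * a w \<in> carrier_mat d' d" using Vc aw by auto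
    have VaI: "(mat_adjoint V * a w) $$ (r, l) = (\<Sum>i<d'. cnj (V $$ (i, r)) * a w $$ (i, l))" if "l < d" for l
      using mat_mult_index[OF mat_adjoint_carrier[OF Vc] aw rc(1) that] rc Vc by simp
    have "(mat_adjoint V * a w * U) $$ (r, c)
        = (\<Sum>l<d. (\<Sum>i<d'. cnj (V $$ (i, r)) * a w $$ (i, l)) * U $$ (l, c))"
      unfolding mat_mult_index[OF Va Uc rc] using VaI by simp
    also have "\<dots> = of_bool (w = [(r, c)])"
    proof (cases "r < g'")
      case True
      have Vs: "(\<Sum>i<d'. cnj (V $$ (i, r)) * a w $$ (i, l)) = (\<Sum>i<d'. cnj (s r i) * a w $$ (i, l))" for l
        using V(2)[OF True] by (intro sum.cong) auto
      show ?thesis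
      proof (cases "\<exists>l. w = [(r, l)]")
        case True
        then obtain l where l: "w = [(r, l)]" by blast
        then have lg: "l < g" using w by (auto simp: nc_words_def)
        have "(\<Sum>i<d'. cnj (s r i) * a w $$ (i, l')) = cnj (U $$ (l', l))" if "l' < d" for l'
          using asx[OF \<open>r < g'\<close> lg that] U(2)[OF lg that] by (simp add: l)
        then show ?thesis unfolding Vs using Uorth[of l c] lg gd rc by (simp add: l)
      next
        case False
        then show ?thesis unfolding Vs using row[OF w \<open>r < g'\<close>] by simp
      qed
    next
      case False
      then have c: "c < g" using or by simp
      have "(\<Sum>l<d. (\<Sum>i<d'. cnj (V $$ (i, r)) * a w $$ (i, l)) * U $$ (l, c))
          = (\<Sum>i<d'. cnj (V $$ (i, r)) * (\<Sum>l<d. a w $$ (i, l) * x c l))"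
        unfolding swap using U(2)[OF c] by (intro sum.cong refl arg_cong2[where f = "(*)"]) auto
      also have "\<dots> = of_bool (w = [(r, c)])"
      proof (cases "\<exists>j. w = [(j, c)]")
        case True
        then obtain j where j: "w = [(j, c)]" by blast
        then have jg: "j < g'" using w by (auto simp: nc_words_def)
        have "(\<Sum>i<d'. cnj (V $$ (i, r)) * (\<Sum>l<d. a w $$ (i, l) * x c l))
            = (\<Sum>i<d'. cnj (V $$ (i, r)) * V $$ (i, j))"
          using axs[OF jg c] V(2)[OF jg] by (intro sum.cong) (auto simp: j)
        then show ?thesis using Vorth[of r j] jg gd' rc by (auto simp: j)
      next
        case False
        then show ?thesis using col[OF w c] by simp
      qed
      finally show ?thesis .
    qed
    finally show ?thesis .
  qed
  with gd gd' U(1) V(1) show thesis by (rule that)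
qed

text \<open>\<open>ht\<close> is the compression of \<open>h\<close> to the last \<open>d' - g'\<close> columns of \<open>V\<close> and the last \<open>d - g\<close> columns of
  \<open>U\<close>; so its analyticity and contractivity are inherited from \<open>h\<close>.\<close>

lemma nc_ball_map_block_identity:
  assumes h: "nc_ball_map g' g d' d h" and h0: "h (0\<^sub>m g' g) = 0\<^sub>m d' d" and g: "1 \<le> g'" "1 \<le> g"
  shows "\<exists>U V ht. unitary_mat d U \<and> unitary_mat d' V \<and>
           nc_analytic g' g (d' - g') (d - g) ht \<and> nc_contractive g' g ht \<and>
           ht (0\<^sub>m g' g) = 0\<^sub>m (d' - g') (d - g) \<and> nc_block_identity g' g d' d h V U ht"
proof -
  have f: "nc_analytic g' g d' d h" "nc_contractive g' g h" using h by (auto simp: nc_ball_map_def)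
  obtain a where a: "nc_series_of g' g d' d h a"
    using f(1) unfolding nc_analytic_def nc_has_power_series_iff by blast
  have hcar: "h X \<in> carrier_mat (d' * N) (d * N)" if "N \<ge> 1" "X \<in> nc_int_ball g' g N" for N X
    using f that by (auto simp: nc_analytic_def)
  obtain U V where gd: "g \<le> d" "g' \<le> d'" and U: "unitary_mat d U" and V: "unitary_mat d' V"
    and b: "\<And>k w r c. w \<in> nc_words g' g k \<Longrightarrow> r < d' \<Longrightarrow> c < d \<Longrightarrow> r < g' \<or> c < g \<Longrightarrow>
      (mat_adjoint V * a w * U) $$ (r, c) = of_bool (w = [(r, c)])"
    by (rule nc_ball_map_coefficients[OF h h0 g(2,1) a]) blast
  have Uc: "U \<in> carrier_mat d d" and UU: "U * mat_adjoint U = 1\<^sub>m d" "mat_adjoint U * U = 1\<^sub>m d"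
    and Vc: "V \<in> carrier_mat d' d'" and VV: "V * mat_adjoint V = 1\<^sub>m d'" "mat_adjoint V * V = 1\<^sub>m d'"
    using U V by (auto simp: unitary_mat_def)
  have Vac: "mat_adjoint V \<in> carrier_mat d' d'" using Vc by auto
  let ?T = "nc_compress_fun g' (mat_adjoint V) U h"
  have T: "nc_analytic g' g d' d ?T" by (rule nc_analytic_compress[OF g(1) Vac Uc f(1)])
  have Tser: "nc_series_of g' g d' d ?T (\<lambda>w. mat_adjoint V * a w * U)"
    by (rule nc_series_of_compress[OF g(1) Vac Uc a hcar])
  define P where "P = Matrix.mat (d' - g') d' (\<lambda>(r, i). cnj (V $$ (i, g' + r)))"
  define Q where "Q = Matrix.mat d (d - g) (\<lambda>(k, c). U $$ (k, g + c))"
  have P: "P \<in> carrier_mat (d' - g') d'" and Q: "Q \<in> carrier_mat d (d - g)" by (auto simp: P_def Q_def)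
  have PP: "P * mat_adjoint P = 1\<^sub>m (d' - g')"
  proof (rule eq_matI)
    fix r r' assume "r < dim_row (1\<^sub>m (d' - g') :: complex mat)" "r' < dim_col (1\<^sub>m (d' - g') :: complex mat)"
    then have r: "r < d' - g'" "r' < d' - g'" "g' + r < d'" "g' + r' < d'" by auto
    have "(P * mat_adjoint P) $$ (r, r') = (\<Sum>i<d'. cnj (V $$ (i, g' + r)) * V $$ (i, g' + r'))"
      using mat_mult_index[OF P mat_adjoint_carrier[OF P] r(1,2)] r by (simp add: P_def)
    also have "\<dots> = (mat_adjoint V * V) $$ (g' + r, g' + r')"
      using mat_mult_index[OF Vac Vc r(3,4)] r Vc by simp
    finally show "(P * mat_adjoint P) $$ (r, r') = 1\<^sub>m (d' - g') $$ (r, r')" using r by (simp add: VV)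
  qed (use P in auto)
  have QQ: "mat_adjoint Q * Q = 1\<^sub>m (d - g)"
  proof (rule eq_matI)
    fix r r' assume "r < dim_row (1\<^sub>m (d - g) :: complex mat)" "r' < dim_col (1\<^sub>m (d - g) :: complex mat)"
    then have r: "r < d - g" "r' < d - g" "g + r < d" "g + r' < d" by auto
    have "(mat_adjoint Q * Q) $$ (r, r') = (\<Sum>i<d. cnj (U $$ (i, g + r)) * U $$ (i, g + r'))"
      using mat_mult_index[OF mat_adjoint_carrier[OF Q] Q r(1,2)] r by (simp add: Q_def)
    also have "\<dots> = (mat_adjoint U * U) $$ (g + r, g + r')"
      using mat_mult_index[OF mat_adjoint_carrier[OF Uc] Uc r(3,4)] r Uc by simp
    finally show "(mat_adjoint Q * Q) $$ (r, r') = 1\<^sub>m (d - g) $$ (r, r')" using r by (simp add: UU)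
  qed (use Q in auto)
  let ?ht = "nc_compress_fun g' P Q h"
  have ht: "nc_analytic g' g (d' - g') (d - g) ?ht" by (rule nc_analytic_compress[OF g(1) P Q f(1)])
  have htc: "nc_contractive g' g ?ht" by (rule nc_contractive_compress[OF g(1) P Q f PP QQ])
  have B0: "0\<^sub>m g' g \<in> nc_int_ball g' g 1" by (simp add: nc_int_ball_def)
  have ht0: "?ht (0\<^sub>m g' g) = 0\<^sub>m (d' - g') (d - g)"
  proof -
    have "kron P (1\<^sub>m 1) \<in> carrier_mat (d' - g') d'" "kron Q (1\<^sub>m 1) \<in> carrier_mat d (d - g)"
      using kron_carrier[OF P, of "1\<^sub>m 1" 1 1] kron_carrier[OF Q, of "1\<^sub>m 1" 1 1] by auto
    then show ?thesis by (simp add: nc_compress_fun_eq[OF g(1) B0] nc_compress_def h0)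
  qed
  have "nc_block_identity g' g d' d h V U ?ht"
    unfolding nc_block_identity_def
  proof (intro conjI gd allI impI ballI)
    fix N X assume N: "1 \<le> N" and X: "X \<in> nc_int_ball g' g N"
    have Xc: "X \<in> carrier_mat (g' * N) (g * N)" and X1: "mat_opnorm X < 1"
      using X by (auto simp: nc_int_ball_def)
    have hX: "h X \<in> carrier_mat (d' * N) (d * N)" by (rule hcar[OF N X])
    have htX: "?ht X \<in> carrier_mat ((d' - g') * N) ((d - g) * N)" using ht N X by (auto simp: nc_analytic_def)
    define Z where "Z = four_block_mat X (0\<^sub>m (g' * N) ((d - g) * N)) (0\<^sub>m ((d' - g') * N) (g * N)) (?ht X)"
    have dims: "g' * N + (d' - g') * N = d' * N" "g * N + (d - g) * N = d * N"
      using gd by (simp_all flip: distrib_right)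
    have Zc: "Z \<in> carrier_mat (d' * N) (d * N)"
      unfolding Z_def using four_block_carrier_mat[OF Xc htX] dims by simp
    have TX: "?T X \<in> carrier_mat (d' * N) (d * N)" using T N X by (auto simp: nc_analytic_def)
    \<comment> \<open>The radius \<open>2 / (1 + \<parallel>X\<parallel>)\<close> exceeds 1, so the line through \<open>X\<close> can be followed from 0 past \<open>X\<close>.\<close>
    define R where "R = 2 / (1 + mat_opnorm X)"
    have pos: "0 < 1 + mat_opnorm X" using mat_opnorm_nonneg[of X] by linarith
    have R: "1 < R" "mat_opnorm X * R \<le> 1" using X1 pos by (auto simp: R_def field_simps)
    have outer: "?T X $$ (r * N + p, c * N + q) = (if r < g' \<and> c < g then X $$ (r * N + p, c * N + q) else 0)"
      if r: "r < d'" "p < N" and c: "c < d" "q < N" and or: "r < g' \<or> c < g" for r p c q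
    proof -
      let ?E = "if r < g' \<and> c < g then X $$ (r * N + p, c * N + q) else 0"
      have IJ: "r * N + p < d' * N" "c * N + q < d * N" using r c by (simp_all add: block_index_less)
      have "?T (1 \<cdot>\<^sub>m X) $$ (r * N + p, c * N + q) = 1 * ?E"
      proof (rule nc_entry_eq_on_line[OF T Tser N Xc _ R(2) IJ, where G = "\<lambda>z. z * ?E"])
        fix z
        have Hk: "nc_homogeneous g' g d' d (\<lambda>w. mat_adjoint V * a w * U) k N (z \<cdot>\<^sub>m X) $$ (r * N + p, c * N + q)
            = of_bool (k = 1) * (z * ?E)" for k
        proof -
          have "nc_homogeneous g' g d' d (\<lambda>w. mat_adjoint V * a w * U) k N (z \<cdot>\<^sub>m X) $$ (r * N + p, c * N + q)
            = (\<Sum>w\<in>nc_words g' g k. of_bool (w = [(r, c)]) * word_eval N w (z \<cdot>\<^sub>m X) $$ (p, q))"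
            using r c or b by (subst nc_homogeneous_index[OF nc_series_of_carrier[OF Tser]]) auto
          also have "\<dots> = (\<Sum>w\<in>nc_words g' g k \<inter> {[(r, c)]}. word_eval N w (z \<cdot>\<^sub>m X) $$ (p, q))"
            by (intro sum.mono_neutral_cong_right) auto
          also have "\<dots> = of_bool (k = 1) * (z * ?E)"
          proof (cases "k = 1 \<and> r < g' \<and> c < g")
            case True
            then have "nc_words g' g k \<inter> {[(r, c)]} = {[(r, c)]}" by (auto simp: nc_words_def)
            moreover have "word_eval N [(r, c)] (z \<cdot>\<^sub>m X) $$ (p, q) = z * X $$ (r * N + p, c * N + q)"
              unfolding word_eval_single using True r c Xc by (simp add: nc_block_def block_index_less)
            ultimately show ?thesis using True by (simp del: word_eval_Cons)
          next
            case False
            then have "nc_words g' g k \<inter> {[(r, c)]} = {}" by (auto simp: nc_words_def)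
            then show ?thesis using False by auto
          qed
          finally show ?thesis .
        qed
        show "\<forall>\<^sub>F n in sequentially.
            nc_partial_sum g' g d' d (\<lambda>w. mat_adjoint V * a w * U) n N (z \<cdot>\<^sub>m X) $$ (r * N + p, c * N + q) = z * ?E"
          unfolding eventually_sequentially
        proof (intro exI[of _ 2] allI impI)
          fix n :: nat assume n: "2 \<le> n"
          have "nc_partial_sum g' g d' d (\<lambda>w. mat_adjoint V * a w * U) n N (z \<cdot>\<^sub>m X) $$ (r * N + p, c * N + q)
              = (\<Sum>k<n. (z * ?E) * of_bool (k = 1))"
            unfolding nc_partial_sum_index[OF IJ] Hk by (simp only: mult.commute)
          then show "nc_partial_sum g' g d' d (\<lambda>w. mat_adjoint V * a w * U) n N (z \<cdot>\<^sub>m X) $$ (r * N + p, c * N + q)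
              = z * ?E"
            using n by (simp only: sum_of_bool_mult)
        qed
      qed (use R in \<open>auto intro!: holomorphic_intros\<close>)
      moreover have "1 \<cdot>\<^sub>m X = X" by (rule eq_matI) auto
      ultimately show ?thesis by simp
    qed
    have "?T X = Z"
    proof (rule block_mat_eqI[OF TX Zc])
      fix r p c q assume rc: "r < d'" "p < N" "c < d" "q < N"
      have row: "(r * N + p < g' * N) = (r < g')" if "p < N" for r p g'
        using that by (metis block_index_less div_mult_self3 less_mult_imp_div_less div_less add_0_right
            mult.commute not_less_zero gr_zeroI)
      have bound: "r * N + p < g' * N + (d' - g') * N" "c * N + q < g * N + (d - g) * N"
        unfolding dims using rc by (simp_all add: block_index_less)
      have Zent: "Z $$ (r * N + p, c * N + q)
          = (if r < g' then if c < g then X $$ (r * N + p, c * N + q) else 0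
             else if c < g then 0 else ?ht X $$ ((r - g') * N + p, (c - g) * N + q))"
      proof -
        have sub: "r * N + p - g' * N = (r - g') * N + p" if "\<not> r < g'" for r p g'
          using that by (simp add: diff_mult_distrib)
        have in0: "(r - g') * N + p < (d' - g') * N" if "\<not> r < g'"
          using that rc by (intro block_index_less) auto
        have in1: "(c - g) * N + q < (d - g) * N" if "\<not> c < g"
          using that rc by (intro block_index_less) auto
        show ?thesis
          unfolding Z_def using Xc htX bound rc in0 in1 sub
          by (subst index_mat_four_block) (auto simp: row)
      qed
      show "?T X $$ (r * N + p, c * N + q) = Z $$ (r * N + p, c * N + q)"
      proof (cases "r < g' \<or> c < g")
        case True
        then show ?thesis using outer[OF rc True] by (auto simp: Zent)
      next
        case False
        then have r': "r - g' < d' - g'" "c - g < d - g" using rc by auto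
        have "?ht X $$ ((r - g') * N + p, (c - g) * N + q)
            = (\<Sum>i<d'. \<Sum>k<d. P $$ (r - g', i) * h X $$ (i * N + p, k * N + q) * Q $$ (k, c - g))"
          unfolding nc_compress_fun_eq[OF g(1) X] by (rule nc_compress_index[OF P Q hX r'(1) rc(2) r'(2) rc(4)])
        also have "\<dots> = (\<Sum>i<d'. \<Sum>k<d. mat_adjoint V $$ (r, i) * h X $$ (i * N + p, k * N + q) * U $$ (k, c))"
          using False rc r' Vc by (intro sum.cong refl) (simp add: P_def Q_def)
        also have "\<dots> = ?T X $$ (r * N + p, c * N + q)"
          unfolding nc_compress_fun_eq[OF g(1) X] by (rule nc_compress_index[OF Vac Uc hX rc, symmetric])
        finally show ?thesis using False by (simp add: Zent)
      qed
    qed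
    then have TZ: "kron (mat_adjoint V) (1\<^sub>m N) * h X * kron U (1\<^sub>m N) = Z"
      by (simp add: nc_compress_fun_eq[OF g(1) X] nc_compress_def)
    define kV where "kV = kron V (1\<^sub>m N)"
    define kU where "kU = kron U (1\<^sub>m N)"
    have kc: "kV \<in> carrier_mat (d' * N) (d' * N)" "kU \<in> carrier_mat (d * N) (d * N)"
      using Uc Vc by (auto simp: kV_def kU_def)
    have kk: "kV * mat_adjoint kV = 1\<^sub>m (d' * N)" "kU * mat_adjoint kU = 1\<^sub>m (d * N)"
      unfolding kV_def kU_def adjoint_kron[OF Vc] adjoint_kron[OF Uc]
      using Vc Uc by (simp_all add: kron_mult[of _ d' d' _ N N _ d' _ N] kron_mult[of _ d d _ N N _ d _ N]
          VV UU kron_one)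
    have "kV * Z * mat_adjoint kU = (kV * mat_adjoint kV) * h X * (kU * mat_adjoint kU)"
      unfolding TZ[symmetric] adjoint_kron[OF Vc, symmetric] kV_def[symmetric] kU_def[symmetric]
      using kc hX
      by (simp add: assoc_mult_mat[of _ "d' * N" "d' * N" _ "d' * N" _ "d * N"]
          assoc_mult_mat[of _ "d' * N" "d' * N" _ "d * N" _ "d * N"]
          assoc_mult_mat[of _ "d' * N" "d * N" _ "d * N" _ "d * N"] mult_carrier_mat[of _ _ "d' * N"]
          mult_carrier_mat[of _ _ "d * N"])
    then have "kV * Z * mat_adjoint kU = h X" using hX by (simp add: kk)
    then show "h X = kron V (1\<^sub>m N) *
        four_block_mat X (0\<^sub>m (g' * N) ((d - g) * N)) (0\<^sub>m ((d' - g') * N) (g * N)) (?ht X) *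
        mat_adjoint (kron U (1\<^sub>m N))"
      by (simp add: kV_def kU_def Z_def)
  qed
  with U V ht htc ht0 show ?thesis by blast
qed

theorem theorem1p3:
  fixes g' g d' d :: nat
  assumes "1 \<le> g'" and "1 \<le> g" and "1 \<le> d'" and "1 \<le> d"
  shows
    "(\<forall>h. nc_ball_map g' g d' d h \<and> h (0\<^sub>m g' g) = 0\<^sub>m d' d \<longrightarrow>
        (\<exists>U V ht. unitary_mat d U \<and> unitary_mat d' V \<and>
           nc_analytic g' g (d' - g') (d - g) ht \<and> nc_contractive g' g ht \<and>
           ht (0\<^sub>m g' g) = 0\<^sub>m (d' - g') (d - g) \<and>
           nc_block_identity g' g d' d h V U ht)) \<and>
     (\<forall>h U V ht.
        nc_analytic g' g d' d h \<and> unitary_mat d U \<and> unitary_mat d' V \<and>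
        nc_analytic g' g (d' - g') (d - g) ht \<and> nc_contractive g' g ht \<and>
        ht (0\<^sub>m g' g) = 0\<^sub>m (d' - g') (d - g) \<and>
        nc_block_identity g' g d' d h V U ht \<longrightarrow>
        nc_ball_map g' g d' d h \<and> h (0\<^sub>m g' g) = 0\<^sub>m d' d)"
proof (intro conjI allI impI; (elim conjE)?)
  fix h assume "nc_ball_map g' g d' d h" "h (0\<^sub>m g' g) = 0\<^sub>m d' d"
  then show "\<exists>U V ht. unitary_mat d U \<and> unitary_mat d' V \<and>
      nc_analytic g' g (d' - g') (d - g) ht \<and> nc_contractive g' g ht \<and>
      ht (0\<^sub>m g' g) = 0\<^sub>m (d' - g') (d - g) \<and> nc_block_identity g' g d' d h V U ht"
    using assms(1,2) by (rule nc_ball_map_block_identity)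
next
  fix h U V ht
  assume h: "nc_analytic g' g d' d h" and U: "unitary_mat d U" and V: "unitary_mat d' V"
    and ht: "nc_analytic g' g (d' - g') (d - g) ht" "nc_contractive g' g ht"
      "ht (0\<^sub>m g' g) = 0\<^sub>m (d' - g') (d - g)"
    and id: "nc_block_identity g' g d' d h V U ht"
  show "nc_ball_map g' g d' d h" by (rule nc_block_identity_ball_map[OF assms(1) h U V ht(1,2) id])
  show "h (0\<^sub>m g' g) = 0\<^sub>m d' d" by (rule nc_block_identity_zero[OF id U V ht(3)])
qed

end
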